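(* As $n\to\infty$, the metric spaces $\mathcal{UCP}_{\mathcal{K}}(\mathcal{T}_n)$ converge to $\mathcal{UCP}_{\mathcal{K}}(C(S^1))$ in the Gromov-Hausdorff distance.
   Context: $\mathcal{K}$ is a complex separable Hilbert space and $\{k_p:p\in\mathbb{N}\}$ is a fixed dense subset of its closed unit ball. For a closed operator system $E$, $\mathcal{UCP}_{\mathcal{K}}(E)$ is the set of all unital completely positive maps $E\to\mathcal{B}(\mathcal{K})$. Let $D=-i\frac{d}{d\theta}$ on $L^2(S^1)$, where $C(S^1)$ acts by multiplication operators $M_f$. Let $e_k$ be the function $z^k$ on the unit circle, $\mathcal{H}_n=\mathrm{span}\{e_1,\dots,e_n\}$ and $P_n$ the orthogonal projection of $L^2(S^1)$ onto $\mathcal{H}_n$. Let $\mathcal{T}_n=\{P_nM_f|_{\mathcal{H}_n}:f\in C^\infty(S^1)\}\subseteq\mathcal{B}(\mathcal{H}_n)$; in the basis $e_1,\dots,e_n$ this is the operator system of all $n\times n$ complex Toeplitz matrices. Let $D_n=P_nD|_{\mathcal{H}_n}$. The metrics used are as follows. $\mathcal{UCP}_{\mathcal{K}}(E)$ carries the metric $$d_E(\phi,\psi)=\sup\Big\{\sum_{p=1}^\infty\frac{1}{2^p}|\langle(\phi-\psi)(f)k_p,k_p\rangle| : f\in\mathcal{E},\ \|f\|\le1,\ \|f\|_1\le1\Big\},$$ where for $E=C(S^1)$ one takes $\mathcal{E}=C^\infty(S^1)$ and $\|f\|_1=\|[D,f]\|$, and for $E=\mathcal{T}_n$ one takes $\mathcal{E}=\mathcal{T}_n$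 and $\|T\|_1=\|[D_n,T]\|$. The Gromov-Hausdorff distance between compact metric spaces is the infimum of the Hausdorff distances between their images under isometric embeddings into a common compact metric space. *)

theory Defs
  imports "HOL-Analysis.Analysis" "HOL-Library.Nonpos_Ints"
begin

section \<open>Complex Hilbert spaces\<close>

text \<open>The inner product is linear in its first argument. The axiom \<open>cinner_self\<close> makes it
  positive definite and makes the norm the induced one; completeness comes from \<^class>\<open>banach\<close>.\<close>

class complex_hilbert = banach +
  fixes scaleC :: "complex \<Rightarrow> 'a \<Rightarrow> 'a" (infixr \<open>*\<^sub>C\<close> 75)
    and cinner :: "'a \<Rightarrow> 'a \<Rightarrow> complex"
  assumes scaleC_add_right: "c *\<^sub>C (x + y) = c *\<^sub>C x + c *\<^sub>C y"
    and scaleC_add_left: "(c + d) *\<^sub>C x = c *\<^sub>C x + d *\<^sub>C x"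
    and scaleC_scaleC: "c *\<^sub>C (d *\<^sub>C x) = (c * d) *\<^sub>C x"
    and scaleC_of_real: "complex_of_real r *\<^sub>C x = r *\<^sub>R x"
    and cinner_add_left: "cinner (x + y) z = cinner x z + cinner y z"
    and cinner_scaleC_left: "cinner (c *\<^sub>C x) y = c * cinner x y"
    and cinner_commute: "cinner x y = cnj (cinner y x)"
    and cinner_self: "cinner x x = complex_of_real ((norm x)\<^sup>2)"

definition bounded_clinear :: "('k::complex_hilbert \<Rightarrow> 'k) \<Rightarrow> bool" where
  "bounded_clinear A \<longleftrightarrow> bounded_linear A \<and> (\<forall>c x. A (c *\<^sub>C x) = c *\<^sub>C A x)"


section \<open>The circle\<close>

text \<open>Functions on the circle are functions of the angle, that is, functions on the real line of
  period \<open>2 * pi\<close>. Elements of the Hilbert space of square integrable functions are represented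
  by functions rather than classes of functions, so \<open>L2_inner\<close> is only semidefinite. It is
  normalised so that the \<open>fourier_basis k\<close> are orthonormal.\<close>

type_synonym circle_fun = "real \<Rightarrow> complex"
type_synonym circle_op = "circle_fun \<Rightarrow> circle_fun"

definition periodic :: "circle_fun \<Rightarrow> bool" where
  "periodic g \<longleftrightarrow> (\<forall>\<theta>. g (\<theta> + 2 * pi) = g \<theta>)"

definition C_circle :: "circle_fun set" where
  "C_circle = {f. periodic f \<and> continuous_on UNIV f}"

definition Cinf_circle :: "circle_fun set" where
  "Cinf_circle = {f. periodic f \<and>
     (\<forall>j \<theta>. ((\<lambda>g t. vector_derivative g (at t)) ^^ j) f differentiable (at \<theta>))}"

definition L2_circle :: "circle_fun set" where
  "L2_circle = {g. periodic g \<and> g \<in> borel_measurable borel \<and>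
     set_integrable lborel {0..2*pi} (\<lambda>\<theta>. (cmod (g \<theta>))\<^sup>2)}"

definition L2_inner :: "circle_fun \<Rightarrow> circle_fun \<Rightarrow> complex" where
  "L2_inner g h = (LINT \<theta>:{0..2*pi}|lborel. g \<theta> * cnj (h \<theta>)) / complex_of_real (2 * pi)"

definition L2_norm :: "circle_fun \<Rightarrow> real" where
  "L2_norm g = sqrt (Re (L2_inner g g))"

definition fourier_basis :: "nat \<Rightarrow> circle_fun" where
  "fourier_basis k \<theta> = cis (real k * \<theta>)"

definition H_trunc :: "nat \<Rightarrow> circle_fun set" where
  "H_trunc n = {\<lambda>\<theta>. \<Sum>k=1..n. c k * fourier_basis k \<theta> | c. True}"

text \<open>The orthogonal projection onto \<open>H_trunc n\<close>.\<close>

definition P_trunc :: "nat \<Rightarrow> circle_op" where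
  "P_trunc n g = (THE h. h \<in> H_trunc n \<and>
     (\<forall>u \<in> H_trunc n. L2_inner (\<lambda>\<theta>. g \<theta> - h \<theta>) u = 0))"


section \<open>Operators\<close>

text \<open>An operator on a subspace \<open>H\<close> of \<open>L2_circle\<close> is represented by its extension by zero off \<open>H\<close>,
  so that equality and pointwise linear combinations are those of operators on \<open>H\<close>.\<close>

definition op_on :: "circle_fun set \<Rightarrow> circle_op \<Rightarrow> circle_op" where
  "op_on H T = (\<lambda>g. if g \<in> H then T g else (\<lambda>_. 0))"

text \<open>The operator norm of an operator with domain \<open>H\<close>. If \<open>H\<close> is merely dense
  in a Hilbert space, this is the norm of the bounded extension.\<close>

definition op_norm :: "circle_fun set \<Rightarrow> circle_op \<Rightarrow> real" where
  "op_norm H T = Sup {L2_norm (T g) | g. g \<in> H \<and> L2_norm g \<le> 1}"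

definition commutator :: "circle_op \<Rightarrow> circle_op \<Rightarrow> circle_op" where
  "commutator A T = (\<lambda>g \<theta>. A (T g) \<theta> - T (A g) \<theta>)"

definition mult_op :: "circle_fun \<Rightarrow> circle_op" where
  "mult_op f = op_on L2_circle (\<lambda>g \<theta>. f \<theta> * g \<theta>)"

text \<open>The operator \<open>D = -i d/d\<theta>\<close>, to be used on the core \<open>Cinf_circle\<close>.\<close>

definition D_circle :: circle_op where
  "D_circle g = (\<lambda>\<theta>. - \<i> * vector_derivative g (at \<theta>))"

definition D_trunc :: "nat \<Rightarrow> circle_op" where
  "D_trunc n = op_on (H_trunc n) (\<lambda>g. P_trunc n (D_circle g))"


section \<open>The operator systems and their Lipschitz seminorms\<close>

definition C_sys :: "circle_op set" where
  "C_sys = mult_op ` C_circle"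

definition Cinf_sys :: "circle_op set" where
  "Cinf_sys = mult_op ` Cinf_circle"

definition lip_C :: "circle_op \<Rightarrow> real" where
  "lip_C T = op_norm Cinf_circle (commutator D_circle T)"

definition Toeplitz_sys :: "nat \<Rightarrow> circle_op set" where
  "Toeplitz_sys n = {op_on (H_trunc n) (\<lambda>g. P_trunc n (mult_op f g)) | f. f \<in> Cinf_circle}"

definition lip_Toeplitz :: "nat \<Rightarrow> circle_op \<Rightarrow> real" where
  "lip_Toeplitz n T = op_norm (H_trunc n) (commutator (D_trunc n) T)"


section \<open>Unital completely positive maps\<close>

text \<open>Positivity of an \<open>m \<times> m\<close> matrix of operators on the space \<open>V\<close> with inner product \<open>ip\<close>, as
  an operator on the direct sum of \<open>m\<close> copies of \<open>V\<close>.\<close>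

definition mat_positive ::
  "'v set \<Rightarrow> ('v \<Rightarrow> 'v \<Rightarrow> complex) \<Rightarrow> nat \<Rightarrow> (nat \<Rightarrow> nat \<Rightarrow> 'v \<Rightarrow> 'v) \<Rightarrow> bool" where
  "mat_positive V ip m X \<longleftrightarrow> (\<forall>h. (\<forall>i<m. h i \<in> V) \<longrightarrow>
     (\<Sum>i<m. \<Sum>j<m. ip (X i j (h j)) (h i)) \<in> \<real>\<^sub>\<ge>\<^sub>0)"

text \<open>Here \<open>E\<close> is an operator system of operators on \<open>H\<close>. Its unit is \<open>op_on H id\<close>. Maps on \<open>E\<close>
  are extensional, so that equality is equality on \<open>E\<close>.\<close>

definition UCP :: "circle_fun set \<Rightarrow> circle_op set \<Rightarrow>
    (circle_op \<Rightarrow> 'k \<Rightarrow> 'k::complex_hilbert) set" where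
  "UCP H E = {\<phi> \<in> extensional E.
     (\<forall>T\<in>E. bounded_clinear (\<phi> T)) \<and>
     (\<forall>S\<in>E. \<forall>T\<in>E. \<phi> (\<lambda>g \<theta>. S g \<theta> + T g \<theta>) = (\<lambda>x. \<phi> S x + \<phi> T x)) \<and>
     (\<forall>c. \<forall>T\<in>E. \<phi> (\<lambda>g \<theta>. c * T g \<theta>) = (\<lambda>x. c *\<^sub>C \<phi> T x)) \<and>
     \<phi> (op_on H id) = id \<and>
     (\<forall>m X. (\<forall>i<m. \<forall>j<m. X i j \<in> E) \<and> mat_positive H L2_inner m X \<longrightarrow>
        mat_positive UNIV cinner m (\<lambda>i j. \<phi> (X i j)))}"

text \<open>The metric determined by the sequence \<open>k 1, k 2, \<dots>\<close>, the dense subspace \<open>E0\<close> of \<open>E\<close> and the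
  seminorm \<open>L\<close> on \<open>E0\<close>. It is set to \<open>0\<close> off \<open>UCP H E\<close> only because \<^locale>\<open>Metric_space\<close> demands
  nonnegativity outside the carrier as well.\<close>

definition UCP_dist :: "(nat \<Rightarrow> 'k::complex_hilbert) \<Rightarrow> circle_fun set \<Rightarrow> circle_op set \<Rightarrow>
    circle_op set \<Rightarrow> (circle_op \<Rightarrow> real) \<Rightarrow>
    (circle_op \<Rightarrow> 'k \<Rightarrow> 'k) \<Rightarrow> (circle_op \<Rightarrow> 'k \<Rightarrow> 'k) \<Rightarrow> real" where
  "UCP_dist k H E E0 L \<phi> \<psi> =
     (if \<phi> \<in> UCP H E \<and> \<psi> \<in> UCP H E
      then Sup {\<Sum>p. 1 / 2 ^ Suc p * cmod (cinner (\<phi> T (k (Suc p)) - \<psi> T (k (Suc p))) (k (Suc p)))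
                | T. T \<in> E0 \<and> op_norm H T \<le> 1 \<and> L T \<le> 1}
      else 0)"


section \<open>Gromov-Hausdorff distance\<close>

definition compact_metric :: "'a set \<Rightarrow> ('a \<Rightarrow> 'a \<Rightarrow> real) \<Rightarrow> bool" where
  "compact_metric X d \<longleftrightarrow> Metric_space X d \<and> compact_space (Metric_space.mtopology X d)"

definition isometric_embedding :: "'a set \<Rightarrow> ('a \<Rightarrow> 'a \<Rightarrow> real) \<Rightarrow> 'b set \<Rightarrow> ('b \<Rightarrow> 'b \<Rightarrow> real) \<Rightarrow>
    ('a \<Rightarrow> 'b) \<Rightarrow> bool" where
  "isometric_embedding X dX Z dZ f \<longleftrightarrow>
     f \<in> X \<rightarrow> Z \<and> (\<forall>x\<in>X. \<forall>y\<in>X. dZ (f x) (f y) = dX x y)"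

definition Hausdorff_dist :: "('a \<Rightarrow> 'a \<Rightarrow> real) \<Rightarrow> 'a set \<Rightarrow> 'a set \<Rightarrow> ennreal" where
  "Hausdorff_dist d A B =
     max (SUP a\<in>A. INF b\<in>B. ennreal (d a b)) (SUP b\<in>B. INF a\<in>A. ennreal (d a b))"

text \<open>The common space ranges over compact metric spaces with carrier in the sum type. This loses
  nothing: a common space can be cut down to the union of the two images, which is compact and
  injects into \<open>'a + 'b\<close>. The distance is a notion for compact metric spaces; its value is \<open>\<infinity>\<close> if
  one of the arguments is not a compact metric space, so that convergence to \<open>0\<close> has content.\<close>

definition GH_dist :: "'a set \<Rightarrow> ('a \<Rightarrow> 'a \<Rightarrow> real) \<Rightarrow> 'b set \<Rightarrow> ('b \<Rightarrow> 'b \<Rightarrow> real) \<Rightarrow> ennreal" where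
  "GH_dist X dX Y dY =
     (if compact_metric X dX \<and> compact_metric Y dY
      then Inf {Hausdorff_dist dZ (f ` X) (g ` Y) | (Z :: ('a + 'b) set) dZ f g.
                compact_metric Z dZ \<and>
                isometric_embedding X dX Z dZ f \<and> isometric_embedding Y dY Z dZ g}
      else \<infinity>)"

end

theory Submission
  imports Defs
begin

text \<open>
  Write \<open>R n\<close> for the compression of multiplication operators to \<open>H_trunc n\<close> (\<open>compress n\<close>), and \<open>S n\<close>
  for the map that sends an operator \<open>T\<close> on \<open>H_trunc n\<close> to multiplication by its lower symbol
  \<open>\<theta> \<mapsto> \<langle>T v, v\<rangle> / n\<close> (\<open>symbol_op n\<close>), where \<open>v = coherent n \<theta>\<close> is the vector whose squared modulus is
  \<open>n\<close> times the Fejer kernel centred at \<open>\<theta>\<close>. Both are unital and completely positive, so composition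
  with them carries unital completely positive maps to such maps, in both directions. Neither
  increases the norm or the Lipschitz seminorm: the commutator with the Dirac operator replaces
  a symbol \<open>f\<close> by \<open>- \<i> f'\<close> on either side, and \<open>R n\<close> and \<open>S n\<close> commute with this. Hence the two
  composition maps are nonexpansive for the metrics in question.

  They are nearly inverse to each other. The composite \<open>S n \<circ> R n\<close> is the \<open>n\<close>-th Fejer mean, which
  approximates the functions of the Lipschitz ball uniformly, since these have a common modulus
  of continuity (\<open>fejer_converges_lipschitz\<close>). The composite \<open>R n \<circ> S n\<close> multiplies the entries \<open>t (a - b)\<close>
  of a Toeplitz matrix by \<open>1 - \<bar>a - b\<bar> / n\<close>, and a comparison of Hilbert-Schmidt norms shows that it
  moves the Lipschitz ball by at most \<open>1 / sqrt n\<close> (\<open>toep_fejer_approx\<close>). As unital completely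
  positive maps are contractive, both errors pass to the spaces of maps. Two nonexpansive maps
  that are inverse to each other up to \<open>\<epsilon>\<close> bound the Gromov-Hausdorff distance by \<open>2 \<epsilon>\<close>
  (\<open>GH_dist_le\<close>).

  The Gromov-Hausdorff distance presupposes that the spaces are compact metric spaces. For both
  operator systems this follows from the properties collected in the locale \<open>lip_system\<close>. By
  Tychonoff's theorem and the Riesz representation theorem the maps form a compact set for
  pointwise weak convergence, and the metric is continuous for it because the Lipschitz ball is
  totally bounded (\<open>compact_metric_UCP\<close>). Total boundedness comes from finite dimension for the
  Toeplitz systems and from the Fejer means for the continuous functions.
\<close>

section \<open>Complex Hilbert spaces\<close>

lemma cinner_add_right: "cinner x (y + z) = cinner x y + cinner x (z::'k::complex_hilbert)"
  by (subst (1 2 3) cinner_commute) (simp add: cinner_add_left)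

lemma cinner_scaleC_right: "cinner x (c *\<^sub>C y) = cnj c * cinner x (y::'k::complex_hilbert)"
  by (subst (1 2) cinner_commute) (simp add: cinner_scaleC_left)

lemma cinner_zero_left [simp]: "cinner 0 (y::'k::complex_hilbert) = 0"
  using cinner_add_left[of 0 0 y] by simp

lemma cinner_zero_right [simp]: "cinner y (0::'k::complex_hilbert) = 0"
  using cinner_add_right[of y 0 0] by simp

lemma cinner_minus_left: "cinner (- x) y = - cinner x (y::'k::complex_hilbert)"
  using cinner_add_left[of x "- x" y] by (simp add: eq_neg_iff_add_eq_0 add.commute)

lemma cinner_minus_right: "cinner x (- y) = - cinner x (y::'k::complex_hilbert)"
  using cinner_add_right[of x y "- y"] by (simp add: eq_neg_iff_add_eq_0 add.commute)

lemma cinner_diff_left: "cinner (x - y) z = cinner x z - cinner y (z::'k::complex_hilbert)"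
  using cinner_add_left[of x "- y" z] by (simp add: cinner_minus_left)

lemma cinner_diff_right: "cinner x (y - z) = cinner x y - cinner x (z::'k::complex_hilbert)"
  using cinner_add_right[of x y "- z"] by (simp add: cinner_minus_right)

lemmas cinner_simps = cinner_add_left cinner_add_right cinner_scaleC_left cinner_scaleC_right
  cinner_diff_left cinner_diff_right cinner_minus_left cinner_minus_right

lemma cinner_scaleR_left: "cinner (r *\<^sub>R x) y = of_real r * cinner x (y::'k::complex_hilbert)"
  by (metis cinner_scaleC_left scaleC_of_real)

lemma cinner_scaleR_right: "cinner x (r *\<^sub>R y) = of_real r * cinner x (y::'k::complex_hilbert)"
  by (metis cinner_scaleC_right scaleC_of_real complex_cnj_complex_of_real)

lemma Re_cinner_self: "Re (cinner x x) = (norm (x::'k::complex_hilbert))\<^sup>2"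
  by (simp add: cinner_self)

lemma norm_scaleC: "norm (c *\<^sub>C x) = cmod c * norm (x::'k::complex_hilbert)"
proof -
  have "complex_of_real ((norm (c *\<^sub>C x))\<^sup>2) = c * cnj c * complex_of_real ((norm x)\<^sup>2)"
    by (simp only: cinner_self[symmetric] cinner_simps) (simp add: mult.assoc)
  also have "\<dots> = complex_of_real ((cmod c * norm x)\<^sup>2)"
    by (simp add: complex_norm_square[symmetric] power_mult_distrib)
  finally have "(norm (c *\<^sub>C x))\<^sup>2 = (cmod c * norm x)\<^sup>2" by (simp only: of_real_eq_iff)
  then show ?thesis by (simp add: power2_eq_iff_nonneg)
qed

lemma norm_add_sq: "(norm (x + y))\<^sup>2 = (norm x)\<^sup>2 + 2 * Re (cinner x y) + (norm (y::'k::complex_hilbert))\<^sup>2"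
proof -
  have "Re (cinner y x) = Re (cinner x y)" by (subst cinner_commute) simp
  then show ?thesis by (simp add: Re_cinner_self[symmetric] cinner_simps)
qed

text \<open>Bounds for real parts are enough if the hypotheses are invariant under rotation.\<close>

lemma cmod_le_by_rotation:
  assumes "\<And>\<zeta>. cmod \<zeta> = 1 \<Longrightarrow> Re (\<zeta> * a) \<le> r"
  shows "cmod a \<le> r"
proof (cases "a = 0")
  case True then show ?thesis using assms[of 1] by simp
next
  case False
  have "cnj a / cmod a * a = cmod a"
    using False by (simp add: complex_norm_square[symmetric] mult.commute power2_eq_square)
  then show ?thesis using assms[of "cnj a / cmod a"] False by (simp add: norm_divide)
qed

lemma cinner_Cauchy_Schwarz: "cmod (cinner x y) \<le> norm x * norm (y::'k::complex_hilbert)"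
proof (rule cmod_le_by_rotation)
  fix \<zeta> :: complex assume z: "cmod \<zeta> = 1"
  let ?x = "\<zeta> *\<^sub>C x"
  have nx: "norm ?x = norm x" using z by (simp add: norm_scaleC)
  have "(norm (?x + y))\<^sup>2 \<le> (norm x + norm y)\<^sup>2"
    by (rule power_mono) (use norm_triangle_ineq[of ?x y] nx in auto)
  then show "Re (\<zeta> * cinner x y) \<le> norm x * norm y"
    unfolding norm_add_sq nx by (simp add: cinner_simps power2_sum)
qed

lemma cinner_eq_zero_all: "(\<And>y. cinner x y = 0) \<Longrightarrow> x = (0::'k::complex_hilbert)"
  using cinner_self[of x] by simp

lemma continuous_on_cinner [continuous_intros]:
  fixes f g :: "'a::topological_space \<Rightarrow> 'k::complex_hilbert"
  assumes "continuous_on S f" "continuous_on S g"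
  shows "continuous_on S (\<lambda>x. cinner (f x) (g x))"
proof -
  have "bounded_bilinear (\<lambda>x y::'k. cinner x y)"
    by (unfold_locales)
       (auto simp: cinner_simps cinner_scaleR_left cinner_scaleR_right scaleR_conv_of_real
          intro!: exI[of _ 1] cinner_Cauchy_Schwarz)
  from bounded_bilinear.continuous_on[OF this assms] show ?thesis .
qed

lemma bounded_clinear_continuous: "bounded_clinear A \<Longrightarrow> continuous_on UNIV A"
  by (simp add: bounded_clinear_def linear_continuous_on)

lemma
  assumes "bounded_clinear A"
  shows bounded_clinear_add: "A (x + y) = A x + A y"
    and bounded_clinear_scaleC: "A (c *\<^sub>C x) = c *\<^sub>C A x"
  using assms by (auto simp: bounded_clinear_def linear_simps)

text \<open>Polarization gives \<open>\<langle>A x, y\<rangle> + \<langle>A y, x\<rangle> = 0\<close>; replacing \<open>x\<close> by \<open>\<i> x\<close> separates the two terms.\<close>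

lemma quadratic_form_zero:
  fixes A :: "'k::complex_hilbert \<Rightarrow> 'k"
  assumes A: "bounded_clinear A" and q: "\<And>x. cinner (A x) x = 0"
  shows "A x = 0"
proof (rule cinner_eq_zero_all)
  fix y
  have 1: "cinner (A x) y + cinner (A y) x = 0" for x y
    using q[of "x + y"] q[of x] q[of y] by (simp add: bounded_clinear_add[OF A] cinner_simps add_ac)
  have "\<i> * cinner (A x) y - \<i> * cinner (A y) x = 0"
    using 1[of "\<i> *\<^sub>C x" y] by (simp add: bounded_clinear_scaleC[OF A] cinner_simps)
  then have "cinner (A x) y = cinner (A y) x" by simp
  with 1[of x y] show "cinner (A x) y = 0" by simp
qed

text \<open>The Riesz representation theorem: the representing vector minimizes the strictly convex
  functional \<open>\<parallel>y\<parallel>\<^sup>2 - 2 Re (F y)\<close>, and by the parallelogram law minimizing sequences are Cauchy.\<close>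

lemma Riesz_representation:
  fixes F :: "'k::complex_hilbert \<Rightarrow> complex"
  assumes add: "\<And>x y. F (x + y) = F x + F y"
    and scale: "\<And>c x. F (c *\<^sub>C x) = cnj c * F x"
    and bound: "\<And>x. cmod (F x) \<le> M * norm x"
  shows "\<exists>a. \<forall>y. F y = cinner a y"
proof -
  define J where "J y = (norm y)\<^sup>2 - 2 * Re (F y)" for y
  have scaleR: "F (r *\<^sub>R x) = of_real r * F x" for r x
    using scale[of "of_real r" x] by (simp add: scaleC_of_real)
  have J_ge: "J y \<ge> - M\<^sup>2" for y
  proof -
    have "Re (F y) \<le> M * norm y" using bound[of y] complex_Re_le_cmod order_trans by blast
    moreover have "0 \<le> (norm y - M)\<^sup>2" by simp
    ultimately show ?thesis unfolding J_def by (simp add: power2_diff algebra_simps)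
  qed
  then have bdd: "bdd_below (range J)" by (intro bdd_belowI[of _ "- M\<^sup>2"]) auto
  define m where "m = (INF y. J y)"
  have m_le: "m \<le> J y" for y unfolding m_def using bdd by (simp add: cINF_lower)
  have para: "(norm (x - y))\<^sup>2 = 2 * (J x + J y - 2 * J ((1/2) *\<^sub>R (x + y)))" for x y
  proof -
    have "(norm (x - y))\<^sup>2 + (norm (x + y))\<^sup>2 = 2 * (norm x)\<^sup>2 + 2 * (norm y)\<^sup>2"
      using norm_add_sq[of x y] norm_add_sq[of x "- y"] by (simp add: cinner_simps)
    moreover have "J ((1/2) *\<^sub>R (x + y)) = (norm (x + y))\<^sup>2 / 4 - Re (F x + F y)"
      unfolding J_def scaleR norm_scaleR by (simp add: add power_mult_distrib power_divide add_divide_distrib)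
    ultimately show ?thesis unfolding J_def by (simp add: field_simps)
  qed
  have "\<exists>y. J y < m + inverse (real (Suc n))" for n
    using cINF_less_iff[OF _ bdd, of "m + inverse (real (Suc n))"] unfolding m_def[symmetric] by auto
  then obtain y where y: "\<And>n. J (y n) < m + inverse (real (Suc n))" by metis
  have close: "(norm (y i - y j))\<^sup>2 \<le> 2 * (inverse (real (Suc i)) + inverse (real (Suc j)))" for i j
    unfolding para using y[of i] y[of j] m_le[of "(1/2) *\<^sub>R (y i + y j)"] by simp
  have "Cauchy y"
  proof (rule metric_CauchyI)
    fix e :: real assume e: "e > 0"
    obtain N where N: "inverse (real (Suc N)) < e\<^sup>2 / 4"
      using reals_Archimedean[of "e\<^sup>2 / 4"] e by auto
    show "\<exists>N. \<forall>i\<ge>N. \<forall>j\<ge>N. dist (y i) (y j) < e"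
    proof (intro exI[of _ N] allI impI)
      fix i j assume "i \<ge> N" "j \<ge> N"
      then have "inverse (real (Suc i)) \<le> inverse (real (Suc N))"
        "inverse (real (Suc j)) \<le> inverse (real (Suc N))" by (auto simp: field_simps)
      then have "2 * (inverse (real (Suc i)) + inverse (real (Suc j)))
          \<le> 2 * (inverse (real (Suc N)) + inverse (real (Suc N)))"
        by (intro mult_left_mono add_mono) auto
      also have "\<dots> < e\<^sup>2" using N by simp
      finally have "(norm (y i - y j))\<^sup>2 < e\<^sup>2" using close[of i j] by simp
      then show "dist (y i) (y j) < e" using e by (simp add: dist_norm power2_less_imp_less)
    qed
  qed
  then obtain a where a: "y \<longlonglongrightarrow> a" by (auto simp: Cauchy_convergent_iff convergent_def)
  have lin: "bounded_linear F"
    by (rule bounded_linear_intro[of _ M])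
       (use bound in \<open>auto simp: add scaleR scaleR_conv_of_real mult.commute\<close>)
  have "(\<lambda>n. J (y n)) \<longlonglongrightarrow> J a"
    unfolding J_def by (intro tendsto_intros a bounded_linear.tendsto[OF lin])
  moreover have "(\<lambda>n. m + inverse (real (Suc n))) \<longlonglongrightarrow> m + 0"
    by (intro tendsto_intros LIMSEQ_inverse_real_of_nat)
  ultimately have "J a \<le> m + 0"
    by (rule LIMSEQ_le) (use y less_imp_le in blast)
  then have min: "J a \<le> J y" for y using m_le[of y] by simp
  \<comment> \<open>the first variation of \<open>J\<close> at its minimum vanishes\<close>
  have Re_eq: "Re (F v) = Re (cinner a v)" for v
  proof -
    define c where "c = Re (cinner a v) - Re (F v)"
    have q: "0 \<le> 2 * t * c + t\<^sup>2 * (norm v)\<^sup>2" for t :: real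
      using min[of "a + t *\<^sub>R v"] unfolding J_def norm_add_sq c_def
      by (simp add: add scaleR cinner_scaleR_right power_mult_distrib algebra_simps)
    define s where "s = (norm v)\<^sup>2 + 1"
    have "s > 0" unfolding s_def by (simp add: add_nonneg_pos)
    have "0 \<le> s\<^sup>2 * (2 * (- c / s) * c + (- c / s)\<^sup>2 * (norm v)\<^sup>2)"
      using q[of "- c / s"] by simp
    also have "\<dots> = - 2 * c\<^sup>2 * s + c\<^sup>2 * (norm v)\<^sup>2"
      using \<open>s > 0\<close> by (simp add: field_simps power2_eq_square)
    also have "\<dots> = - c\<^sup>2 * (s + 1)" by (simp add: s_def algebra_simps)
    finally have "c\<^sup>2 * (s + 1) \<le> 0" by simp
    then have "c = 0" using \<open>s > 0\<close> by (simp add: mult_le_0_iff)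
    then show ?thesis by (simp add: c_def)
  qed
  have "F v = cinner a v" for v
    using Re_eq[of v] Re_eq[of "\<i> *\<^sub>C v"] by (simp add: complex_eq_iff scale cinner_simps)
  then show ?thesis by blast
qed

text \<open>The operator comes from the representing vectors of the functionals \<open>y \<mapsto> z x y\<close>, and it is
  linear because these vectors are unique.\<close>

lemma sesquilinear_representation:
  fixes z :: "'k::complex_hilbert \<Rightarrow> 'k \<Rightarrow> complex"
  assumes add1: "\<And>x y w. z (x + y) w = z x w + z y w"
    and scale1: "\<And>c x w. z (c *\<^sub>C x) w = c * z x w"
    and add2: "\<And>x y w. z w (x + y) = z w x + z w y"
    and scale2: "\<And>c x w. z w (c *\<^sub>C x) = cnj c * z w x"
    and bound: "\<And>x y. cmod (z x y) \<le> M * norm x * norm y"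
  shows "\<exists>A. bounded_clinear A \<and> (\<forall>x y. cinner (A x) y = z x y)"
proof -
  have "\<forall>x. \<exists>a. \<forall>y. z x y = cinner a y"
    using Riesz_representation[of "z _"] add2 scale2 bound by blast
  then obtain A where A: "\<And>x y. z x y = cinner (A x) y" by metis
  have A_add: "A (x + y) = A x + A y" for x y
  proof -
    have "A (x + y) - (A x + A y) = 0"
      by (rule cinner_eq_zero_all) (simp add: cinner_simps A[symmetric] add1)
    then show ?thesis by simp
  qed
  have A_scale: "A (c *\<^sub>C x) = c *\<^sub>C A x" for c x
  proof -
    have "A (c *\<^sub>C x) - c *\<^sub>C A x = 0"
      by (rule cinner_eq_zero_all) (simp add: cinner_simps A[symmetric] scale1)
    then show ?thesis by simp
  qed
  have "norm (A x) \<le> norm x * \<bar>M\<bar>" for x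
  proof -
    have "(norm (A x))\<^sup>2 \<le> M * norm x * norm (A x)"
      using bound[of x "A x"] complex_Re_le_cmod[of "z x (A x)"] by (simp add: A Re_cinner_self)
    then have "norm (A x) \<le> M * norm x \<or> norm (A x) = 0" by (auto simp: power2_eq_square mult_le_cancel_right)
    moreover have "M * norm x \<le> norm x * \<bar>M\<bar>"
      by (simp add: mult.commute[of M] mult_left_mono)
    ultimately show ?thesis by auto
  qed
  then have "bounded_linear A"
    by (intro bounded_linear_intro[of _ "\<bar>M\<bar>"])
       (auto simp: A_add A_scale scaleC_of_real[symmetric])
  then show ?thesis using A A_scale by (auto simp: bounded_clinear_def intro!: exI[of _ A])
qed


section \<open>Square integrable functions on the circle\<close>

lemma periodic_int:
  assumes "periodic f" shows "f (\<theta> + 2 * pi * of_int m) = f \<theta>"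
proof -
  have nat: "f (\<theta> + 2 * pi * of_nat j) = f \<theta>" for j \<theta>
  proof (induction j)
    case (Suc j)
    have "f (\<theta> + 2 * pi * of_nat (Suc j)) = f ((\<theta> + 2 * pi * of_nat j) + 2 * pi)"
      by (simp add: algebra_simps)
    also have "\<dots> = f \<theta>" using assms Suc by (simp add: periodic_def)
    finally show ?case .
  qed simp
  show ?thesis
  proof (cases "m \<ge> 0")
    case True then show ?thesis using nat[of \<theta> "nat m"] by simp
  next
    case False then show ?thesis using nat[of "\<theta> + 2 * pi * of_int m" "nat (- m)"] by simp
  qed
qed

lemma angle_in_period: "\<exists>m. \<theta> + 2 * pi * of_int m \<in> {a..<a + 2 * pi}"
proof -
  define q where "q = (\<theta> - a) / (2 * pi)"
  have \<theta>: "\<theta> = a + 2 * pi * q" by (simp add: q_def)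
  have "2 * pi * of_int \<lfloor>q\<rfloor> \<le> 2 * pi * q" "2 * pi * q < 2 * pi * (of_int \<lfloor>q\<rfloor> + 1)"
    by (intro mult_left_mono mult_strict_left_mono; simp; linarith)+
  then have "\<theta> + 2 * pi * of_int (- \<lfloor>q\<rfloor>) \<in> {a..<a + 2 * pi}"
    by (simp add: \<theta> algebra_simps)
  then show ?thesis by blast
qed

lemma C_circle_bounded:
  assumes "f \<in> C_circle" obtains M where "0 \<le> M" "\<And>\<theta>. cmod (f \<theta>) \<le> M"
proof -
  have "continuous_on {0..2 * pi} f" "periodic f"
    using assms continuous_on_subset by (auto simp: C_circle_def)
  then have "bounded (f ` {0..2 * pi})" by (simp add: compact_continuous_image compact_imp_bounded)
  then obtain M where M: "\<And>\<theta>. \<theta> \<in> {0..2 * pi} \<Longrightarrow> cmod (f \<theta>) \<le> M" unfolding bounded_iff by blast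
  have "cmod (f \<theta>) \<le> M" for \<theta>
  proof -
    obtain m where "\<theta> + 2 * pi * of_int m \<in> {0..<0 + 2 * pi}" using angle_in_period[of \<theta> 0] by blast
    then have "cmod (f (\<theta> + 2 * pi * of_int m)) \<le> M" by (intro M) auto
    then show ?thesis by (simp add: periodic_int[OF \<open>periodic f\<close>])
  qed
  moreover from this[of 0] have "0 \<le> M" by (rule order_trans[OF norm_ge_zero])
  ultimately show ?thesis using that by blast
qed

lemma
  shows C_circle_add: "f \<in> C_circle \<Longrightarrow> g \<in> C_circle \<Longrightarrow> (\<lambda>\<theta>. f \<theta> + g \<theta>) \<in> C_circle"
    and C_circle_diff: "f \<in> C_circle \<Longrightarrow> g \<in> C_circle \<Longrightarrow> (\<lambda>\<theta>. f \<theta> - g \<theta>) \<in> C_circle"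
    and C_circle_mult: "f \<in> C_circle \<Longrightarrow> g \<in> C_circle \<Longrightarrow> (\<lambda>\<theta>. f \<theta> * g \<theta>) \<in> C_circle"
    and C_circle_cnj: "f \<in> C_circle \<Longrightarrow> (\<lambda>\<theta>. cnj (f \<theta>)) \<in> C_circle"
    and C_circle_const: "(\<lambda>\<theta>. c) \<in> C_circle"
  by (auto simp: C_circle_def periodic_def intro!: continuous_intros)

lemma L2_measurable [measurable_dest]: "g \<in> L2_circle \<Longrightarrow> g \<in> borel_measurable borel"
  by (simp add: L2_circle_def)

lemma L2_circleI:
  assumes per: "periodic g" and meas: "g \<in> borel_measurable borel"
    and int: "set_integrable lborel {0..2*pi} b"
    and le: "\<And>\<theta>. (cmod (g \<theta>))\<^sup>2 \<le> (b \<theta> :: real)"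
  shows "g \<in> L2_circle"
proof -
  have "set_integrable lborel {0..2*pi} (\<lambda>\<theta>. (cmod (g \<theta>))\<^sup>2)"
    unfolding set_integrable_def
  proof (rule Bochner_Integration.integrable_bound[OF int[unfolded set_integrable_def]])
    show "(\<lambda>\<theta>. indicat_real {0..2 * pi} \<theta> *\<^sub>R (cmod (g \<theta>))\<^sup>2) \<in> borel_measurable lborel"
      using meas by measurable
    show "AE \<theta> in lborel. norm (indicat_real {0..2 * pi} \<theta> *\<^sub>R (cmod (g \<theta>))\<^sup>2)
        \<le> norm (indicat_real {0..2 * pi} \<theta> *\<^sub>R b \<theta>)"
      using le by (intro AE_I2) (auto simp: indicator_def intro: order_trans[OF _ abs_ge_self])
  qed
  with per meas show ?thesis by (simp add: L2_circle_def)
qed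

lemma L2_sq_integrable: "g \<in> L2_circle \<Longrightarrow> set_integrable lborel {0..2*pi} (\<lambda>\<theta>. (cmod (g \<theta>))\<^sup>2)"
  by (simp add: L2_circle_def)

lemma L2_periodic: "g \<in> L2_circle \<Longrightarrow> periodic g"
  by (simp add: L2_circle_def)

lemma L2_add:
  assumes g: "g \<in> L2_circle" and h: "h \<in> L2_circle"
  shows "(\<lambda>\<theta>. g \<theta> + h \<theta>) \<in> L2_circle"
proof (rule L2_circleI)
  show "periodic (\<lambda>\<theta>. g \<theta> + h \<theta>)" using L2_periodic[OF g] L2_periodic[OF h] by (simp add: periodic_def)
  show "(\<lambda>\<theta>. g \<theta> + h \<theta>) \<in> borel_measurable borel" using g h by measurable
  show "set_integrable lborel {0..2*pi} (\<lambda>\<theta>. 2 * (cmod (g \<theta>))\<^sup>2 + 2 * (cmod (h \<theta>))\<^sup>2)"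
    by (intro set_integral_add set_integrable_mult_right L2_sq_integrable impI g h)
  show "(cmod (g \<theta> + h \<theta>))\<^sup>2 \<le> 2 * (cmod (g \<theta>))\<^sup>2 + 2 * (cmod (h \<theta>))\<^sup>2" for \<theta>
  proof -
    have "(cmod (g \<theta> + h \<theta>))\<^sup>2 \<le> (cmod (g \<theta>) + cmod (h \<theta>))\<^sup>2"
      by (intro power_mono norm_triangle_ineq) auto
    also have "\<dots> \<le> 2 * (cmod (g \<theta>))\<^sup>2 + 2 * (cmod (h \<theta>))\<^sup>2"
      using zero_le_power2[of "cmod (g \<theta>) - cmod (h \<theta>)"] by (simp add: power2_eq_square algebra_simps)
    finally show ?thesis .
  qed
qed

lemma L2_mult:
  assumes f: "f \<in> C_circle" and g: "g \<in> L2_circle"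
  shows "(\<lambda>\<theta>. f \<theta> * g \<theta>) \<in> L2_circle"
proof -
  obtain M where M: "0 \<le> M" "\<And>\<theta>. cmod (f \<theta>) \<le> M" using C_circle_bounded[OF f] by blast
  have fm: "f \<in> borel_measurable borel"
    using f by (simp add: C_circle_def borel_measurable_continuous_onI)
  show ?thesis
  proof (rule L2_circleI)
    show "periodic (\<lambda>\<theta>. f \<theta> * g \<theta>)" using L2_periodic[OF g] f by (simp add: periodic_def C_circle_def)
    show "(\<lambda>\<theta>. f \<theta> * g \<theta>) \<in> borel_measurable borel" using fm g by measurable
    show "set_integrable lborel {0..2*pi} (\<lambda>\<theta>. M\<^sup>2 * (cmod (g \<theta>))\<^sup>2)"
      by (intro set_integrable_mult_right L2_sq_integrable impI g)
    show "(cmod (f \<theta> * g \<theta>))\<^sup>2 \<le> M\<^sup>2 * (cmod (g \<theta>))\<^sup>2" for \<theta>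
      using M by (simp add: norm_mult power_mult_distrib mult_right_mono power_mono)
  qed
qed

lemma C_circle_subset_L2: "f \<in> C_circle \<Longrightarrow> f \<in> L2_circle"
proof -
  assume f: "f \<in> C_circle"
  have "set_integrable lborel {0..2*pi} (\<lambda>\<theta>. 1 :: real)"
    by (intro borel_integrable_atLeastAtMost' continuous_intros)
  then have "(\<lambda>\<theta>. 1) \<in> L2_circle" by (simp add: L2_circle_def periodic_def)
  from L2_mult[OF f this] show ?thesis by simp
qed

lemma L2_scale: "g \<in> L2_circle \<Longrightarrow> (\<lambda>\<theta>. c * g \<theta>) \<in> L2_circle"
  by (rule L2_mult[OF C_circle_const])

lemma L2_zero: "(\<lambda>\<theta>. 0) \<in> L2_circle"
  by (rule C_circle_subset_L2[OF C_circle_const])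

lemma L2_sum: "(\<And>i. i \<in> I \<Longrightarrow> g i \<in> L2_circle) \<Longrightarrow> (\<lambda>\<theta>. \<Sum>i\<in>I. g i \<theta>) \<in> L2_circle"
  by (induction I rule: infinite_finite_induct) (auto simp: L2_zero L2_add)

lemma borel_measurable_cnj [measurable]: "cnj \<in> borel_measurable borel"
  by (intro borel_measurable_continuous_onI continuous_intros)

lemma L2_prod_integrable:
  assumes g: "g \<in> L2_circle" and h: "h \<in> L2_circle"
  shows "set_integrable lborel {0..2*pi} (\<lambda>\<theta>. g \<theta> * cnj (h \<theta>))"
  unfolding set_integrable_def
proof (rule Bochner_Integration.integrable_bound)
  show "integrable lborel (\<lambda>\<theta>. indicat_real {0..2*pi} \<theta> *\<^sub>R ((cmod (g \<theta>))\<^sup>2 + (cmod (h \<theta>))\<^sup>2))"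
    unfolding set_integrable_def[symmetric] by (intro set_integral_add L2_sq_integrable g h)
  show "(\<lambda>\<theta>. indicat_real {0..2 * pi} \<theta> *\<^sub>R (g \<theta> * cnj (h \<theta>))) \<in> borel_measurable lborel"
    using g h by measurable
  have "cmod (g \<theta>) * cmod (h \<theta>) \<le> (cmod (g \<theta>))\<^sup>2 + (cmod (h \<theta>))\<^sup>2" for \<theta>
  proof -
    have "0 \<le> cmod (g \<theta>) * cmod (h \<theta>)" by simp
    moreover have "2 * (cmod (g \<theta>) * cmod (h \<theta>)) \<le> (cmod (g \<theta>))\<^sup>2 + (cmod (h \<theta>))\<^sup>2"
      using sum_squares_bound[of "cmod (g \<theta>)" "cmod (h \<theta>)"] by (simp add: mult.assoc)
    ultimately show ?thesis by linarith
  qed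
  then show "AE \<theta> in lborel. norm (indicat_real {0..2 * pi} \<theta> *\<^sub>R (g \<theta> * cnj (h \<theta>)))
      \<le> norm (indicat_real {0..2 * pi} \<theta> *\<^sub>R ((cmod (g \<theta>))\<^sup>2 + (cmod (h \<theta>))\<^sup>2))"
    by (intro AE_I2) (auto simp: indicator_def norm_mult)
qed

lemma L2_inner_add_left:
  assumes "g \<in> L2_circle" "h \<in> L2_circle" "u \<in> L2_circle"
  shows "L2_inner (\<lambda>\<theta>. g \<theta> + h \<theta>) u = L2_inner g u + L2_inner h u"
  unfolding L2_inner_def using assms
  by (simp add: distrib_right set_integral_add L2_prod_integrable add_divide_distrib)

lemma L2_inner_scale_left: "L2_inner (\<lambda>\<theta>. c * g \<theta>) u = c * L2_inner g u"
  unfolding L2_inner_def by (simp add: mult.assoc set_lebesgue_integral_def flip: mult_scaleR_right)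

lemma L2_inner_commute: "L2_inner g h = cnj (L2_inner h g)"
proof -
  have "cnj (LINT \<theta>:{0..2*pi}|lborel. h \<theta> * cnj (g \<theta>)) = (LINT \<theta>:{0..2*pi}|lborel. g \<theta> * cnj (h \<theta>))"
    unfolding set_lebesgue_integral_def Bochner_Integration.integral_cnj[symmetric]
    by (intro Bochner_Integration.integral_cong) (auto simp: indicator_def)
  then show ?thesis by (simp add: L2_inner_def)
qed

lemma L2_inner_scale_right: "L2_inner g (\<lambda>\<theta>. c * u \<theta>) = cnj c * L2_inner g u"
  by (subst (1 2) L2_inner_commute) (simp add: L2_inner_scale_left)

lemma L2_inner_add_right:
  assumes "g \<in> L2_circle" "h \<in> L2_circle" "u \<in> L2_circle"
  shows "L2_inner u (\<lambda>\<theta>. g \<theta> + h \<theta>) = L2_inner u g + L2_inner u h"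
  by (subst (1 2 3) L2_inner_commute) (simp add: L2_inner_add_left assms)

lemma L2_inner_diff_left:
  assumes "g \<in> L2_circle" "h \<in> L2_circle" "u \<in> L2_circle"
  shows "L2_inner (\<lambda>\<theta>. g \<theta> - h \<theta>) u = L2_inner g u - L2_inner h u"
  using L2_inner_add_left[OF assms(1) L2_scale[OF assms(2), of "-1"] assms(3)]
    L2_inner_scale_left[of "-1" h u] by simp

lemma L2_inner_zero_left [simp]: "L2_inner (\<lambda>\<theta>. 0) u = 0"
  and L2_inner_zero_right [simp]: "L2_inner u (\<lambda>\<theta>. 0) = 0"
  by (simp_all add: L2_inner_def)

lemma L2_inner_sum_left:
  assumes "\<And>i. i \<in> I \<Longrightarrow> g i \<in> L2_circle" "u \<in> L2_circle"
  shows "L2_inner (\<lambda>\<theta>. \<Sum>i\<in>I. g i \<theta>) u = (\<Sum>i\<in>I. L2_inner (g i) u)"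
  using assms by (induction I rule: infinite_finite_induct) (auto simp: L2_inner_add_left L2_sum)

lemma L2_inner_sum_right:
  assumes "\<And>i. i \<in> I \<Longrightarrow> g i \<in> L2_circle" "u \<in> L2_circle"
  shows "L2_inner u (\<lambda>\<theta>. \<Sum>i\<in>I. g i \<theta>) = (\<Sum>i\<in>I. L2_inner u (g i))"
  using assms by (induction I rule: infinite_finite_induct) (auto simp: L2_inner_add_right L2_sum)

lemma L2_inner_self_real:
  "L2_inner g g = complex_of_real ((LINT \<theta>:{0..2*pi}|lborel. (cmod (g \<theta>))\<^sup>2) / (2 * pi))"
proof -
  have "(LINT \<theta>:{0..2*pi}|lborel. g \<theta> * cnj (g \<theta>))
      = (LINT \<theta>:{0..2*pi}|lborel. complex_of_real ((cmod (g \<theta>))\<^sup>2))"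
    by (simp add: complex_norm_square del: of_real_power)
  also have "\<dots> = complex_of_real (LINT \<theta>:{0..2*pi}|lborel. (cmod (g \<theta>))\<^sup>2)"
    by (rule set_integral_complex_of_real)
  finally show ?thesis by (simp add: L2_inner_def)
qed

lemma L2_norm_square: "(L2_norm g)\<^sup>2 = (LINT \<theta>:{0..2*pi}|lborel. (cmod (g \<theta>))\<^sup>2) / (2 * pi)"
proof -
  have "0 \<le> (LINT \<theta>:{0..2*pi}|lborel. (cmod (g \<theta>))\<^sup>2)"
    unfolding set_lebesgue_integral_def by (rule Bochner_Integration.integral_nonneg) auto
  then show ?thesis unfolding L2_norm_def L2_inner_self_real by simp
qed

lemma L2_inner_self: "L2_inner g g = complex_of_real ((L2_norm g)\<^sup>2)"
  by (simp only: L2_inner_self_real L2_norm_square)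

lemma L2_norm_nonneg [simp]: "0 \<le> L2_norm g"
proof -
  have "0 \<le> Re (L2_inner g g)" unfolding L2_inner_self by simp
  then show ?thesis by (simp add: L2_norm_def)
qed

lemma L2_norm_zero [simp]: "L2_norm (\<lambda>\<theta>. 0) = 0"
  by (simp add: L2_norm_def)

lemma L2_norm_scale: "L2_norm (\<lambda>\<theta>. c * g \<theta>) = cmod c * L2_norm g"
proof -
  have "complex_of_real ((L2_norm (\<lambda>\<theta>. c * g \<theta>))\<^sup>2) = complex_of_real ((cmod c * L2_norm g)\<^sup>2)"
    unfolding L2_inner_self[symmetric] L2_inner_scale_left L2_inner_scale_right
    by (simp add: L2_inner_self power_mult_distrib complex_norm_square[of c, symmetric] flip: mult.assoc)
  then have "(L2_norm (\<lambda>\<theta>. c * g \<theta>))\<^sup>2 = (cmod c * L2_norm g)\<^sup>2" by (simp only: of_real_eq_iff)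
  then show ?thesis by (simp add: power2_eq_iff_nonneg)
qed

lemma L2_norm_mono:
  assumes "h \<in> L2_circle" "g \<in> L2_circle" "\<And>\<theta>. cmod (h \<theta>) \<le> cmod (g \<theta>)"
  shows "L2_norm h \<le> L2_norm g"
proof (rule power2_le_imp_le)
  show "(L2_norm h)\<^sup>2 \<le> (L2_norm g)\<^sup>2"
    unfolding L2_norm_square
    by (intro divide_right_mono set_integral_mono L2_sq_integrable assms power_mono) auto
qed simp

lemma L2_norm_add_sq:
  assumes "g \<in> L2_circle" "h \<in> L2_circle"
  shows "(L2_norm (\<lambda>\<theta>. g \<theta> + h \<theta>))\<^sup>2 = (L2_norm g)\<^sup>2 + 2 * Re (L2_inner g h) + (L2_norm h)\<^sup>2"
proof -
  have "complex_of_real ((L2_norm (\<lambda>\<theta>. g \<theta> + h \<theta>))\<^sup>2)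
    = complex_of_real ((L2_norm g)\<^sup>2) + L2_inner g h + L2_inner h g + complex_of_real ((L2_norm h)\<^sup>2)"
    unfolding L2_inner_self[symmetric] using assms
    by (simp add: L2_inner_add_left L2_inner_add_right L2_add)
  moreover have "Re (L2_inner h g) = Re (L2_inner g h)" by (subst L2_inner_commute) simp
  ultimately show ?thesis by (auto simp: complex_eq_iff)
qed

text \<open>The form is only semidefinite, which is why \<open>L2_norm h = 0\<close> has to be treated separately: there
  the quadratic polynomial in \<open>t\<close> degenerates to a linear one that is bounded below.\<close>

lemma L2_Cauchy_Schwarz:
  assumes g: "g \<in> L2_circle" and h: "h \<in> L2_circle"
  shows "cmod (L2_inner g h) \<le> L2_norm g * L2_norm h"
proof (rule cmod_le_by_rotation)
  fix \<zeta> :: complex assume z: "cmod \<zeta> = 1"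
  define b where "b = Re (\<zeta> * L2_inner g h)"
  have q: "0 \<le> (L2_norm g)\<^sup>2 - 2 * t * b + t\<^sup>2 * (L2_norm h)\<^sup>2" for t :: real
  proof -
    have "0 \<le> (L2_norm (\<lambda>\<theta>. \<zeta> * g \<theta> + complex_of_real (- t) * h \<theta>))\<^sup>2" by simp
    also have "\<dots> = (L2_norm g)\<^sup>2 - 2 * t * b + t\<^sup>2 * (L2_norm h)\<^sup>2"
      unfolding L2_norm_add_sq[OF L2_scale[OF g] L2_scale[OF h]] L2_norm_scale
        L2_inner_scale_left L2_inner_scale_right
      using z by (simp add: b_def power_mult_distrib algebra_simps)
    finally show ?thesis .
  qed
  show "b \<le> L2_norm g * L2_norm h"
  proof (rule ccontr)
    assume "\<not> ?thesis"
    then have less: "L2_norm g * L2_norm h < b" by simp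
    then have "b > 0" using mult_nonneg_nonneg[OF L2_norm_nonneg[of g] L2_norm_nonneg[of h]] by linarith
    show False
    proof (cases "L2_norm h = 0")
      case True
      have "(L2_norm g)\<^sup>2 + 1 > 0" by (simp add: add_nonneg_pos)
      with q[of "((L2_norm g)\<^sup>2 + 1) / (2 * b)"] True \<open>b > 0\<close> show False by simp
    next
      case False
      then have hp: "(L2_norm h)\<^sup>2 > 0" by simp
      have "0 \<le> (L2_norm h)\<^sup>2 * ((L2_norm g)\<^sup>2 - 2 * (b / (L2_norm h)\<^sup>2) * b + (b / (L2_norm h)\<^sup>2)\<^sup>2 * (L2_norm h)\<^sup>2)"
        using q[of "b / (L2_norm h)\<^sup>2"] by (intro mult_nonneg_nonneg) auto
      also have "\<dots> = (L2_norm g * L2_norm h)\<^sup>2 - b\<^sup>2"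
        using False by (simp add: field_simps power2_eq_square)
      finally have "b\<^sup>2 \<le> (L2_norm g * L2_norm h)\<^sup>2" by simp
      then have "b \<le> L2_norm g * L2_norm h"
        using mult_nonneg_nonneg[OF L2_norm_nonneg L2_norm_nonneg] by (rule power2_le_imp_le)
      with less show False by simp
    qed
  qed
qed

section \<open>Bounded operators\<close>

text \<open>The homogeneous operators with finite norm, for which the supremum in \<open>op_norm\<close> is
  meaningful and gives the usual inequality.\<close>

definition bounded_op :: "circle_fun set \<Rightarrow> circle_op \<Rightarrow> bool" where
  "bounded_op H T \<longleftrightarrow> (\<forall>g\<in>H. \<forall>c. (\<lambda>\<theta>. c * g \<theta>) \<in> H \<and> T (\<lambda>\<theta>. c * g \<theta>) = (\<lambda>\<theta>. c * T g \<theta>)) \<and>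
     (\<exists>M. \<forall>g\<in>H. L2_norm (T g) \<le> M * L2_norm g)"

lemma op_norm_le:
  assumes "H \<noteq> {}" "bounded_op H T" "0 \<le> M" "\<And>g. g \<in> H \<Longrightarrow> L2_norm (T g) \<le> M * L2_norm g"
  shows "op_norm H T \<le> M"
  unfolding op_norm_def
proof (rule cSup_least)
  obtain g where "g \<in> H" using assms(1) by blast
  then have "(\<lambda>\<theta>. 0 * g \<theta>) \<in> H" using assms(2) unfolding bounded_op_def by blast
  then show "{L2_norm (T g) |g. g \<in> H \<and> L2_norm g \<le> 1} \<noteq> {}" by (auto intro!: exI[of _ "\<lambda>\<theta>. 0"])
  fix x assume "x \<in> {L2_norm (T g) |g. g \<in> H \<and> L2_norm g \<le> 1}"
  then obtain g where g: "g \<in> H" "L2_norm g \<le> 1" "x = L2_norm (T g)" by blast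
  then have "x \<le> M * L2_norm g" using assms(4) by simp
  also have "\<dots> \<le> M * 1" using g assms(3) by (intro mult_left_mono) auto
  finally show "x \<le> M" by simp
qed

lemma op_norm_bound:
  assumes T: "bounded_op H T" and g: "g \<in> H"
  shows "L2_norm (T g) \<le> op_norm H T * L2_norm g"
proof (cases "L2_norm g = 0")
  case True
  then show ?thesis using T g unfolding bounded_op_def by fastforce
next
  case False
  then have pos: "L2_norm g > 0" by (simp add: less_le)
  obtain M where M: "\<And>g. g \<in> H \<Longrightarrow> L2_norm (T g) \<le> M * L2_norm g" using T unfolding bounded_op_def by blast
  have "bdd_above {L2_norm (T g) |g. g \<in> H \<and> L2_norm g \<le> 1}"
  proof (rule bdd_aboveI)
    fix x assume "x \<in> {L2_norm (T g) |g. g \<in> H \<and> L2_norm g \<le> 1}"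
    then obtain g where g: "g \<in> H" "L2_norm g \<le> 1" "x = L2_norm (T g)" by blast
    have "x \<le> M * L2_norm g" using M g by simp
    also have "\<dots> \<le> \<bar>M\<bar> * 1" using g by (intro mult_mono) auto
    finally show "x \<le> \<bar>M\<bar>" by simp
  qed
  moreover let ?g = "\<lambda>\<theta>. complex_of_real (1 / L2_norm g) * g \<theta>"
  have "?g \<in> H" and eq: "T ?g = (\<lambda>\<theta>. complex_of_real (1 / L2_norm g) * T g \<theta>)"
    using T g unfolding bounded_op_def by blast+
  moreover have "L2_norm ?g \<le> 1" using pos unfolding L2_norm_scale norm_of_real by simp
  ultimately have "L2_norm (T ?g) \<le> op_norm H T"
    unfolding op_norm_def by (intro cSup_upper) (blast, assumption)
  then show ?thesis unfolding eq L2_norm_scale norm_of_real using pos by (simp add: field_simps)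
qed

lemma op_norm_nonneg:
  assumes "g \<in> H" "L2_norm g \<noteq> 0" "bounded_op H T" shows "0 \<le> op_norm H T"
proof -
  have "0 \<le> op_norm H T * L2_norm g"
    using op_norm_bound[OF assms(3,1)] by (rule order_trans[OF L2_norm_nonneg])
  then show ?thesis using assms(2) L2_norm_nonneg[of g] by (simp add: zero_le_mult_iff)
qed


section \<open>Unital completely positive maps and their metric\<close>

lemma
  assumes "\<phi> \<in> UCP H E"
  shows UCP_clinear: "T \<in> E \<Longrightarrow> bounded_clinear (\<phi> T)"
    and UCP_add: "S \<in> E \<Longrightarrow> T \<in> E \<Longrightarrow> \<phi> (\<lambda>g \<theta>. S g \<theta> + T g \<theta>) = (\<lambda>x. \<phi> S x + \<phi> T x)"
    and UCP_scale: "T \<in> E \<Longrightarrow> \<phi> (\<lambda>g \<theta>. c * T g \<theta>) = (\<lambda>x. c *\<^sub>C \<phi> T x)"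
    and UCP_unit: "\<phi> (op_on H id) = id"
    and UCP_extensional: "\<phi> \<in> extensional E"
    and UCP_positive: "(\<And>i j. i < m \<Longrightarrow> j < m \<Longrightarrow> X i j \<in> E) \<Longrightarrow> mat_positive H L2_inner m X \<Longrightarrow>
      mat_positive UNIV cinner m (\<lambda>i j. \<phi> (X i j))"
  using assms by (auto simp: UCP_def)

text \<open>The set over which the supremum in \<open>UCP_dist\<close> is taken, and the sum inside it.\<close>

definition lip_ball :: "circle_fun set \<Rightarrow> circle_op set \<Rightarrow> (circle_op \<Rightarrow> real) \<Rightarrow> circle_op set" where
  "lip_ball H E0 L = {T \<in> E0. op_norm H T \<le> 1 \<and> L T \<le> 1}"

definition weighted_form :: "(nat \<Rightarrow> 'k::complex_hilbert) \<Rightarrow> ('k \<Rightarrow> 'k) \<Rightarrow> real" where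
  "weighted_form k A = (\<Sum>p. 1 / 2 ^ Suc p * cmod (cinner (A (k (Suc p))) (k (Suc p))))"

lemma sums_geometric_half: "(\<lambda>p. 1 / 2 ^ Suc p * M) sums (M::real)"
  using sums_mult2[OF power_half_series, of M] by (simp add: power_one_over field_simps)

lemma suminf_geometric_tail: "(\<Sum>p. 1 / 2 ^ Suc (p + P) * 2) = 2 / (2::real) ^ P"
  using sums_unique[OF sums_geometric_half[of "2 / 2 ^ P"]] by (simp add: power_add mult.commute)

locale ball_sequence =
  fixes k :: "nat \<Rightarrow> 'k::complex_hilbert"
  assumes k_ball: "\<And>p. p \<ge> 1 \<Longrightarrow> k p \<in> cball 0 1"
    and k_dense: "cball 0 1 \<subseteq> closure (k ` {1..})"
begin

lemma norm_k: "norm (k (Suc p)) \<le> 1"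
  using k_ball[of "Suc p"] by simp

lemma weighted_form_summable:
  assumes "\<And>x. norm x \<le> 1 \<Longrightarrow> cmod (cinner (A x) x) \<le> M"
  shows "summable (\<lambda>p. 1 / 2 ^ Suc p * cmod (cinner (A (k (Suc p))) (k (Suc p))))"
proof (rule summable_comparison_test')
  show "summable (\<lambda>p. 1 / 2 ^ Suc p * M)" using sums_geometric_half by (rule sums_summable)
  show "norm (1 / 2 ^ Suc p * cmod (cinner (A (k (Suc p))) (k (Suc p)))) \<le> 1 / 2 ^ Suc p * M" if "p \<ge> 0" for p
    using assms[OF norm_k[of p]] by (simp add: divide_right_mono)
qed

lemma weighted_form_nonneg:
  assumes "\<And>x. norm x \<le> 1 \<Longrightarrow> cmod (cinner (A x) x) \<le> M"
  shows "0 \<le> weighted_form k A"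
  unfolding weighted_form_def by (rule suminf_nonneg[OF weighted_form_summable[of A M]]) (auto simp: assms)

lemma weighted_form_le:
  assumes "\<And>x. norm x \<le> 1 \<Longrightarrow> cmod (cinner (A x) x) \<le> M"
  shows "weighted_form k A \<le> M"
proof -
  have "weighted_form k A \<le> (\<Sum>p. 1 / 2 ^ Suc p * M)" unfolding weighted_form_def
  proof (rule suminf_le)
    show "1 / 2 ^ Suc p * cmod (cinner (A (k (Suc p))) (k (Suc p))) \<le> 1 / 2 ^ Suc p * M" for p
      using assms[OF norm_k[of p]] by (intro mult_left_mono) auto
    show "summable (\<lambda>p. 1 / 2 ^ Suc p * cmod (cinner (A (k (Suc p))) (k (Suc p))))"
      using assms by (rule weighted_form_summable)
    show "summable (\<lambda>p. 1 / 2 ^ Suc p * M)" using sums_geometric_half by (rule sums_summable)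
  qed
  then show ?thesis using sums_unique[OF sums_geometric_half[of M]] by simp
qed

text \<open>The tail of the weights is small, so that estimates of the metric reduce to finitely many of the
  vectors \<open>k p\<close>.\<close>

lemma weighted_form_le_initial:
  assumes "\<And>x. norm x \<le> 1 \<Longrightarrow> cmod (cinner (A x) x) \<le> 2"
    and "0 \<le> \<epsilon>" and "\<And>p. p < P \<Longrightarrow> cmod (cinner (A (k (Suc p))) (k (Suc p))) \<le> \<epsilon>"
  shows "weighted_form k A \<le> \<epsilon> + 2 / 2 ^ P"
proof -
  let ?t = "\<lambda>p. 1 / 2 ^ Suc p * cmod (cinner (A (k (Suc p))) (k (Suc p)))"
  have sm: "summable ?t" using assms(1) by (rule weighted_form_summable)
  have "(\<Sum>p<P. ?t p) \<le> (\<Sum>p<P. 1 / 2 ^ Suc p * \<epsilon>)"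
    using assms(3) by (intro sum_mono mult_left_mono) auto
  also have "\<dots> \<le> (\<Sum>p. 1 / 2 ^ Suc p * \<epsilon>)"
    using sums_geometric_half[of \<epsilon>] assms(2) by (intro sum_le_suminf sums_summable[OF sums_geometric_half]) auto
  also have "\<dots> = \<epsilon>" using sums_unique[OF sums_geometric_half[of \<epsilon>]] by simp
  finally have 1: "(\<Sum>p<P. ?t p) \<le> \<epsilon>" .
  have "(\<Sum>p. ?t (p + P)) \<le> (\<Sum>p. 1 / 2 ^ Suc (p + P) * 2)"
  proof (rule suminf_le)
    show "summable (\<lambda>p. ?t (p + P))" using sm by (rule summable_ignore_initial_segment)
    show "summable (\<lambda>p. 1 / 2 ^ Suc (p + P) * (2::real))"
      using sums_summable[OF sums_geometric_half[of 2]] by (rule summable_ignore_initial_segment)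
    show "?t (p + P) \<le> 1 / 2 ^ Suc (p + P) * 2" for p
      using assms(1)[OF norm_k[of "p + P"]] by (intro mult_left_mono) auto
  qed
  also have "\<dots> = 2 / 2 ^ P" by (rule suminf_geometric_tail)
  finally have 2: "(\<Sum>p. ?t (p + P)) \<le> 2 / 2 ^ P" .
  show ?thesis unfolding weighted_form_def suminf_split_initial_segment[OF sm, of P]
    using 1 2 by simp
qed

lemma weighted_form_triangle:
  assumes "\<And>x. norm x \<le> 1 \<Longrightarrow> cmod (cinner (A x - B x) x) \<le> M"
    and "\<And>x. norm x \<le> 1 \<Longrightarrow> cmod (cinner (B x - C x) x) \<le> M"
  shows "weighted_form k (\<lambda>x. A x - C x) \<le> weighted_form k (\<lambda>x. A x - B x) + weighted_form k (\<lambda>x. B x - C x)"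
proof -
  have tri: "cmod (cinner (A x - C x) x) \<le> cmod (cinner (A x - B x) x) + cmod (cinner (B x - C x) x)" for x
    using norm_triangle_ineq[of "cinner (A x - B x) x" "cinner (B x - C x) x"] by (simp add: cinner_simps)
  have s: "summable (\<lambda>p. 1 / 2 ^ Suc p * cmod (cinner (A (k (Suc p)) - B (k (Suc p))) (k (Suc p))))"
    "summable (\<lambda>p. 1 / 2 ^ Suc p * cmod (cinner (B (k (Suc p)) - C (k (Suc p))) (k (Suc p))))"
    using weighted_form_summable[of "\<lambda>x. A x - B x" M] weighted_form_summable[of "\<lambda>x. B x - C x" M] assms
    by auto
  show ?thesis unfolding weighted_form_def suminf_add[OF s]
  proof (rule suminf_le)
    have "cmod (cinner (A x - C x) x) \<le> M + M" if "norm x \<le> 1" for x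
      using tri[of x] assms[OF that] by linarith
    then show "summable (\<lambda>p. 1 / 2 ^ Suc p * cmod (cinner (A (k (Suc p)) - C (k (Suc p))) (k (Suc p))))"
      using weighted_form_summable[of "\<lambda>x. A x - C x" "M + M"] by auto
    show "1 / 2 ^ Suc p * cmod (cinner (A (k (Suc p)) - C (k (Suc p))) (k (Suc p)))
      \<le> 1 / 2 ^ Suc p * cmod (cinner (A (k (Suc p)) - B (k (Suc p))) (k (Suc p)))
       + 1 / 2 ^ Suc p * cmod (cinner (B (k (Suc p)) - C (k (Suc p))) (k (Suc p)))" for p
      unfolding distrib_left[symmetric] using tri by (intro mult_left_mono) auto
  qed (intro summable_add s)
qed

text \<open>All the terms \<open>\<langle>A (k p), k p\<rangle>\<close> vanish. By density the quadratic form of \<open>A\<close> vanishes on the unit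
  ball, hence everywhere, and polarization gives \<open>A = 0\<close>.\<close>

lemma weighted_form_definite:
  assumes A: "bounded_clinear A" and M: "\<And>x. norm x \<le> 1 \<Longrightarrow> cmod (cinner (A x) x) \<le> M"
    and "weighted_form k A = 0"
  shows "A x = 0"
proof -
  let ?t = "\<lambda>p. 1 / 2 ^ Suc p * cmod (cinner (A (k (Suc p))) (k (Suc p)))"
  have sm: "summable ?t" using M by (rule weighted_form_summable)
  have "\<forall>p. ?t p = 0"
    using suminf_eq_zero_iff[OF sm] assms(3) unfolding weighted_form_def by simp
  then have kp: "cinner (A (k (Suc p))) (k (Suc p)) = 0" for p by simp
  have cont: "continuous_on S (\<lambda>x. cinner (A x) x)" for S
    by (intro continuous_intros continuous_on_subset[OF bounded_clinear_continuous[OF A]]) simp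
  have ball: "cinner (A x) x = 0" if "norm x \<le> 1" for x
  proof (rule continuous_constant_on_closure[OF cont[of "closure (k ` {1..})"]])
    show "x \<in> closure (k ` {1..})" using k_dense that by auto
    fix y assume "y \<in> k ` {1..}"
    then obtain p where "y = k p" "p \<ge> 1" by auto
    then show "cinner (A y) y = 0" using kp[of "p - 1"] by simp
  qed
  show ?thesis
  proof (rule quadratic_form_zero[OF A])
    fix x :: 'k
    define r where "r = 1 / (1 + norm x)"
    have r: "r > 0" by (simp add: r_def add_pos_nonneg)
    have "norm (r *\<^sub>R x) \<le> 1" by (simp add: r_def divide_le_eq add_pos_nonneg)
    then have "cinner (A (r *\<^sub>R x)) (r *\<^sub>R x) = 0" by (rule ball)
    moreover have "A (r *\<^sub>R x) = r *\<^sub>R A x"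
      by (metis bounded_clinear_scaleC[OF A] scaleC_of_real)
    ultimately show "cinner (A x) x = 0" using r by (auto simp: cinner_scaleR_left cinner_scaleR_right)
  qed
qed

end

text \<open>The properties of the two kinds of operator system that make the set of unital completely
  positive maps a compact metric space. The last one says that the Lipschitz ball is totally
  bounded, in the form that every element is nearly a combination, with bounded coefficients, of
  finitely many fixed elements.\<close>

locale lip_system = ball_sequence k for k :: "nat \<Rightarrow> 'k::complex_hilbert" +
  fixes H :: "circle_fun set" and E E0 :: "circle_op set" and L :: "circle_op \<Rightarrow> real"
  assumes H_L2: "H \<subseteq> L2_circle"
    and H_nonzero: "\<exists>g\<in>H. L2_norm g \<noteq> 0"
    and E_maps: "\<And>T g. T \<in> E \<Longrightarrow> g \<in> H \<Longrightarrow> T g \<in> L2_circle"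
    and E_bounded: "\<And>T. T \<in> E \<Longrightarrow> bounded_op H T"
    and E_unit: "op_on H id \<in> E"
    and E_add: "\<And>S T. S \<in> E \<Longrightarrow> T \<in> E \<Longrightarrow> (\<lambda>g \<theta>. S g \<theta> + T g \<theta>) \<in> E"
    and E_scale: "\<And>c T. T \<in> E \<Longrightarrow> (\<lambda>g \<theta>. c * T g \<theta>) \<in> E"
    and E_adjoint: "\<And>T. T \<in> E \<Longrightarrow> \<exists>T'\<in>E. \<forall>g\<in>H. \<forall>h\<in>H. L2_inner (T' g) h = L2_inner g (T h)"
    and E0_subset: "E0 \<subseteq> E"
    and E0_absorbed: "\<And>T. T \<in> E0 \<Longrightarrow> \<exists>c>0. (\<lambda>g \<theta>. complex_of_real c * T g \<theta>) \<in> lip_ball H E0 L"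
    and E0_dense: "\<And>T \<epsilon>. T \<in> E \<Longrightarrow> 0 < \<epsilon> \<Longrightarrow> \<exists>S\<in>E0. op_norm H (\<lambda>g \<theta>. T g \<theta> - S g \<theta>) \<le> \<epsilon>"
    and E0_nonempty: "E0 \<noteq> {}"
    and ball_approx: "\<And>\<epsilon>. 0 < \<epsilon> \<Longrightarrow> \<exists>(I :: (int \<times> int) set) \<tau>. finite I \<and> (\<forall>i\<in>I. \<tau> i \<in> E) \<and>
      (\<forall>T\<in>lip_ball H E0 L. \<exists>c. (\<forall>i\<in>I. cmod (c i) \<le> 1) \<and>
         op_norm H (\<lambda>g \<theta>. T g \<theta> - (\<Sum>i\<in>I. c i * \<tau> i g \<theta>)) \<le> \<epsilon>)"
begin

lemma ball_nonempty: "lip_ball H E0 L \<noteq> {}"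
  using E0_nonempty E0_absorbed by blast

lemma ball_subset: "lip_ball H E0 L \<subseteq> E"
  using E0_subset by (auto simp: lip_ball_def)

lemma E_diff: "S \<in> E \<Longrightarrow> T \<in> E \<Longrightarrow> (\<lambda>g \<theta>. S g \<theta> - T g \<theta>) \<in> E"
  using E_add[OF _ E_scale[of T "-1"]] by simp

lemma E_zero: "(\<lambda>g \<theta>. 0) \<in> E"
  using E_scale[OF E_unit, of 0] by simp

lemma E_sum: "(\<And>i. i \<in> I \<Longrightarrow> \<tau> i \<in> E) \<Longrightarrow> (\<lambda>g \<theta>. \<Sum>i\<in>I. c i * \<tau> i g \<theta>) \<in> E"
  by (induction I rule: infinite_finite_induct) (auto simp: E_zero E_add E_scale)

lemma op_norm_E_nonneg: "T \<in> E \<Longrightarrow> 0 \<le> op_norm H T"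
  using H_nonzero E_bounded op_norm_nonneg by blast

lemma UCP_diff:
  fixes \<phi> :: "circle_op \<Rightarrow> 'a \<Rightarrow> 'a::complex_hilbert"
  assumes "\<phi> \<in> UCP H E" "S \<in> E" "T \<in> E"
  shows "\<phi> (\<lambda>g \<theta>. S g \<theta> - T g \<theta>) = (\<lambda>x. \<phi> S x - \<phi> T x)"
proof -
  have "(-1) *\<^sub>C x = - x" for x :: "'a::complex_hilbert" using scaleC_of_real[of "-1" x] by simp
  then show ?thesis
    using UCP_add[OF assms(1,2) E_scale[OF assms(3), of "-1"]] UCP_scale[OF assms(1,3), of "-1"]
    by (simp only: mult_minus1 add_uminus_conv_diff)
qed

lemma UCP_zero: "\<phi> \<in> UCP H E \<Longrightarrow> \<phi> (\<lambda>g \<theta>. 0) = (\<lambda>x. 0)"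
  using UCP_diff[of \<phi> "op_on H id" "op_on H id"] E_unit by simp

lemma UCP_sum:
  assumes "\<phi> \<in> UCP H E" "\<And>i. i \<in> I \<Longrightarrow> \<tau> i \<in> E"
  shows "\<phi> (\<lambda>g \<theta>. \<Sum>i\<in>I. c i * \<tau> i g \<theta>) = (\<lambda>x. \<Sum>i\<in>I. c i *\<^sub>C \<phi> (\<tau> i) x)"
  using assms(2)
  by (induction I rule: infinite_finite_induct)
     (auto simp: UCP_zero[OF assms(1)] UCP_add[OF assms(1)] UCP_scale[OF assms(1)] E_scale E_sum)

text \<open>The two by two matrix with diagonal \<open>r\<close> and off-diagonal entries \<open>T\<close> and its adjoint is positive
  when \<open>r\<close> is the norm of \<open>T\<close>. Positivity of its image under \<open>\<phi>\<close> is the claim for unit vectors.\<close>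

lemma UCP_contractive:
  assumes \<phi>: "\<phi> \<in> UCP H E" and T: "T \<in> E"
  shows "cmod (cinner (\<phi> T x) y) \<le> op_norm H T * norm x * norm (y :: 'k)"
proof -
  define r where "r = op_norm H T"
  obtain T' where T': "T' \<in> E" and adj: "\<And>g h. g \<in> H \<Longrightarrow> h \<in> H \<Longrightarrow> L2_inner (T' g) h = L2_inner g (T h)"
    using E_adjoint[OF T] by blast
  define D where "D = (\<lambda>g \<theta>. complex_of_real r * op_on H id g \<theta>)"
  define X where "X i j = (if i = j then D else if i = (0::nat) then T else T')" for i j
  have D: "D \<in> E" unfolding D_def by (intro E_scale E_unit)
  have XE: "X i j \<in> E" for i j using T T' D by (simp add: X_def)
  have "mat_positive H L2_inner 2 X"
    unfolding mat_positive_def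
  proof (intro allI impI)
    fix h :: "nat \<Rightarrow> circle_fun" assume "\<forall>i<2. h i \<in> H"
    then have h: "h 0 \<in> H" "h 1 \<in> H" by auto
    define a b where "a = L2_norm (h 0)" and "b = L2_norm (h 1)"
    define t where "t = L2_inner (T (h 1)) (h 0)"
    have "cmod t \<le> L2_norm (T (h 1)) * a"
      unfolding t_def a_def using h H_L2 E_maps[OF T h(2)] by (intro L2_Cauchy_Schwarz) auto
    also have "\<dots> \<le> r * b * a"
      using op_norm_bound[OF E_bounded[OF T] h(2)] by (simp add: a_def b_def r_def mult_right_mono)
    finally have "Re t \<ge> - (r * a * b)"
      using abs_Re_le_cmod[of t] by (simp add: mult_ac)
    moreover have "0 \<le> r * (a - b)\<^sup>2" using op_norm_E_nonneg[OF T] by (simp add: r_def)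
    ultimately have nonneg: "0 \<le> r * a\<^sup>2 + 2 * Re t + r * b\<^sup>2" by (simp add: power2_diff algebra_simps)
    have "L2_inner (T' (h 0)) (h 1) = cnj t"
      unfolding t_def adj[OF h] by (rule L2_inner_commute)
    moreover have "D (h 0) = (\<lambda>\<theta>. complex_of_real r * h 0 \<theta>)" "D (h 1) = (\<lambda>\<theta>. complex_of_real r * h 1 \<theta>)"
      using h by (simp_all add: D_def op_on_def)
    ultimately have "(\<Sum>i<2. \<Sum>j<2. L2_inner (X i j (h j)) (h i)) = complex_of_real (r * a\<^sup>2 + 2 * Re t + r * b\<^sup>2)"
      by (simp add: numeral_2_eq_2 X_def L2_inner_scale_left L2_inner_self a_def b_def t_def complex_eq_iff
          flip: of_real_power)
    then show "(\<Sum>i<2. \<Sum>j<2. L2_inner (X i j (h j)) (h i)) \<in> \<real>\<^sub>\<ge>\<^sub>0"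
      using nonneg by (simp only: nonneg_Reals_of_real_iff)
  qed
  then have pos: "mat_positive UNIV cinner 2 (\<lambda>i j. \<phi> (X i j))"
    using UCP_positive[OF \<phi>, of 2 X] XE by blast
  have \<phi>D: "\<phi> D = (\<lambda>x. complex_of_real r *\<^sub>C x)"
    unfolding D_def by (simp add: UCP_scale[OF \<phi> E_unit] UCP_unit[OF \<phi>])
  have sum: "complex_of_real (r * ((norm x)\<^sup>2 + (norm y)\<^sup>2)) + cinner (\<phi> T y) x + cinner (\<phi> T' x) y \<in> \<real>\<^sub>\<ge>\<^sub>0" for x y
  proof -
    have "(\<Sum>i<2. \<Sum>j<2. cinner (\<phi> (X i j) ((case_nat x (\<lambda>_. y)) j)) ((case_nat x (\<lambda>_. y)) i)) \<in> \<real>\<^sub>\<ge>\<^sub>0"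
      using pos unfolding mat_positive_def by blast
    then show ?thesis by (simp add: numeral_2_eq_2 X_def \<phi>D cinner_simps cinner_self algebra_simps)
  qed
  have unit_vectors: "cmod (cinner (\<phi> T y) x) \<le> r" if x: "norm x = 1" and y: "norm y = 1" for x y
  proof (rule cmod_le_by_rotation)
    define a where "a = cinner (\<phi> T y) x"
    define b where "b = cinner (\<phi> T' x) y"
    have rot: "complex_of_real (r * 2) + \<zeta> * a + cnj \<zeta> * b \<in> \<real>\<^sub>\<ge>\<^sub>0" if "cmod \<zeta> = 1" for \<zeta>
      using sum[of x "\<zeta> *\<^sub>C y"] that x y bounded_clinear_scaleC[OF UCP_clinear[OF \<phi> T]]
      by (simp add: norm_scaleC cinner_simps a_def b_def)
    \<comment> \<open>the values \<open>1\<close> and \<open>\<i>\<close> of \<open>\<zeta>\<close> show that \<open>\<phi> T'\<close> is the adjoint of \<open>\<phi> T\<close>\<close>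
    have b: "b = cnj a"
      using rot[of 1] rot[of \<i>] by (simp add: complex_eq_iff complex_nonneg_Reals_iff)
    fix \<zeta> :: complex assume "cmod \<zeta> = 1"
    then have "complex_of_real (r * 2) + (- \<zeta>) * a + cnj (- \<zeta>) * b \<in> \<real>\<^sub>\<ge>\<^sub>0" by (intro rot) simp
    then show "Re (\<zeta> * a) \<le> r" by (simp add: complex_nonneg_Reals_iff b)
  qed
  show ?thesis
  proof (cases "x = 0 \<or> y = 0")
    case True
    then show ?thesis using UCP_clinear[OF \<phi> T] by (auto simp: bounded_clinear_def linear_simps)
  next
    case False
    define a b where "a = norm x" and "b = norm y"
    have ab: "a > 0" "b > 0" using False by (auto simp: a_def b_def)
    let ?x = "complex_of_real (1 / a) *\<^sub>C x" and ?y = "complex_of_real (1 / b) *\<^sub>C y"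
    have "norm ?x = 1" "norm ?y = 1" using ab unfolding norm_scaleC norm_of_real by (auto simp: a_def b_def)
    then have "cmod (cinner (\<phi> T ?x) ?y) \<le> r" by (intro unit_vectors)
    then have "cmod (cinner (\<phi> T x) y) / (a * b) \<le> r"
      unfolding bounded_clinear_scaleC[OF UCP_clinear[OF \<phi> T]] cinner_simps using ab
      by (simp add: norm_mult norm_divide mult.commute)
    then show ?thesis using ab by (simp add: field_simps r_def a_def b_def)
  qed
qed

lemma UCP_form_le:
  assumes "\<phi> \<in> UCP H E" "T \<in> E" "norm (x::'k) \<le> 1"
  shows "cmod (cinner (\<phi> T x) x) \<le> op_norm H T"
proof -
  have "cmod (cinner (\<phi> T x) x) \<le> op_norm H T * (norm x * norm x)"
    using UCP_contractive[OF assms(1,2), of x x] by (simp add: mult.assoc)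
  also have "\<dots> \<le> op_norm H T * 1"
    using assms(3) op_norm_E_nonneg[OF assms(2)] by (intro mult_left_mono mult_le_one) auto
  finally show ?thesis by simp
qed

lemma UCP_form_diff_le:
  assumes "\<phi> \<in> UCP H E" "\<psi> \<in> UCP H E" "T \<in> E" "norm (x::'k) \<le> 1"
  shows "cmod (cinner (\<phi> T x - \<psi> T x) x) \<le> 2 * op_norm H T"
  using norm_triangle_ineq4[of "cinner (\<phi> T x) x" "cinner (\<psi> T x) x"]
    UCP_form_le[OF assms(1,3,4)] UCP_form_le[OF assms(2,3,4)] by (simp add: cinner_simps)

lemma UCP_form_ball:
  assumes "\<phi> \<in> UCP H E" "\<psi> \<in> UCP H E" "T \<in> lip_ball H E0 L" "norm (x::'k) \<le> 1"
  shows "cmod (cinner (\<phi> T x - \<psi> T x) x) \<le> 2"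
  using UCP_form_diff_le[OF assms(1,2) _ assms(4), of T] assms(3) ball_subset by (auto simp: lip_ball_def)

abbreviation udist where "udist \<equiv> UCP_dist k H E E0 L"

lemma UCP_dist_eq:
  assumes "\<phi> \<in> UCP H E" "\<psi> \<in> UCP H E"
  shows "udist \<phi> \<psi> = (SUP T\<in>lip_ball H E0 L. weighted_form k (\<lambda>x. \<phi> T x - \<psi> T x))"
proof -
  have "{\<Sum>p. 1 / 2 ^ Suc p * cmod (cinner (\<phi> T (k (Suc p)) - \<psi> T (k (Suc p))) (k (Suc p)))
                | T. T \<in> E0 \<and> op_norm H T \<le> 1 \<and> L T \<le> 1}
    = (\<lambda>T. weighted_form k (\<lambda>x. \<phi> T x - \<psi> T x)) ` lip_ball H E0 L"
    unfolding weighted_form_def lip_ball_def by blast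
  then show ?thesis using assms unfolding UCP_dist_def by simp
qed

lemma UCP_dist_upper:
  assumes "\<phi> \<in> UCP H E" "\<psi> \<in> UCP H E" "T \<in> lip_ball H E0 L"
  shows "weighted_form k (\<lambda>x. \<phi> T x - \<psi> T x) \<le> udist \<phi> \<psi>"
proof -
  have "bdd_above ((\<lambda>T. weighted_form k (\<lambda>x. \<phi> T x - \<psi> T x)) ` lip_ball H E0 L)"
    using UCP_form_ball[OF assms(1,2)] by (intro bdd_aboveI2[of _ _ 2] weighted_form_le) auto
  then show ?thesis unfolding UCP_dist_eq[OF assms(1,2)] using assms(3) by (intro cSUP_upper)
qed

lemma UCP_dist_least:
  assumes "\<phi> \<in> UCP H E" "\<psi> \<in> UCP H E"
    and "\<And>T. T \<in> lip_ball H E0 L \<Longrightarrow> weighted_form k (\<lambda>x. \<phi> T x - \<psi> T x) \<le> r"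
  shows "udist \<phi> \<psi> \<le> r"
  unfolding UCP_dist_eq[OF assms(1,2)] using ball_nonempty assms(3) by (rule cSUP_least)

text \<open>Maps at distance \<open>0\<close> agree on the Lipschitz ball, and hence on all of \<open>E\<close>, because the ball spans a
  dense subspace and the maps are contractive.\<close>

lemma UCP_dist_definite:
  assumes \<phi>: "\<phi> \<in> UCP H E" and \<psi>: "\<psi> \<in> UCP H E" and 0: "udist \<phi> \<psi> = 0"
  shows "\<phi> = \<psi>"
proof (rule extensionalityI[OF UCP_extensional[OF \<phi>] UCP_extensional[OF \<psi>]])
  have on_ball: "\<phi> T x = \<psi> T x" if T: "T \<in> lip_ball H E0 L" for T x
  proof -
    have TE: "T \<in> E" using T ball_subset by blast
    have "bounded_clinear (\<lambda>x. \<phi> T x - \<psi> T x)"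
      using UCP_clinear[OF \<phi> TE] UCP_clinear[OF \<psi> TE]
      by (auto simp: bounded_clinear_def intro: bounded_linear_sub)
         (metis add_diff_cancel diff_add_cancel scaleC_add_right)
    moreover have "weighted_form k (\<lambda>x. \<phi> T x - \<psi> T x) = 0"
      using UCP_dist_upper[OF \<phi> \<psi> T] weighted_form_nonneg[of "\<lambda>x. \<phi> T x - \<psi> T x" 2]
        UCP_form_ball[OF \<phi> \<psi> T] 0 by simp
    ultimately have "\<phi> T x - \<psi> T x = 0"
      using UCP_form_ball[OF \<phi> \<psi> T] by (intro weighted_form_definite[of "\<lambda>x. \<phi> T x - \<psi> T x"])
    then show ?thesis by simp
  qed
  have on_E0: "\<phi> S x = \<psi> S x" if S: "S \<in> E0" for S x
  proof -
    obtain c where c: "c > 0" "(\<lambda>g \<theta>. complex_of_real c * S g \<theta>) \<in> lip_ball H E0 L"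
      using E0_absorbed[OF S] by blast
    have SE: "S \<in> E" using S E0_subset by blast
    have "complex_of_real c *\<^sub>C \<phi> S x = complex_of_real c *\<^sub>C \<psi> S x"
      using on_ball[OF c(2), of x] by (simp add: UCP_scale[OF \<phi> SE] UCP_scale[OF \<psi> SE])
    then show ?thesis using c(1) by (simp add: scaleC_of_real)
  qed
  show "\<phi> T = \<psi> T" if T: "T \<in> E" for T
  proof
    fix x
    have small: "cmod (cinner (\<phi> T x - \<psi> T x) y) \<le> \<epsilon> * (2 * norm x * norm y)" if e: "\<epsilon> > 0" for \<epsilon> y
    proof -
      obtain S where S: "S \<in> E0" and n: "op_norm H (\<lambda>g \<theta>. T g \<theta> - S g \<theta>) \<le> \<epsilon>"
        using E0_dense[OF T e] by blast
      have SE: "S \<in> E" using S E0_subset by blast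
      have le: "cmod (cinner (\<rho> T x - \<rho> S x) y) \<le> \<epsilon> * (norm x * norm y)" if \<rho>: "\<rho> \<in> UCP H E" for \<rho>
        using UCP_contractive[OF \<rho> E_diff[OF T SE], of x y] mult_right_mono[OF n, of "norm x * norm y"]
        by (simp add: UCP_diff[OF \<rho> T SE] mult.assoc)
      have "cinner (\<phi> T x - \<psi> T x) y = cinner (\<phi> T x - \<phi> S x) y - cinner (\<psi> T x - \<psi> S x) y"
        using on_E0[OF S, of x] by (simp add: cinner_simps)
      then show ?thesis using le[OF \<phi>] le[OF \<psi>]
          norm_triangle_ineq4[of "cinner (\<phi> T x - \<phi> S x) y" "cinner (\<psi> T x - \<psi> S x) y"] by simp
    qed
    have "\<phi> T x - \<psi> T x = 0"
    proof (rule cinner_eq_zero_all, rule ccontr)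
      fix y assume ne: "cinner (\<phi> T x - \<psi> T x) y \<noteq> 0"
      define N where "N = 2 * norm x * norm y + 1"
      have N: "N > 0" unfolding N_def by (simp add: add_nonneg_pos)
      let ?c = "cmod (cinner (\<phi> T x - \<psi> T x) y)"
      have "?c \<le> ?c / (2 * N) * (2 * norm x * norm y)" using ne N by (intro small) simp
      also have "\<dots> \<le> ?c / (2 * N) * N" using N by (intro mult_left_mono) (auto simp: N_def)
      also have "\<dots> = ?c / 2" using N by simp
      finally show False using ne by simp
    qed
    then show "\<phi> T x = \<psi> T x" by simp
  qed
qed

lemma UCP_dist_nonneg: "0 \<le> udist \<phi> \<psi>"
proof (cases "\<phi> \<in> UCP H E \<and> \<psi> \<in> UCP H E")
  case True
  obtain T where "T \<in> lip_ball H E0 L" using ball_nonempty by blast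
  then show ?thesis
    using UCP_dist_upper[of \<phi> \<psi> T] weighted_form_nonneg[of "\<lambda>x. \<phi> T x - \<psi> T x" 2]
      UCP_form_ball[of \<phi> \<psi> T] True by (meson order_trans)
qed (auto simp: UCP_dist_def)

lemma Metric_space_UCP: "Metric_space (UCP H E) udist"
proof
  fix \<phi> \<psi> \<rho> :: "circle_op \<Rightarrow> 'k \<Rightarrow> 'k"
  show "0 \<le> udist \<phi> \<psi>" by (rule UCP_dist_nonneg)
  have "cinner (a - b) c = - cinner (b - a) c" for a b c :: 'k by (simp add: cinner_simps)
  then have "cmod (cinner (a - b) c) = cmod (cinner (b - a) c)" for a b c :: 'k by (metis norm_minus_cancel)
  then have "weighted_form k (\<lambda>x. \<phi> T x - \<psi> T x) = weighted_form k (\<lambda>x. \<psi> T x - \<phi> T x)" for T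
    unfolding weighted_form_def by simp
  then show "udist \<phi> \<psi> = udist \<psi> \<phi>"
    by (cases "\<phi> \<in> UCP H E \<and> \<psi> \<in> UCP H E") (auto simp: UCP_dist_eq, auto simp: UCP_dist_def)
  show "udist \<phi> \<psi> = 0 \<longleftrightarrow> \<phi> = \<psi>" if \<phi>: "\<phi> \<in> UCP H E" and \<psi>: "\<psi> \<in> UCP H E"
  proof
    show "udist \<phi> \<psi> = 0" if "\<phi> = \<psi>"
      using \<phi> that ball_nonempty by (simp add: UCP_dist_eq weighted_form_def)
  qed (rule UCP_dist_definite[OF \<phi> \<psi>])
  assume \<phi>: "\<phi> \<in> UCP H E" and \<psi>: "\<psi> \<in> UCP H E" and \<rho>: "\<rho> \<in> UCP H E"
  show "udist \<phi> \<rho> \<le> udist \<phi> \<psi> + udist \<psi> \<rho>"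
  proof (rule UCP_dist_least[OF \<phi> \<rho>])
    fix T assume T: "T \<in> lip_ball H E0 L"
    have "weighted_form k (\<lambda>x. \<phi> T x - \<rho> T x)
        \<le> weighted_form k (\<lambda>x. \<phi> T x - \<psi> T x) + weighted_form k (\<lambda>x. \<psi> T x - \<rho> T x)"
      using UCP_form_ball[OF \<phi> \<psi> T] UCP_form_ball[OF \<psi> \<rho> T] by (rule weighted_form_triangle)
    also have "\<dots> \<le> udist \<phi> \<psi> + udist \<psi> \<rho>"
      by (intro add_mono UCP_dist_upper \<phi> \<psi> \<rho> T)
    finally show "weighted_form k (\<lambda>x. \<phi> T x - \<rho> T x) \<le> udist \<phi> \<psi> + udist \<psi> \<rho>" .
  qed
qed

end


section \<open>Compactness\<close>

text \<open>A map \<open>\<phi>\<close> is encoded by the scalars \<open>\<langle>\<phi> T x, y\<rangle>\<close>, so that it becomes a point of a product of discs.\<close>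

type_synonym 'k forms = "circle_op \<times> 'k \<times> 'k \<Rightarrow> complex"

context lip_system
begin

text \<open>Each of the conditions involves finitely many coordinates and is closed. The bound by \<open>0\<close> off \<open>E\<close>
  matches the extensionality of the maps.\<close>

definition UCP_forms :: "'k forms set" where
  "UCP_forms = {z.
     (\<forall>T x y. cmod (z (T, x, y)) \<le> (if T \<in> E then op_norm H T * norm x * norm y else 0)) \<and>
     (\<forall>T x y w. z (T, x + y, w) = z (T, x, w) + z (T, y, w)) \<and>
     (\<forall>T c x w. z (T, c *\<^sub>C x, w) = c * z (T, x, w)) \<and>
     (\<forall>T x y w. z (T, w, x + y) = z (T, w, x) + z (T, w, y)) \<and>
     (\<forall>T c x w. z (T, w, c *\<^sub>C x) = cnj c * z (T, w, x)) \<and>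
     (\<forall>S T x y. S \<in> E \<longrightarrow> T \<in> E \<longrightarrow> z (\<lambda>g \<theta>. S g \<theta> + T g \<theta>, x, y) = z (S, x, y) + z (T, x, y)) \<and>
     (\<forall>c T x y. T \<in> E \<longrightarrow> z (\<lambda>g \<theta>. c * T g \<theta>, x, y) = c * z (T, x, y)) \<and>
     (\<forall>x y. z (op_on H id, x, y) = cinner x y) \<and>
     (\<forall>m X h. (\<forall>i<m. \<forall>j<m. X i j \<in> E) \<and> mat_positive H L2_inner m X \<longrightarrow>
        (\<Sum>i<m. \<Sum>j<m. z (X i j, h j, h i)) \<in> \<real>\<^sub>\<ge>\<^sub>0)}"

lemma UCP_formsD:
  assumes "z \<in> UCP_forms"
  shows "T \<in> E \<Longrightarrow> cmod (z (T, x, y)) \<le> op_norm H T * norm x * norm y"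
    and "z (T, x + y, w) = z (T, x, w) + z (T, y, w)"
    and "z (T, c *\<^sub>C x, w) = c * z (T, x, w)"
    and "z (T, w, x + y) = z (T, w, x) + z (T, w, y)"
    and "z (T, w, c *\<^sub>C x) = cnj c * z (T, w, x)"
    and "S \<in> E \<Longrightarrow> T \<in> E \<Longrightarrow> z (\<lambda>g \<theta>. S g \<theta> + T g \<theta>, x, y) = z (S, x, y) + z (T, x, y)"
    and "T \<in> E \<Longrightarrow> z (\<lambda>g \<theta>. c * T g \<theta>, x, y) = c * z (T, x, y)"
    and "z (op_on H id, x, y) = cinner x y"
    and "(\<forall>i<m. \<forall>j<m. X i j \<in> E) \<and> mat_positive H L2_inner m X \<Longrightarrow>
        (\<Sum>i<m. \<Sum>j<m. z (X i j, h j, h i)) \<in> \<real>\<^sub>\<ge>\<^sub>0"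
proof -
  note z = assms[unfolded UCP_forms_def mem_Collect_eq]
  note z2 = conjunct2[OF z] note z3 = conjunct2[OF z2] note z4 = conjunct2[OF z3]
  note z5 = conjunct2[OF z4] note z6 = conjunct2[OF z5] note z7 = conjunct2[OF z6]
  note z8 = conjunct2[OF z7] note z9 = conjunct2[OF z8]
  show "T \<in> E \<Longrightarrow> cmod (z (T, x, y)) \<le> op_norm H T * norm x * norm y"
    using conjunct1[OF z, rule_format, of T x y] by simp
  show "z (T, x + y, w) = z (T, x, w) + z (T, y, w)" using conjunct1[OF z2] by blast
  show "z (T, c *\<^sub>C x, w) = c * z (T, x, w)" using conjunct1[OF z3] by blast
  show "z (T, w, x + y) = z (T, w, x) + z (T, w, y)" using conjunct1[OF z4] by blast
  show "z (T, w, c *\<^sub>C x) = cnj c * z (T, w, x)" using conjunct1[OF z5] by blast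
  show "S \<in> E \<Longrightarrow> T \<in> E \<Longrightarrow> z (\<lambda>g \<theta>. S g \<theta> + T g \<theta>, x, y) = z (S, x, y) + z (T, x, y)"
    using conjunct1[OF z6] by blast
  show "T \<in> E \<Longrightarrow> z (\<lambda>g \<theta>. c * T g \<theta>, x, y) = c * z (T, x, y)" using conjunct1[OF z7] by blast
  show "z (op_on H id, x, y) = cinner x y" using conjunct1[OF z8] by blast
  show "(\<forall>i<m. \<forall>j<m. X i j \<in> E) \<and> mat_positive H L2_inner m X \<Longrightarrow>
        (\<Sum>i<m. \<Sum>j<m. z (X i j, h j, h i)) \<in> \<real>\<^sub>\<ge>\<^sub>0"
    using z9 by blast
qed

lemma compact_UCP_forms: "compact UCP_forms"
proof -
  define r where "r a = (case a of (T, x::'k, y::'k) \<Rightarrow> if T \<in> E then op_norm H T * norm x * norm y else 0)" for a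
  have coord: "continuous_on UNIV (\<lambda>z::'k forms. z a)" for a
    by (rule continuous_on_product_coordinates)
  have psd: "closed {z :: 'k forms. (\<Sum>i<m. \<Sum>j<m. z (X i j, h j, h i)) \<in> \<real>\<^sub>\<ge>\<^sub>0}" for m X h
  proof -
    have "closed ((\<lambda>z :: 'k forms. \<Sum>i<m. \<Sum>j<m. z (X i j, h j, h i)) -` \<real>\<^sub>\<ge>\<^sub>0)"
      by (intro closed_vimage closed_nonneg_Reals_complex continuous_on_sum coord)
    then show ?thesis by (simp add: vimage_def)
  qed
  have "closed UCP_forms"
    unfolding UCP_forms_def
    by (intro closed_Collect_conj closed_Collect_all closed_Collect_imp open_Collect_const psd
          closed_Collect_eq closed_Collect_le continuous_on_const continuous_on_add continuous_on_mult
          continuous_on_norm coord)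
  moreover have "compact (PiE UNIV (\<lambda>a. cball (0::complex) (r a)))"
  proof -
    have "compactin (product_topology (\<lambda>a. euclidean) UNIV) (PiE UNIV (\<lambda>a. cball (0::complex) (r a)))"
      by (simp add: compactin_PiE)
    then show ?thesis by (simp add: euclidean_product_topology)
  qed
  moreover have "UCP_forms \<subseteq> PiE UNIV (\<lambda>a. cball (0::complex) (r a))"
    by (auto simp: UCP_forms_def r_def PiE_def extensional_def)
  ultimately show ?thesis by (metis compact_Int_closed inf.absorb_iff2)
qed

definition map_of_forms :: "'k forms \<Rightarrow> circle_op \<Rightarrow> 'k \<Rightarrow> 'k" where
  "map_of_forms z = restrict (\<lambda>T. SOME A. bounded_clinear A \<and> (\<forall>x y. cinner (A x) y = z (T, x, y))) E"

lemma map_of_forms: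
  assumes z: "z \<in> UCP_forms" and T: "T \<in> E"
  shows "bounded_clinear (map_of_forms z T)" "cinner (map_of_forms z T x) y = z (T, x, y)"
proof -
  have "\<exists>A. bounded_clinear A \<and> (\<forall>x y. cinner (A x) y = z (T, x, y))"
    using UCP_formsD[OF z] T
    by (intro sesquilinear_representation[of "\<lambda>x y. z (T, x, y)" "op_norm H T"]) auto
  from someI_ex[OF this]
  show "bounded_clinear (map_of_forms z T)" "cinner (map_of_forms z T x) y = z (T, x, y)"
    using T by (auto simp: map_of_forms_def)
qed

lemma op_eqI_cinner: "(\<And>x y. cinner (A x) y = cinner (B x) y) \<Longrightarrow> A = (B :: 'k \<Rightarrow> 'k)"
  using cinner_eq_zero_all[of "A _ - B _"] by (simp add: cinner_simps fun_eq_iff)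

lemma map_of_forms_UCP:
  assumes z: "z \<in> UCP_forms" shows "map_of_forms z \<in> UCP H E"
  unfolding UCP_def
proof (intro CollectI conjI ballI allI impI)
  show "map_of_forms z \<in> extensional E" by (simp add: map_of_forms_def)
  fix T assume T: "T \<in> E"
  show "bounded_clinear (map_of_forms z T)" using map_of_forms(1)[OF z T] .
  show "map_of_forms z (\<lambda>g \<theta>. c * T g \<theta>) = (\<lambda>x. c *\<^sub>C map_of_forms z T x)" for c
    by (rule op_eqI_cinner)
       (use z T in \<open>simp add: cinner_simps map_of_forms(2)[OF z] E_scale UCP_formsD(7)[OF z]\<close>)
  show "map_of_forms z (\<lambda>g \<theta>. T g \<theta> + S g \<theta>) = (\<lambda>x. map_of_forms z T x + map_of_forms z S x)" if "S \<in> E" for S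
    by (rule op_eqI_cinner)
       (use z T that in \<open>simp add: cinner_simps map_of_forms(2)[OF z] E_add UCP_formsD(6)[OF z]\<close>)
next
  show "map_of_forms z (op_on H id) = id"
    by (rule op_eqI_cinner)
       (use z E_unit in \<open>simp add: map_of_forms(2)[OF z] UCP_formsD(8)[OF z]\<close>)
  fix m X assume X: "(\<forall>i<m. \<forall>j<m. X i j \<in> E) \<and> mat_positive H L2_inner m X"
  show "mat_positive UNIV cinner m (\<lambda>i j. map_of_forms z (X i j))"
    unfolding mat_positive_def
  proof (intro allI impI)
    fix h :: "nat \<Rightarrow> 'k"
    have "(\<Sum>i<m. \<Sum>j<m. z (X i j, h j, h i)) \<in> \<real>\<^sub>\<ge>\<^sub>0"
      using X by (rule UCP_formsD(9)[OF z])
    then show "(\<Sum>i<m. \<Sum>j<m. cinner (map_of_forms z (X i j) (h j)) (h i)) \<in> \<real>\<^sub>\<ge>\<^sub>0"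
      using X by (simp add: map_of_forms(2)[OF z])
  qed
qed

lemma forms_of_UCP:
  fixes \<phi> :: "circle_op \<Rightarrow> 'k \<Rightarrow> 'k"
  assumes \<phi>: "\<phi> \<in> UCP H E"
  defines "z \<equiv> \<lambda>(T, x, y). if T \<in> E then cinner (\<phi> T x) y else 0"
  shows "z \<in> UCP_forms" "map_of_forms z = \<phi>"
proof -
  have z: "z (T, x, y) = (if T \<in> E then cinner (\<phi> T x) y else 0)" for T x y by (simp add: z_def)
  have pos: "(\<Sum>i<m. \<Sum>j<m. z (X i j, h j, h i)) \<in> \<real>\<^sub>\<ge>\<^sub>0"
    if X: "(\<forall>i<m. \<forall>j<m. X i j \<in> E) \<and> mat_positive H L2_inner m X" for m X h
  proof -
    have "mat_positive UNIV cinner m (\<lambda>i j. \<phi> (X i j))" using UCP_positive[OF \<phi>, of m X] X by blast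
    then have "(\<Sum>i<m. \<Sum>j<m. cinner (\<phi> (X i j) (h j)) (h i)) \<in> \<real>\<^sub>\<ge>\<^sub>0"
      unfolding mat_positive_def by blast
    then show ?thesis using X by (simp add: z)
  qed
  show mem: "z \<in> UCP_forms"
    unfolding UCP_forms_def mem_Collect_eq
    by (intro conjI allI impI; (rule pos, assumption)?)
      (simp_all add: z UCP_contractive[OF \<phi>] bounded_clinear_add[OF UCP_clinear[OF \<phi>]]
        bounded_clinear_scaleC[OF UCP_clinear[OF \<phi>]]
        cinner_simps UCP_add[OF \<phi>] UCP_scale[OF \<phi>] E_add E_scale E_unit UCP_unit[OF \<phi>])
  show "map_of_forms z = \<phi>"
  proof (rule extensionalityI[OF _ UCP_extensional[OF \<phi>]])
    show "map_of_forms z \<in> extensional E" by (simp add: map_of_forms_def)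
    show "map_of_forms z T = \<phi> T" if "T \<in> E" for T
      by (rule op_eqI_cinner) (use that in \<open>simp add: map_of_forms(2)[OF mem] z\<close>)
  qed
qed

text \<open>Every element of the Lipschitz ball is nearly a combination of the finitely many \<open>\<tau> i\<close>, with bounded
  coefficients. Hence maps are close in the metric as soon as they are weakly close at the \<open>\<tau> i\<close>
  on finitely many of the vectors \<open>k p\<close>; this is continuity of the metric for pointwise weak
  convergence.\<close>

lemma UCP_dist_small:
  assumes e: "0 < \<epsilon>"
  obtains I :: "(int \<times> int) set" and \<tau> P \<delta> where "finite I" "\<And>i. i \<in> I \<Longrightarrow> \<tau> i \<in> E" "0 < \<delta>"
    "\<And>\<phi> \<psi>. \<phi> \<in> UCP H E \<Longrightarrow> \<psi> \<in> UCP H E \<Longrightarrow>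
      (\<And>p i. p < P \<Longrightarrow> i \<in> I \<Longrightarrow> cmod (cinner (\<phi> (\<tau> i) (k (Suc p)) - \<psi> (\<tau> i) (k (Suc p))) (k (Suc p))) < \<delta>) \<Longrightarrow>
      udist \<phi> \<psi> < \<epsilon>"
proof -
  have "0 < \<epsilon> / 8" using e by simp
  then obtain I :: "(int \<times> int) set" and \<tau> where I: "finite I" and \<tau>: "\<forall>i\<in>I. \<tau> i \<in> E" and
    approx: "\<forall>T\<in>lip_ball H E0 L. \<exists>c. (\<forall>i\<in>I. cmod (c i) \<le> 1) \<and>
         op_norm H (\<lambda>g \<theta>. T g \<theta> - (\<Sum>i\<in>I. c i * \<tau> i g \<theta>)) \<le> \<epsilon> / 8"
    using ball_approx[of "\<epsilon> / 8"] by blast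
  obtain P where P: "(1/2) ^ P < \<epsilon> / 8"
    using real_arch_pow_inv[of "\<epsilon> / 8" "1/2"] e by auto
  define \<delta> where "\<delta> = \<epsilon> / (4 * (real (card I) + 1))"
  have \<delta>: "0 < \<delta>" using e by (simp add: \<delta>_def)
  have "udist \<phi> \<psi> < \<epsilon>" if \<phi>: "\<phi> \<in> UCP H E" and \<psi>: "\<psi> \<in> UCP H E"
    and close: "\<And>p i. p < P \<Longrightarrow> i \<in> I \<Longrightarrow>
      cmod (cinner (\<phi> (\<tau> i) (k (Suc p)) - \<psi> (\<tau> i) (k (Suc p))) (k (Suc p))) < \<delta>" for \<phi> \<psi>
  proof -
    have "udist \<phi> \<psi> \<le> \<epsilon> / 2 + 2 / 2 ^ P"
    proof (rule UCP_dist_least[OF \<phi> \<psi>])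
      fix T assume T: "T \<in> lip_ball H E0 L"
      then have TE: "T \<in> E" using ball_subset by blast
      obtain c where c: "\<forall>i\<in>I. cmod (c i) \<le> 1"
        and n: "op_norm H (\<lambda>g \<theta>. T g \<theta> - (\<Sum>i\<in>I. c i * \<tau> i g \<theta>)) \<le> \<epsilon> / 8"
        using approx T by blast
      let ?S = "\<lambda>g \<theta>. \<Sum>i\<in>I. c i * \<tau> i g \<theta>"
      have SE: "?S \<in> E" using \<tau> by (intro E_sum) auto
      show "weighted_form k (\<lambda>x. \<phi> T x - \<psi> T x) \<le> \<epsilon> / 2 + 2 / 2 ^ P"
      proof (rule weighted_form_le_initial)
        fix p assume p: "p < P"
        let ?x = "k (Suc p)"
        have sum: "cinner (\<phi> ?S ?x - \<psi> ?S ?x) ?x = (\<Sum>i\<in>I. c i * cinner (\<phi> (\<tau> i) ?x - \<psi> (\<tau> i) ?x) ?x)"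
        proof -
          have lin: "cinner (\<Sum>i\<in>J. v i) y = (\<Sum>i\<in>J. cinner (v i) y)" for J :: "(int \<times> int) set" and v and y :: 'k
            by (induction J rule: infinite_finite_induct) (auto simp: cinner_simps)
          show ?thesis
            using \<tau> by (simp add: UCP_sum[OF \<phi>] UCP_sum[OF \<psi>] cinner_simps lin sum_subtractf right_diff_distrib)
        qed
        have "cmod (cinner (\<phi> ?S ?x - \<psi> ?S ?x) ?x) \<le> (\<Sum>i\<in>I. \<delta>)"
          unfolding sum
        proof (rule sum_norm_le)
          fix i assume i: "i \<in> I"
          have "cmod (c i * cinner (\<phi> (\<tau> i) ?x - \<psi> (\<tau> i) ?x) ?x) \<le> 1 * \<delta>"
            unfolding norm_mult using c i close[OF p i] by (intro mult_mono) auto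
          then show "cmod (c i * cinner (\<phi> (\<tau> i) ?x - \<psi> (\<tau> i) ?x) ?x) \<le> \<delta>" by simp
        qed
        also have "\<dots> \<le> \<epsilon> / 4"
          using e by (simp add: \<delta>_def field_simps)
        finally have 1: "cmod (cinner (\<phi> ?S ?x - \<psi> ?S ?x) ?x) \<le> \<epsilon> / 4" .
        have 2: "cmod (cinner ((\<phi> T ?x - \<phi> ?S ?x) - (\<psi> T ?x - \<psi> ?S ?x)) ?x) \<le> 2 * (\<epsilon> / 8)"
          using UCP_form_diff_le[OF \<phi> \<psi> E_diff[OF TE SE] norm_k[of p]] n
          by (simp add: UCP_diff[OF \<phi> TE SE] UCP_diff[OF \<psi> TE SE])
        have "cinner (\<phi> T ?x - \<psi> T ?x) ?x
          = cinner (\<phi> ?S ?x - \<psi> ?S ?x) ?x + cinner ((\<phi> T ?x - \<phi> ?S ?x) - (\<psi> T ?x - \<psi> ?S ?x)) ?x"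
          by (simp add: cinner_simps)
        then show "cmod (cinner (\<phi> T ?x - \<psi> T ?x) ?x) \<le> \<epsilon> / 2"
          using norm_triangle_ineq[of "cinner (\<phi> ?S ?x - \<psi> ?S ?x) ?x"
              "cinner ((\<phi> T ?x - \<phi> ?S ?x) - (\<psi> T ?x - \<psi> ?S ?x)) ?x"] 1 2 by simp
      qed (use UCP_form_ball[OF \<phi> \<psi> T] e in auto)
    qed
    also have "\<dots> < \<epsilon> / 2 + \<epsilon> / 2"
      using P e by (intro add_strict_left_mono) (simp add: power_one_over field_simps)
    finally show ?thesis by simp
  qed
  with I \<tau> \<delta> that show ?thesis by blast
qed

text \<open>The space is the image of a compact set under a continuous map.\<close>

theorem compact_metric_UCP: "compact_metric (UCP H E) udist"
proof -
  interpret Metric_space "UCP H E" udist by (rule Metric_space_UCP)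
  have "continuous_map (top_of_set UCP_forms) mtopology map_of_forms"
    unfolding continuous_map_to_metric
  proof (intro ballI allI impI)
    fix z0 and \<epsilon> :: real assume z0: "z0 \<in> topspace (top_of_set UCP_forms)" and e: "0 < \<epsilon>"
    then have z0: "z0 \<in> UCP_forms" by simp
    obtain I :: "(int \<times> int) set" and \<tau> P \<delta> where I: "finite I" and \<tau>: "\<And>i. i \<in> I \<Longrightarrow> \<tau> i \<in> E" and \<delta>: "0 < \<delta>"
      and small: "\<And>\<phi> \<psi>. \<phi> \<in> UCP H E \<Longrightarrow> \<psi> \<in> UCP H E \<Longrightarrow>
      (\<And>p i. p < P \<Longrightarrow> i \<in> I \<Longrightarrow> cmod (cinner (\<phi> (\<tau> i) (k (Suc p)) - \<psi> (\<tau> i) (k (Suc p))) (k (Suc p))) < \<delta>) \<Longrightarrow>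
      udist \<phi> \<psi> < \<epsilon>"
      using UCP_dist_small[OF e] by metis
    define U where "U = (\<Inter>(p, i)\<in>{..<P} \<times> I. {z :: 'k forms. cmod (z0 (\<tau> i, k (Suc p), k (Suc p)) - z (\<tau> i, k (Suc p), k (Suc p))) < \<delta>})"
    have "open U" unfolding U_def
      using I by (intro open_INT) (auto intro!: open_Collect_less continuous_intros)
    then have "openin (top_of_set UCP_forms) (UCP_forms \<inter> U)" by (simp add: openin_open_Int)
    moreover have "z0 \<in> UCP_forms \<inter> U" using z0 \<delta> by (auto simp: U_def)
    moreover have "map_of_forms z \<in> mball (map_of_forms z0) \<epsilon>" if z: "z \<in> UCP_forms \<inter> U" for z
    proof -
      have "udist (map_of_forms z0) (map_of_forms z) < \<epsilon>"
        using z z0 by (intro small map_of_forms_UCP) (auto simp: cinner_simps map_of_forms(2) \<tau> U_def)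
      then show ?thesis using z z0 by (simp add: map_of_forms_UCP)
    qed
    ultimately show "\<exists>U. openin (top_of_set UCP_forms) U \<and> z0 \<in> U \<and> (\<forall>z\<in>U. map_of_forms z \<in> mball (map_of_forms z0) \<epsilon>)"
      by blast
  qed
  moreover have "compactin (top_of_set UCP_forms) UCP_forms"
    using compact_UCP_forms by (simp add: compactin_subtopology)
  ultimately have "compactin mtopology (map_of_forms ` UCP_forms)" by (rule image_compactin[rotated])
  moreover have "map_of_forms ` UCP_forms = UCP H E"
  proof (intro equalityI subsetI)
    show "\<phi> \<in> map_of_forms ` UCP_forms" if "\<phi> \<in> UCP H E" for \<phi>
      by (subst forms_of_UCP(2)[OF that, symmetric]) (rule imageI, rule forms_of_UCP(1)[OF that])
  qed (use map_of_forms_UCP in blast)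
  ultimately show ?thesis
    unfolding compact_metric_def using Metric_space_UCP by (simp add: compact_space_def)
qed

end


section \<open>A bound for the Gromov-Hausdorff distance\<close>

lemma compactin_isometric_image:
  assumes X: "compact_metric X dX" and Z: "Metric_space Z dZ"
    and f: "isometric_embedding X dX Z dZ f"
  shows "compactin (Metric_space.mtopology Z dZ) (f ` X)"
proof -
  interpret X: Metric_space X dX using X by (simp add: compact_metric_def)
  interpret Z: Metric_space Z dZ by (rule Z)
  have "continuous_map X.mtopology Z.mtopology f"
    unfolding Z.continuous_map_to_metric
  proof (intro ballI allI impI)
    fix x \<epsilon> assume "x \<in> topspace X.mtopology" and e: "(0::real) < \<epsilon>"
    then have "x \<in> X" by simp
    then show "\<exists>U. openin X.mtopology U \<and> x \<in> U \<and> (\<forall>y\<in>U. f y \<in> Z.mball (f x) \<epsilon>)"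
      using f e by (intro exI[of _ "X.mball x \<epsilon>"]) (auto simp: isometric_embedding_def)
  qed
  moreover have "compactin X.mtopology X"
    using X by (simp add: compact_metric_def compact_space_def)
  ultimately show ?thesis by (rule image_compactin[rotated])
qed

text \<open>Two nonexpansive maps that are nearly inverse to each other make the spaces close: on the
  disjoint union, take the distance of \<open>x\<close> and \<open>y\<close> to be
  \<open>max (dX x (G y)) (dY (F x) y) + \<epsilon>\<close>. The triangle inequalities use nothing but that \<open>F\<close> and \<open>G\<close>
  are nonexpansive, and \<open>\<epsilon>\<close> only serves to separate the two copies.\<close>

lemma GH_dist_le:
  fixes X :: "'a set" and Y :: "'b set"
  assumes X: "compact_metric X dX" and Y: "compact_metric Y dY"
    and F: "\<And>x. x \<in> X \<Longrightarrow> F x \<in> Y" and G: "\<And>y. y \<in> Y \<Longrightarrow> G y \<in> X"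
    and F_le: "\<And>x x'. x \<in> X \<Longrightarrow> x' \<in> X \<Longrightarrow> dY (F x) (F x') \<le> dX x x'"
    and G_le: "\<And>y y'. y \<in> Y \<Longrightarrow> y' \<in> Y \<Longrightarrow> dX (G y) (G y') \<le> dY y y'"
    and GF: "\<And>x. x \<in> X \<Longrightarrow> dX x (G (F x)) \<le> \<epsilon>" and FG: "\<And>y. y \<in> Y \<Longrightarrow> dY (F (G y)) y \<le> \<epsilon>"
    and e: "0 < \<epsilon>"
  shows "GH_dist X dX Y dY \<le> ennreal (2 * \<epsilon>)"
proof -
  interpret X: Metric_space X dX using X by (simp add: compact_metric_def)
  interpret Y: Metric_space Y dY using Y by (simp add: compact_metric_def)
  define c where "c x y = max (dX x (G y)) (dY (F x) y) + \<epsilon>" for x y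
  define Z where "Z = Inl ` X \<union> Inr ` Y"
  define d where "d u v = (case (u, v) of (Inl x, Inl x') \<Rightarrow> dX x x' | (Inl x, Inr y) \<Rightarrow> c x y
     | (Inr y, Inl x) \<Rightarrow> c x y | (Inr y, Inr y') \<Rightarrow> dY y y')" for u v :: "'a + 'b"
  have d_simps [simp]: "d (Inl x) (Inl x') = dX x x'" "d (Inl x) (Inr y) = c x y"
    "d (Inr y) (Inl x) = c x y" "d (Inr y) (Inr y') = dY y y'" for x x' y y'
    by (simp_all add: d_def)
  have c_pos: "0 < c x y" for x y
    using X.nonneg[of x "G y"] e unfolding c_def by linarith
  have c1: "c x y \<le> dX x x' + c x' y" if "x \<in> X" "x' \<in> X" "y \<in> Y" for x x' y
    using X.triangle[of x x' "G y"] Y.triangle[of "F x" "F x'" y] F_le[of x x'] that F G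
    unfolding c_def by fastforce
  have c2: "c x y \<le> c x y' + dY y' y" if "x \<in> X" "y \<in> Y" "y' \<in> Y" for x y y'
    using Y.triangle[of "F x" y' y] X.triangle[of x "G y'" "G y"] G_le[of y' y] that F G
    unfolding c_def by fastforce
  have c1': "c x y \<le> c x' y + dX x' x" if "x \<in> X" "x' \<in> X" "y \<in> Y" for x x' y
    using c1[OF that] X.commute[of x x'] by simp
  have c2': "c x y \<le> dY y y' + c x y'" if "x \<in> X" "y \<in> Y" "y' \<in> Y" for x y y'
    using c2[OF that] Y.commute[of y y'] by simp
  have c3: "dX x x' \<le> c x y + c x' y" if "x \<in> X" "x' \<in> X" "y \<in> Y" for x x' y
    using X.triangle[of x "G y" x'] X.commute[of "G y" x'] that G e
    unfolding c_def by fastforce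
  have c4: "dY y y' \<le> c x y + c x y'" if "x \<in> X" "y \<in> Y" "y' \<in> Y" for x y y'
    using Y.triangle[of y "F x" y'] Y.commute[of "F x" y] that F e
    unfolding c_def by fastforce
  have Z: "Metric_space Z d"
  proof
    fix u v w
    show "0 \<le> d u v" by (cases u; cases v) (auto intro: less_imp_le[OF c_pos])
    show "d u v = d v u" by (cases u; cases v) (auto simp: X.commute Y.commute)
    show "d u v = 0 \<longleftrightarrow> u = v" if "u \<in> Z" "v \<in> Z"
      using that c_pos by (cases u; cases v) (auto simp: Z_def less_imp_neq[symmetric])
    show "d u w \<le> d u v + d v w" if "u \<in> Z" "v \<in> Z" "w \<in> Z"
      using that by (cases u; cases v; cases w)
        (auto simp: Z_def intro: c1 c1' c2 c2' c3 c4 X.triangle Y.triangle)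
  qed
  have emb: "isometric_embedding X dX Z d Inl" "isometric_embedding Y dY Z d Inr"
    by (auto simp: isometric_embedding_def Z_def)
  have "compactin (Metric_space.mtopology Z d) (Inl ` X \<union> Inr ` Y)"
    using compactin_isometric_image[OF X Z emb(1)] compactin_isometric_image[OF Y Z emb(2)]
    by (rule compactin_Un)
  then have cZ: "compact_metric Z d"
    unfolding compact_metric_def using Z
    by (simp add: compact_space_def Z_def Metric_space.topspace_mtopology)
  have "Hausdorff_dist d (Inl ` X) (Inr ` Y) \<le> ennreal (2 * \<epsilon>)"
    unfolding Hausdorff_dist_def
  proof (rule max.boundedI)
    show "(SUP u\<in>Inl ` X. INF v\<in>Inr ` Y. ennreal (d u v)) \<le> ennreal (2 * \<epsilon>)"
    proof (rule SUP_least)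
      fix u :: "'a + 'b" assume "u \<in> Inl ` X"
      then obtain x where x: "x \<in> X" "u = Inl x" by blast
      have "c x (F x) \<le> 2 * \<epsilon>" using GF[OF x(1)] Y.zero[of "F x" "F x"] F[OF x(1)] e by (simp add: c_def)
      then show "(INF v\<in>Inr ` Y. ennreal (d u v)) \<le> ennreal (2 * \<epsilon>)"
        using x F by (intro INF_lower2[of "Inr (F x)"]) (auto intro: ennreal_leI)
    qed
    show "(SUP v\<in>Inr ` Y. INF u\<in>Inl ` X. ennreal (d u v)) \<le> ennreal (2 * \<epsilon>)"
    proof (rule SUP_least)
      fix v :: "'a + 'b" assume "v \<in> Inr ` Y"
      then obtain y where y: "y \<in> Y" "v = Inr y" by blast
      have "c (G y) y \<le> 2 * \<epsilon>" using FG[OF y(1)] X.zero[of "G y" "G y"] G[OF y(1)] e by (simp add: c_def)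
      then show "(INF u\<in>Inl ` X. ennreal (d u v)) \<le> ennreal (2 * \<epsilon>)"
        using y G by (intro INF_lower2[of "Inl (G y)"]) (auto intro: ennreal_leI)
    qed
  qed
  moreover have "GH_dist X dX Y dY \<le> Hausdorff_dist d (Inl ` X) (Inr ` Y)"
    unfolding GH_dist_def using X Y cZ emb by (auto intro!: Inf_lower)
  ultimately show ?thesis by (rule order_trans[rotated])
qed


section \<open>Smooth functions and trigonometric polynomials\<close>

abbreviation circle_deriv :: "circle_fun \<Rightarrow> circle_fun" where
  "circle_deriv g \<equiv> (\<lambda>t. vector_derivative g (at t))"

lemma Cinf_deriv_iterate:
  assumes "f \<in> Cinf_circle"
  shows "((circle_deriv ^^ j) f has_vector_derivative (circle_deriv ^^ Suc j) f \<theta>) (at \<theta>)"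
  using assms by (simp add: Cinf_circle_def vector_derivative_works[symmetric])

lemma Cinf_has_deriv: "f \<in> Cinf_circle \<Longrightarrow> (f has_vector_derivative circle_deriv f \<theta>) (at \<theta>)"
  using Cinf_deriv_iterate[of f 0 \<theta>] by simp

lemma Cinf_deriv:
  assumes f: "f \<in> Cinf_circle" shows "circle_deriv f \<in> Cinf_circle"
proof -
  have per: "periodic f" using f by (simp add: Cinf_circle_def)
  have "periodic (circle_deriv f)"
    unfolding periodic_def
  proof
    fix \<theta>
    have "((\<lambda>t. t + 2 * pi) has_vector_derivative 1) (at \<theta>)"
      using has_vector_derivative_add[OF has_vector_derivative_id has_vector_derivative_const] by simp
    from vector_diff_chain_at[OF this Cinf_has_deriv[OF f]]
    have "((\<lambda>t. f (t + 2 * pi)) has_vector_derivative circle_deriv f (\<theta> + 2 * pi)) (at \<theta>)"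
      by (simp add: o_def)
    moreover have "(\<lambda>t. f (t + 2 * pi)) = f" using per by (simp add: periodic_def)
    ultimately show "circle_deriv f (\<theta> + 2 * pi) = circle_deriv f \<theta>"
      by (simp add: vector_derivative_at)
  qed
  moreover have "(circle_deriv ^^ j) (circle_deriv f) differentiable at \<theta>" for j \<theta>
  proof -
    have "(circle_deriv ^^ Suc j) f differentiable at \<theta>" using f unfolding Cinf_circle_def by blast
    then show ?thesis by (simp only: funpow_Suc_right o_apply)
  qed
  ultimately show ?thesis by (simp add: Cinf_circle_def)
qed

lemma Cinf_subset_C: "f \<in> Cinf_circle \<Longrightarrow> f \<in> C_circle"
  using has_vector_derivative_continuous[OF Cinf_has_deriv[of f]]
  by (simp add: C_circle_def continuous_on_eq_continuous_at) (simp add: Cinf_circle_def)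

text \<open>It is easier to exhibit the successive derivatives by a formula \<open>F\<close> than to compute the iterates.\<close>

lemma Cinf_by_derivs:
  assumes per: "periodic f" and 0: "F 0 = f"
    and deriv: "\<And>j \<theta>. (F j has_vector_derivative F (Suc j) \<theta>) (at \<theta>)"
  shows "f \<in> Cinf_circle"
proof -
  have "(circle_deriv ^^ j) f = F j" for j
    by (induction j) (auto simp: 0 vector_derivative_at[OF deriv])
  then show ?thesis
    using per deriv by (auto simp: Cinf_circle_def intro: differentiableI_vector)
qed

lemma Cinf_add:
  assumes f: "f \<in> Cinf_circle" and g: "g \<in> Cinf_circle"
  shows "(\<lambda>\<theta>. f \<theta> + g \<theta>) \<in> Cinf_circle"
proof (rule Cinf_by_derivs[where F = "\<lambda>j \<theta>. (circle_deriv ^^ j) f \<theta> + (circle_deriv ^^ j) g \<theta>"])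
  show "periodic (\<lambda>\<theta>. f \<theta> + g \<theta>)" using f g by (simp add: Cinf_circle_def periodic_def)
qed (simp, intro has_vector_derivative_add Cinf_deriv_iterate f g)

lemma Cinf_scale:
  assumes f: "f \<in> Cinf_circle"
  shows "(\<lambda>\<theta>. c * f \<theta>) \<in> Cinf_circle"
proof (rule Cinf_by_derivs[where F = "\<lambda>j \<theta>. c * (circle_deriv ^^ j) f \<theta>"])
  show "periodic (\<lambda>\<theta>. c * f \<theta>)" using f by (simp add: Cinf_circle_def periodic_def)
qed (simp, intro has_vector_derivative_mult_right Cinf_deriv_iterate f)

definition trig :: "int \<Rightarrow> circle_fun" where
  "trig m \<theta> = cis (of_int m * \<theta>)"

lemma fourier_basis_trig: "fourier_basis k = trig (int k)"
  by (simp add: fourier_basis_def trig_def fun_eq_iff)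

lemma trig_add: "trig (a + b) \<theta> = trig a \<theta> * trig b \<theta>"
  by (simp add: trig_def cis_mult distrib_right)

lemma cnj_trig: "cnj (trig m \<theta>) = trig (- m) \<theta>"
  by (simp add: trig_def cis_cnj)

lemma norm_trig [simp]: "cmod (trig m \<theta>) = 1"
  by (simp add: trig_def)

lemma trig_0: "trig 0 \<theta> = 1"
  by (simp add: trig_def)

lemma trig_has_deriv: "(trig m has_vector_derivative \<i> * of_int m * trig m \<theta>) (at \<theta>)"
proof -
  have "((\<lambda>z. exp (\<i> * of_int m * z)) has_field_derivative \<i> * of_int m * exp (\<i> * of_int m * of_real \<theta>))
      (at (complex_of_real \<theta>))"
    by (auto intro!: derivative_eq_intros)
  from has_vector_derivative_real_field[OF this] show ?thesis by (simp add: trig_def[abs_def] cis_conv_exp mult.assoc)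
qed

lemma Cinf_trig: "trig m \<in> Cinf_circle"
proof (rule Cinf_by_derivs[where F = "\<lambda>j \<theta>. (\<i> * of_int m) ^ j * trig m \<theta>"])
  have "cis (2 * pi * of_int m) = 1" by (intro cis_multiple_2pi) simp
  then have "trig m (\<theta> + 2 * pi) = trig m \<theta>" for \<theta>
    by (simp add: trig_def distrib_left cis_mult[symmetric] mult.commute)
  then show "periodic (trig m)" by (simp add: periodic_def)
  show "((\<lambda>\<theta>. (\<i> * of_int m) ^ j * trig m \<theta>) has_vector_derivative (\<i> * of_int m) ^ Suc j * trig m \<theta>) (at \<theta>)" for j \<theta>
    using has_vector_derivative_mult_right[OF trig_has_deriv, of "(\<i> * of_int m) ^ j" m \<theta>] by (simp add: mult_ac)
qed simp

lemma Cinf_const: "(\<lambda>\<theta>. c) \<in> Cinf_circle"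
  using Cinf_scale[OF Cinf_trig[of 0], of c] by (simp add: trig_0)

lemma Cinf_sum: "(\<And>i. i \<in> I \<Longrightarrow> f i \<in> Cinf_circle) \<Longrightarrow> (\<lambda>\<theta>. \<Sum>i\<in>I. f i \<theta>) \<in> Cinf_circle"
  by (induction I rule: infinite_finite_induct) (auto simp: Cinf_const Cinf_add)

lemma trig_C: "trig m \<in> C_circle" and trig_L2: "trig m \<in> L2_circle"
  using Cinf_trig Cinf_subset_C C_circle_subset_L2 by blast+

lemma Cinf_subset_L2: "f \<in> Cinf_circle \<Longrightarrow> f \<in> L2_circle"
  using Cinf_subset_C C_circle_subset_L2 by blast

lemma integral_periodic_deriv:
  assumes "periodic F" "\<And>\<theta>. (F has_vector_derivative f \<theta>) (at \<theta>)" "f \<in> C_circle"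
  shows "(LINT \<theta>:{0..2*pi}|lborel. f \<theta>) = 0"
proof -
  have "(\<integral>\<theta>. indicator {0..2*pi} \<theta> *\<^sub>R f \<theta> \<partial>lborel) = F (2 * pi) - F 0"
    using assms(2,3) by (intro integral_FTC_Icc)
      (auto intro: has_vector_derivative_at_within continuous_on_subset simp: C_circle_def)
  also have "\<dots> = 0" using assms(1)[unfolded periodic_def, rule_format, of 0] by simp
  finally show ?thesis by (simp add: set_lebesgue_integral_def)
qed

lemma L2_inner_mult_trig: "L2_inner (\<lambda>\<theta>. g \<theta> * trig a \<theta>) (trig b) = L2_inner g (trig (b - a))"
  unfolding L2_inner_def cnj_trig using trig_add[of a "- b"] by (simp add: mult.assoc)

lemma trig_orthonormal: "L2_inner (trig a) (trig b) = (if a = b then 1 else 0)"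
proof -
  have one: "L2_inner (trig 0) (trig 0) = 1"
    by (simp add: L2_inner_def trig_0 set_lebesgue_integral_def scaleR_conv_of_real)
  have "L2_inner (trig m) (trig 0) = 0" if "m \<noteq> 0" for m
  proof -
    have "(LINT \<theta>:{0..2*pi}|lborel. \<i> * of_int m * trig m \<theta>) = 0"
      using Cinf_trig[of m] trig_has_deriv[of m] C_circle_mult[OF C_circle_const[of "\<i> * of_int m"] trig_C[of m]]
      by (intro integral_periodic_deriv[of "trig m"]) (auto simp: Cinf_circle_def)
    then have "L2_inner (\<lambda>\<theta>. \<i> * of_int m * trig m \<theta>) (trig 0) = 0" by (simp add: L2_inner_def trig_0)
    then show ?thesis using that by (simp add: L2_inner_scale_left)
  qed
  moreover have "L2_inner (trig a) (trig b) = L2_inner (trig (a - b)) (trig 0)"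
    using L2_inner_mult_trig[of "trig (a - b)" b b] trig_add[of "a - b" b, symmetric] by simp
  ultimately show ?thesis using one by simp
qed

definition fhat :: "circle_fun \<Rightarrow> int \<Rightarrow> complex" where
  "fhat f m = L2_inner f (trig m)"

lemma
  assumes "f \<in> L2_circle" "g \<in> L2_circle"
  shows fhat_add: "fhat (\<lambda>\<theta>. f \<theta> + g \<theta>) m = fhat f m + fhat g m"
    and fhat_diff: "fhat (\<lambda>\<theta>. f \<theta> - g \<theta>) m = fhat f m - fhat g m"
  using assms by (simp_all add: fhat_def L2_inner_add_left L2_inner_diff_left trig_L2)

lemma fhat_scale: "fhat (\<lambda>\<theta>. c * f \<theta>) m = c * fhat f m"
  by (simp add: fhat_def L2_inner_scale_left)

lemma fhat_sum_trig: "fhat (\<lambda>\<theta>. \<Sum>i\<in>I. c i * trig (l i) \<theta>) m = (\<Sum>i\<in>I. if l i = m then c i else 0)"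
proof -
  have "fhat (\<lambda>\<theta>. \<Sum>i\<in>I. c i * trig (l i) \<theta>) m = (\<Sum>i\<in>I. L2_inner (\<lambda>\<theta>. c i * trig (l i) \<theta>) (trig m))"
    unfolding fhat_def by (intro L2_inner_sum_left L2_scale trig_L2)
  also have "\<dots> = (\<Sum>i\<in>I. if l i = m then c i else 0)"
    unfolding L2_inner_scale_left trig_orthonormal by (intro sum.cong) auto
  finally show ?thesis .
qed

text \<open>The derivative of \<open>f * trig (- m)\<close> has integral \<open>0\<close> over a period.\<close>

lemma fhat_deriv:
  assumes f: "f \<in> Cinf_circle"
  shows "fhat (circle_deriv f) m = \<i> * of_int m * fhat f m"
proof -
  define A B where "A = (\<lambda>\<theta>. circle_deriv f \<theta> * trig (- m) \<theta>)"
    and "B = (\<lambda>\<theta>. f \<theta> * trig (- m) \<theta>)"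
  have C: "f \<in> C_circle" "circle_deriv f \<in> C_circle" using f Cinf_deriv[OF f] Cinf_subset_C by auto
  have AB: "A \<in> C_circle" "B \<in> C_circle" unfolding A_def B_def by (intro C_circle_mult C trig_C)+
  let ?g = "\<lambda>\<theta>. A \<theta> + - \<i> * of_int m * B \<theta>"
  have "(LINT \<theta>:{0..2*pi}|lborel. ?g \<theta>) = 0"
  proof (rule integral_periodic_deriv[of B])
    show "periodic B" using AB by (simp add: C_circle_def)
    show "?g \<in> C_circle" by (intro C_circle_add C_circle_mult[OF C_circle_const] AB)
    show "(B has_vector_derivative ?g \<theta>) (at \<theta>)" for \<theta>
      using has_vector_derivative_mult[OF Cinf_has_deriv[OF f, of \<theta>] trig_has_deriv[of "- m" \<theta>]]
      by (simp add: A_def B_def algebra_simps)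
  qed
  then have "L2_inner ?g (trig 0) = 0" by (simp add: L2_inner_def trig_0)
  moreover have "L2_inner ?g (trig 0) = L2_inner A (trig 0) + - \<i> * of_int m * L2_inner B (trig 0)"
    using AB C_circle_subset_L2 trig_L2
    by (simp only: L2_inner_add_left L2_scale L2_inner_scale_left)
  ultimately show ?thesis
    unfolding A_def B_def L2_inner_mult_trig by (simp add: fhat_def)
qed

section \<open>Truncations\<close>

lemma H_truncI: "(\<lambda>\<theta>. \<Sum>k=1..n. c k * trig (int k) \<theta>) \<in> H_trunc n"
  by (auto simp: H_trunc_def fourier_basis_trig)

lemma H_truncE:
  assumes "h \<in> H_trunc n"
  obtains c where "h = (\<lambda>\<theta>. \<Sum>k=1..n. c k * trig (int k) \<theta>)"
  using assms by (auto simp: H_trunc_def fourier_basis_trig)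

lemma H_trunc_Cinf: "h \<in> H_trunc n \<Longrightarrow> h \<in> Cinf_circle"
  by (elim H_truncE) (auto intro!: Cinf_sum Cinf_scale Cinf_trig)

lemma H_trunc_L2: "h \<in> H_trunc n \<Longrightarrow> h \<in> L2_circle"
  by (rule Cinf_subset_L2[OF H_trunc_Cinf])

lemma H_trunc_scale: "h \<in> H_trunc n \<Longrightarrow> (\<lambda>\<theta>. c * h \<theta>) \<in> H_trunc n"
proof (elim H_truncE)
  fix d assume "h = (\<lambda>\<theta>. \<Sum>k=1..n. d k * trig (int k) \<theta>)"
  then show "(\<lambda>\<theta>. c * h \<theta>) \<in> H_trunc n"
    using H_truncI[of "\<lambda>k. c * d k" n] by (simp add: sum_distrib_left mult.assoc)
qed

lemma trig_H_trunc: "1 \<le> k \<Longrightarrow> k \<le> n \<Longrightarrow> trig (int k) \<in> H_trunc n"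
  using H_truncI[of "\<lambda>j. if j = k then 1 else 0" n] by (simp add: if_distrib[of "\<lambda>x. x * _"] cong: if_cong)

lemma fhat_trunc:
  "1 \<le> j \<Longrightarrow> j \<le> n \<Longrightarrow> fhat (\<lambda>\<theta>. \<Sum>k=1..n. c k * trig (int k) \<theta>) (int j) = c j"
  by (simp add: fhat_sum_trig)

lemma H_trunc_expand: "h \<in> H_trunc n \<Longrightarrow> h = (\<lambda>\<theta>. \<Sum>k=1..n. fhat h (int k) * trig (int k) \<theta>)"
  by (elim H_truncE) (simp add: fhat_trunc del: One_nat_def)

lemma L2_inner_trunc:
  assumes "g \<in> L2_circle"
  shows "L2_inner g (\<lambda>\<theta>. \<Sum>k=1..n. c k * trig (int k) \<theta>) = (\<Sum>k=1..n. fhat g (int k) * cnj (c k))"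
  using assms by (simp add: L2_inner_sum_right L2_scale trig_L2 L2_inner_scale_right fhat_def mult.commute)

lemma L2_norm_trunc: "(L2_norm (\<lambda>\<theta>. \<Sum>k=1..n. c k * trig (int k) \<theta>))\<^sup>2 = (\<Sum>k=1..n. (cmod (c k))\<^sup>2)"
proof -
  let ?h = "\<lambda>\<theta>. \<Sum>k=1..n. c k * trig (int k) \<theta>"
  have "complex_of_real ((L2_norm ?h)\<^sup>2) = (\<Sum>k=1..n. fhat ?h (int k) * cnj (c k))"
    unfolding L2_inner_self[symmetric] by (rule L2_inner_trunc[OF H_trunc_L2[OF H_truncI]])
  also have "\<dots> = (\<Sum>k=1..n. complex_of_real ((cmod (c k))\<^sup>2))"
    by (intro sum.cong) (auto simp: fhat_trunc complex_norm_square simp del: of_real_power One_nat_def)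
  also have "\<dots> = complex_of_real (\<Sum>k=1..n. (cmod (c k))\<^sup>2)" by (rule of_real_sum[symmetric])
  finally show ?thesis by (simp only: of_real_eq_iff)
qed

lemma P_trunc_eq:
  assumes g: "g \<in> L2_circle"
  shows "P_trunc n g = (\<lambda>\<theta>. \<Sum>k=1..n. fhat g (int k) * trig (int k) \<theta>)"
  unfolding P_trunc_def
proof (rule the_equality)
  let ?h = "\<lambda>\<theta>. \<Sum>k=1..n. fhat g (int k) * trig (int k) \<theta>"
  have "L2_inner (\<lambda>\<theta>. g \<theta> - ?h \<theta>) u = 0" if u: "u \<in> H_trunc n" for u
  proof -
    obtain c where c: "u = (\<lambda>\<theta>. \<Sum>k=1..n. c k * trig (int k) \<theta>)" using u by (rule H_truncE)
    have "L2_inner (\<lambda>\<theta>. g \<theta> - ?h \<theta>) u = L2_inner g u - L2_inner ?h u"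
      by (intro L2_inner_diff_left g H_trunc_L2[OF H_truncI] H_trunc_L2[OF u])
    also have "\<dots> = 0"
      unfolding c L2_inner_trunc[OF g] L2_inner_trunc[OF H_trunc_L2[OF H_truncI]] by (simp add: fhat_trunc del: One_nat_def)
    finally show ?thesis .
  qed
  then show "?h \<in> H_trunc n \<and> (\<forall>u\<in>H_trunc n. L2_inner (\<lambda>\<theta>. g \<theta> - ?h \<theta>) u = 0)"
    by (intro conjI ballI H_truncI)
  fix h assume h: "h \<in> H_trunc n \<and> (\<forall>u\<in>H_trunc n. L2_inner (\<lambda>\<theta>. g \<theta> - h \<theta>) u = 0)"
  have "fhat h (int k) = fhat g (int k)" if "k \<in> {1..n}" for k
  proof -
    have "L2_inner (\<lambda>\<theta>. g \<theta> - h \<theta>) (trig (int k)) = 0" using h that trig_H_trunc by simp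
    then show ?thesis
      using L2_inner_diff_left[OF g H_trunc_L2[of h n] trig_L2[of "int k"]] h by (simp add: fhat_def)
  qed
  then show "h = ?h" using H_trunc_expand[of h n] h by simp
qed

lemma P_trunc_mem: "g \<in> L2_circle \<Longrightarrow> P_trunc n g \<in> H_trunc n"
  by (simp add: P_trunc_eq H_truncI del: One_nat_def)

lemma P_trunc_H: "h \<in> H_trunc n \<Longrightarrow> P_trunc n h = h"
  using H_trunc_expand[of h n] P_trunc_eq[OF H_trunc_L2] by metis

lemma L2_inner_P_trunc:
  assumes g: "g \<in> L2_circle" and u: "u \<in> H_trunc n"
  shows "L2_inner (P_trunc n g) u = L2_inner g u"
proof -
  obtain c where c: "u = (\<lambda>\<theta>. \<Sum>k=1..n. c k * trig (int k) \<theta>)" using u by (rule H_truncE)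
  show ?thesis
    unfolding c P_trunc_eq[OF g] L2_inner_trunc[OF g] L2_inner_trunc[OF H_trunc_L2[OF H_truncI]]
    by (simp add: fhat_trunc del: One_nat_def)
qed

lemma L2_norm_P_trunc:
  assumes g: "g \<in> L2_circle" shows "L2_norm (P_trunc n g) \<le> L2_norm g"
proof -
  let ?h = "P_trunc n g"
  have h: "?h \<in> L2_circle" by (rule H_trunc_L2[OF P_trunc_mem[OF g]])
  have "L2_inner ?h ?h = L2_inner g ?h" by (rule L2_inner_P_trunc[OF g P_trunc_mem[OF g]])
  then have "cmod (complex_of_real ((L2_norm ?h)\<^sup>2)) \<le> L2_norm g * L2_norm ?h"
    unfolding L2_inner_self[symmetric] using L2_Cauchy_Schwarz[OF g h] by simp
  then have "L2_norm ?h * L2_norm ?h \<le> L2_norm g * L2_norm ?h"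
    unfolding norm_of_real by (simp add: power2_eq_square)
  then show ?thesis using L2_norm_nonneg[of ?h] L2_norm_nonneg[of g] mult_right_le_imp_le[of "L2_norm ?h" "L2_norm ?h" "L2_norm g"]
    by (cases "L2_norm ?h = 0") auto
qed


section \<open>Toeplitz operators\<close>

definition toep :: "nat \<Rightarrow> circle_fun \<Rightarrow> circle_op" where
  "toep n f = op_on (H_trunc n) (\<lambda>g. P_trunc n (mult_op f g))"

lemma mult_op_apply: "g \<in> L2_circle \<Longrightarrow> mult_op f g = (\<lambda>\<theta>. f \<theta> * g \<theta>)"
  by (simp add: mult_op_def op_on_def)

lemma toep_apply: "g \<in> H_trunc n \<Longrightarrow> toep n f g = P_trunc n (\<lambda>\<theta>. f \<theta> * g \<theta>)"
  by (simp add: toep_def op_on_def mult_op_apply H_trunc_L2)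

lemma toep_off: "g \<notin> H_trunc n \<Longrightarrow> toep n f g = (\<lambda>\<theta>. 0)"
  by (simp add: toep_def op_on_def)

text \<open>The matrix of a Toeplitz operator, on which all further computations rest.\<close>

lemma toep_coords:
  assumes f: "f \<in> C_circle"
  shows "toep n f (\<lambda>\<theta>. \<Sum>b=1..n. c b * trig (int b) \<theta>)
    = (\<lambda>\<theta>. \<Sum>a=1..n. (\<Sum>b=1..n. fhat f (int a - int b) * c b) * trig (int a) \<theta>)"
proof -
  let ?g = "\<lambda>\<theta>. \<Sum>b=1..n. c b * trig (int b) \<theta>"
  have L2: "(\<lambda>\<theta>. f \<theta> * ?g \<theta>) \<in> L2_circle" by (rule L2_mult[OF f H_trunc_L2[OF H_truncI]])
  have "fhat (\<lambda>\<theta>. f \<theta> * ?g \<theta>) m = (\<Sum>b=1..n. fhat f (m - int b) * c b)" for m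
  proof -
    have "(\<lambda>\<theta>. f \<theta> * ?g \<theta>) = (\<lambda>\<theta>. \<Sum>b=1..n. c b * (f \<theta> * trig (int b) \<theta>))"
      by (simp add: sum_distrib_left mult_ac)
    then have "fhat (\<lambda>\<theta>. f \<theta> * ?g \<theta>) m = (\<Sum>b=1..n. L2_inner (\<lambda>\<theta>. c b * (f \<theta> * trig (int b) \<theta>)) (trig m))"
      unfolding fhat_def by (simp only: L2_inner_sum_left L2_scale L2_mult[OF f trig_L2] trig_L2)
    then show ?thesis unfolding L2_inner_scale_left L2_inner_mult_trig by (simp add: fhat_def mult.commute)
  qed
  then show ?thesis unfolding toep_apply[OF H_truncI] P_trunc_eq[OF L2] by simp
qed

lemma toep_eqI:
  assumes "\<And>g. g \<notin> H_trunc n \<Longrightarrow> T g = (\<lambda>\<theta>. 0)"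
    and "\<And>c. toep n f (\<lambda>\<theta>. \<Sum>b=1..n. c b * trig (int b) \<theta>) = T (\<lambda>\<theta>. \<Sum>b=1..n. c b * trig (int b) \<theta>)"
  shows "toep n f = T"
proof
  fix g show "toep n f g = T g"
    using assms toep_off by (cases "g \<in> H_trunc n") (auto elim!: H_truncE)
qed

lemma toep_cong:
  assumes "f \<in> C_circle" "f' \<in> C_circle" "\<And>m. \<bar>m\<bar> < int n \<Longrightarrow> fhat f m = fhat f' m"
  shows "toep n f = toep n f'"
proof (rule toep_eqI[OF toep_off])
  have "(\<Sum>b=1..n. fhat f (int a - int b) * c b) = (\<Sum>b=1..n. fhat f' (int a - int b) * c b)"
    if "a \<in> {1..n}" for a c using that by (intro sum.cong refl) (auto simp: assms(3))
  then show "toep n f (\<lambda>\<theta>. \<Sum>b=1..n. c b * trig (int b) \<theta>) = toep n f' (\<lambda>\<theta>. \<Sum>b=1..n. c b * trig (int b) \<theta>)" for c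
    unfolding toep_coords[OF assms(1)] toep_coords[OF assms(2)] by simp
qed

lemma toep_add:
  assumes f: "f \<in> C_circle" and f': "f' \<in> C_circle"
  shows "toep n (\<lambda>\<theta>. f \<theta> + f' \<theta>) = (\<lambda>g \<theta>. toep n f g \<theta> + toep n f' g \<theta>)"
  by (rule toep_eqI)
    (simp_all add: toep_off toep_coords[OF f] toep_coords[OF f'] toep_coords[OF C_circle_add[OF f f']]
      fhat_add[OF C_circle_subset_L2[OF f] C_circle_subset_L2[OF f']] distrib_right sum.distrib
      del: One_nat_def)

lemma toep_scale:
  assumes f: "f \<in> C_circle"
  shows "toep n (\<lambda>\<theta>. c * f \<theta>) = (\<lambda>g \<theta>. c * toep n f g \<theta>)"
  by (rule toep_eqI)
    (simp_all add: toep_off toep_coords[OF f] toep_coords[OF C_circle_mult[OF C_circle_const f]]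
      fhat_scale sum_distrib_left sum_distrib_right mult.assoc del: One_nat_def)

lemma toep_diff:
  assumes f: "f \<in> C_circle" and f': "f' \<in> C_circle"
  shows "toep n (\<lambda>\<theta>. f \<theta> - f' \<theta>) = (\<lambda>g \<theta>. toep n f g \<theta> - toep n f' g \<theta>)"
  using toep_add[OF f C_circle_mult[OF C_circle_const f'], of n "-1"] toep_scale[OF f', of n "-1"] by simp

lemma toep_one: "toep n (\<lambda>\<theta>. 1) = op_on (H_trunc n) id"
proof
  fix g show "toep n (\<lambda>\<theta>. 1) g = op_on (H_trunc n) id g"
    by (cases "g \<in> H_trunc n") (simp_all add: toep_apply toep_off P_trunc_H op_on_def)
qed

lemma toep_sum_trig:
  "toep n (\<lambda>\<theta>. \<Sum>i\<in>I. c i * trig (l i) \<theta>) = (\<lambda>g \<theta>. \<Sum>i\<in>I. c i * toep n (trig (l i)) g \<theta>)"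
proof (induction I rule: infinite_finite_induct)
  case (insert i I)
  have C: "(\<lambda>\<theta>. c i * trig (l i) \<theta>) \<in> C_circle" "(\<lambda>\<theta>. \<Sum>i\<in>I. c i * trig (l i) \<theta>) \<in> C_circle"
    by (intro Cinf_subset_C Cinf_sum Cinf_scale Cinf_trig)+
  show ?case using insert toep_add[OF C, of n] toep_scale[OF trig_C, of n "c i" "l i"] by simp
qed (use toep_scale[OF C_circle_const, of n 0 0] in simp_all)

text \<open>Only the Fourier coefficients of index less than \<open>n\<close> in modulus enter, so that every symbol can
  be replaced by a trigonometric polynomial.\<close>

lemma toep_trig_poly:
  assumes f: "f \<in> C_circle"
  shows "toep n f = toep n (\<lambda>\<theta>. \<Sum>m\<in>{- int n<..<int n}. fhat f m * trig m \<theta>)"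
proof (rule toep_cong[OF f])
  show "(\<lambda>\<theta>. \<Sum>m\<in>{- int n<..<int n}. fhat f m * trig m \<theta>) \<in> C_circle"
    by (intro Cinf_subset_C Cinf_sum Cinf_scale Cinf_trig)
qed (simp add: fhat_sum_trig abs_less_iff)

text \<open>Smooth symbols give all Toeplitz operators. Continuous ones are more convenient because they are
  closed under everything that is done with them below.\<close>

lemma Toeplitz_sys_eq: "Toeplitz_sys n = toep n ` C_circle"
proof -
  have "Toeplitz_sys n = toep n ` Cinf_circle" by (auto simp: Toeplitz_sys_def toep_def)
  moreover have "toep n f \<in> toep n ` Cinf_circle" if "f \<in> C_circle" for f
    unfolding toep_trig_poly[OF that] by (intro imageI Cinf_sum Cinf_scale Cinf_trig)
  ultimately show ?thesis using Cinf_subset_C by auto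
qed

lemma Toeplitz_sysE_smooth:
  assumes "T \<in> Toeplitz_sys n" obtains f where "f \<in> Cinf_circle" "T = toep n f"
  using assms by (auto simp: Toeplitz_sys_def toep_def)

lemma toep_mem_H: "f \<in> C_circle \<Longrightarrow> g \<in> H_trunc n \<Longrightarrow> toep n f g \<in> H_trunc n"
  by (simp add: toep_apply P_trunc_mem L2_mult H_trunc_L2)

lemma L2_inner_toep:
  assumes "f \<in> C_circle" "g \<in> H_trunc n" "h \<in> H_trunc n"
  shows "L2_inner (toep n f g) h = L2_inner (\<lambda>\<theta>. f \<theta> * g \<theta>) h"
  using assms by (simp add: toep_apply L2_inner_P_trunc L2_mult H_trunc_L2)

lemma toep_entry:
  assumes f: "f \<in> C_circle" and ab: "1 \<le> a" "a \<le> n" "1 \<le> b" "b \<le> n"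
  shows "L2_inner (toep n f (trig (int b))) (trig (int a)) = fhat f (int a - int b)"
  using ab by (simp add: L2_inner_toep[OF f] trig_H_trunc L2_inner_mult_trig fhat_def)

section \<open>Operator norms and Lipschitz seminorms\<close>

lemma op_norm_cong: "(\<And>g. g \<in> H \<Longrightarrow> T g = T' g) \<Longrightarrow> op_norm H T = op_norm H T'"
  unfolding op_norm_def by (intro arg_cong[where f = Sup] Collect_cong) metis

lemma L2_norm_mult_le:
  assumes f: "f \<in> C_circle" and g: "g \<in> L2_circle" and M: "\<And>\<theta>. cmod (f \<theta>) \<le> M"
  shows "L2_norm (\<lambda>\<theta>. f \<theta> * g \<theta>) \<le> M * L2_norm g"
proof -
  have M0: "0 \<le> M" using M[of 0] norm_ge_zero order_trans by blast
  have "L2_norm (\<lambda>\<theta>. f \<theta> * g \<theta>) \<le> L2_norm (\<lambda>\<theta>. complex_of_real M * g \<theta>)"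
    by (rule L2_norm_mono[OF L2_mult[OF f g] L2_scale[OF g]])
       (use M M0 in \<open>simp add: norm_mult mult_right_mono\<close>)
  then show ?thesis unfolding L2_norm_scale using M0 by simp
qed

lemma bounded_op_mult:
  assumes f: "f \<in> C_circle" and H: "H \<subseteq> L2_circle" "\<And>g c. g \<in> H \<Longrightarrow> (\<lambda>\<theta>. c * g \<theta>) \<in> H"
  shows "bounded_op H (mult_op f)"
proof -
  obtain M where M: "0 \<le> M" "\<And>\<theta>. cmod (f \<theta>) \<le> M" using C_circle_bounded[OF f] by blast
  have L2: "g \<in> L2_circle" if "g \<in> H" for g using that H(1) by blast
  show ?thesis unfolding bounded_op_def
  proof (intro conjI ballI allI exI[of _ M])
    fix g c assume g: "g \<in> H"
    show "(\<lambda>\<theta>. c * g \<theta>) \<in> H" using g by (rule H(2))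
    show "mult_op f (\<lambda>\<theta>. c * g \<theta>) = (\<lambda>\<theta>. c * mult_op f g \<theta>)"
      using g by (simp add: mult_op_apply L2 L2_scale mult.left_commute)
    show "L2_norm (mult_op f g) \<le> M * L2_norm g"
      using L2_norm_mult_le[OF f L2[OF g] M(2)] by (simp add: mult_op_apply L2[OF g])
  qed
qed

lemma op_norm_mult_le:
  assumes f: "f \<in> C_circle" and H: "H \<subseteq> L2_circle" "\<And>g c. g \<in> H \<Longrightarrow> (\<lambda>\<theta>. c * g \<theta>) \<in> H" "H \<noteq> {}"
    and M: "\<And>\<theta>. cmod (f \<theta>) \<le> M"
  shows "op_norm H (mult_op f) \<le> M"
proof (rule op_norm_le[OF H(3) bounded_op_mult[OF f H(1,2)]])
  show "0 \<le> M" using M[of 0] norm_ge_zero order_trans by blast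
  show "L2_norm (mult_op f g) \<le> M * L2_norm g" if "g \<in> H" for g
    using L2_norm_mult_le[OF f _ M] that H(1) by (auto simp: mult_op_apply)
qed

lemma bounded_op_toep:
  assumes f: "f \<in> C_circle"
  shows "bounded_op (H_trunc n) (toep n f)"
proof -
  obtain M where M: "0 \<le> M" "\<And>\<theta>. cmod (f \<theta>) \<le> M" using C_circle_bounded[OF f] by blast
  show ?thesis unfolding bounded_op_def
  proof (intro conjI ballI allI exI[of _ M])
    fix g c assume g: "g \<in> H_trunc n"
    show s: "(\<lambda>\<theta>. c * g \<theta>) \<in> H_trunc n" using g by (rule H_trunc_scale)
    have "(\<lambda>\<theta>. f \<theta> * g \<theta>) \<in> L2_circle" by (rule L2_mult[OF f H_trunc_L2[OF g]])
    then show "toep n f (\<lambda>\<theta>. c * g \<theta>) = (\<lambda>\<theta>. c * toep n f g \<theta>)"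
      unfolding toep_apply[OF g] toep_apply[OF s]
      using L2_scale by (simp add: P_trunc_eq mult.left_commute[of _ c] fhat_scale sum_distrib_left mult.assoc)
    have "L2_norm (toep n f g) \<le> L2_norm (\<lambda>\<theta>. f \<theta> * g \<theta>)"
      unfolding toep_apply[OF g] by (rule L2_norm_P_trunc[OF L2_mult[OF f H_trunc_L2[OF g]]])
    also have "\<dots> \<le> M * L2_norm g" by (rule L2_norm_mult_le[OF f H_trunc_L2[OF g] M(2)])
    finally show "L2_norm (toep n f g) \<le> M * L2_norm g" .
  qed
qed

lemma H_trunc_nonempty: "H_trunc n \<noteq> {}"
  using H_truncI by blast

lemma L2_norm_one: "L2_norm (\<lambda>\<theta>. 1) = 1"
  using trig_orthonormal[of 0 0] by (simp add: L2_norm_def trig_0[abs_def] flip: trig_0)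

text \<open>Orthogonal projections are contractive. The space \<open>H\<close> is all of \<open>L2_circle\<close> when norms are compared,
  and the core \<open>Cinf_circle\<close> when Lipschitz seminorms are.\<close>

lemma op_norm_toep_le_mult:
  assumes f: "f \<in> C_circle" and H: "H \<subseteq> L2_circle" "\<And>g c. g \<in> H \<Longrightarrow> (\<lambda>\<theta>. c * g \<theta>) \<in> H"
    and sub: "H_trunc n \<subseteq> H" and one: "(\<lambda>\<theta>. 1) \<in> H"
  shows "op_norm (H_trunc n) (toep n f) \<le> op_norm H (mult_op f)"
proof (rule op_norm_le[OF H_trunc_nonempty bounded_op_toep[OF f]])
  show "0 \<le> op_norm H (mult_op f)"
    by (rule op_norm_nonneg[OF one _ bounded_op_mult[OF f H]]) (simp_all add: L2_norm_one)
  fix g assume g: "g \<in> H_trunc n"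
  have "L2_norm (toep n f g) \<le> L2_norm (\<lambda>\<theta>. f \<theta> * g \<theta>)"
    unfolding toep_apply[OF g] by (rule L2_norm_P_trunc[OF L2_mult[OF f H_trunc_L2[OF g]]])
  also have "\<dots> = L2_norm (mult_op f g)" by (simp add: mult_op_apply H_trunc_L2[OF g])
  also have "\<dots> \<le> op_norm H (mult_op f) * L2_norm g"
    using g sub by (intro op_norm_bound bounded_op_mult f H) auto
  finally show "L2_norm (toep n f g) \<le> op_norm H (mult_op f) * L2_norm g" .
qed

lemma D_trunc_coords:
  "D_trunc n (\<lambda>\<theta>. \<Sum>k=1..n. c k * trig (int k) \<theta>) = (\<lambda>\<theta>. \<Sum>k=1..n. (of_nat k * c k) * trig (int k) \<theta>)"
proof -
  let ?g = "\<lambda>\<theta>. \<Sum>k=1..n. c k * trig (int k) \<theta>"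
  have "(?g has_vector_derivative (\<Sum>k=1..n. c k * (\<i> * of_int (int k) * trig (int k) \<theta>))) (at \<theta>)" for \<theta>
    by (intro has_vector_derivative_sum has_vector_derivative_mult_right trig_has_deriv)
  note deriv = vector_derivative_at[OF this]
  have "D_circle ?g = (\<lambda>\<theta>. \<Sum>k=1..n. (of_nat k * c k) * trig (int k) \<theta>)"
    unfolding D_circle_def deriv sum_distrib_left by (intro ext sum.cong) (auto simp: complex_eq_iff algebra_simps)
  then show ?thesis using P_trunc_H[OF H_truncI] H_truncI
    by (simp add: D_trunc_def op_on_def del: One_nat_def)
qed

text \<open>On both systems the commutator with the Dirac operator turns the symbol \<open>f\<close> into
  \<open>- \<i> f'\<close>, so that the Lipschitz seminorms are operator norms of operators of the same kind.\<close>

definition dsymbol :: "circle_fun \<Rightarrow> circle_fun" where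
  "dsymbol f = (\<lambda>\<theta>. - \<i> * circle_deriv f \<theta>)"

lemma dsymbol_Cinf: "f \<in> Cinf_circle \<Longrightarrow> dsymbol f \<in> Cinf_circle"
  unfolding dsymbol_def by (intro Cinf_scale Cinf_deriv)

lemma dsymbol_C: "f \<in> Cinf_circle \<Longrightarrow> dsymbol f \<in> C_circle"
  by (intro Cinf_subset_C dsymbol_Cinf)

lemma fhat_dsymbol: "f \<in> Cinf_circle \<Longrightarrow> fhat (dsymbol f) m = of_int m * fhat f m"
  unfolding dsymbol_def fhat_scale by (simp add: fhat_deriv flip: mult.assoc)

lemma lip_Toeplitz_toep:
  assumes f: "f \<in> Cinf_circle"
  shows "lip_Toeplitz n (toep n f) = op_norm (H_trunc n) (toep n (dsymbol f))"
  unfolding lip_Toeplitz_def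
proof (rule op_norm_cong, elim H_truncE)
  fix g c assume g: "g = (\<lambda>\<theta>. \<Sum>k=1..n. c k * trig (int k) \<theta>)"
  note fC = Cinf_subset_C[OF f]
  have "of_nat a * (\<Sum>b=1..n. fhat f (int a - int b) * c b) - (\<Sum>b=1..n. fhat f (int a - int b) * (of_nat b * c b))
    = (\<Sum>b=1..n. fhat (dsymbol f) (int a - int b) * c b)" for a :: nat
    by (simp add: fhat_dsymbol[OF f] sum_distrib_left sum_subtractf[symmetric] algebra_simps)
  then show "commutator (D_trunc n) (toep n f) g = toep n (dsymbol f) g"
    unfolding commutator_def g toep_coords[OF fC] toep_coords[OF dsymbol_C[OF f]] D_trunc_coords
    by (simp add: sum_subtractf[symmetric] left_diff_distrib[symmetric])
qed

lemma lip_C_mult: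
  assumes f: "f \<in> Cinf_circle"
  shows "lip_C (mult_op f) = op_norm Cinf_circle (mult_op (dsymbol f))"
  unfolding lip_C_def
proof (rule op_norm_cong)
  fix g assume g: "g \<in> Cinf_circle"
  have "((\<lambda>\<theta>. f \<theta> * g \<theta>) has_vector_derivative f \<theta> * circle_deriv g \<theta> + circle_deriv f \<theta> * g \<theta>) (at \<theta>)" for \<theta>
    by (intro has_vector_derivative_mult Cinf_has_deriv f g)
  note deriv = vector_derivative_at[OF this]
  have "D_circle (\<lambda>\<theta>. f \<theta> * g \<theta>) = (\<lambda>\<theta>. - \<i> * (f \<theta> * circle_deriv g \<theta> + circle_deriv f \<theta> * g \<theta>))"
    unfolding D_circle_def deriv ..
  moreover have "D_circle g \<in> L2_circle"
    unfolding D_circle_def by (intro Cinf_subset_L2 Cinf_scale Cinf_deriv g)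
  ultimately show "commutator D_circle (mult_op f) g = mult_op (dsymbol f) g"
    by (simp add: commutator_def mult_op_apply Cinf_subset_L2[OF g])
       (simp add: D_circle_def dsymbol_def algebra_simps)
qed


section \<open>Fejer means as lower symbols\<close>

text \<open>The vector \<open>coherent n \<theta>\<close> has squared norm \<open>n\<close>, and its modulus squared divided by \<open>n\<close> is the
  Fejer kernel centred at \<open>\<theta>\<close>.\<close>

definition coherent :: "nat \<Rightarrow> real \<Rightarrow> circle_fun" where
  "coherent n \<theta> = (\<lambda>s. \<Sum>j=1..n. trig (- int j) \<theta> * trig (int j) s)"

definition lower_symbol :: "nat \<Rightarrow> circle_op \<Rightarrow> circle_fun" where
  "lower_symbol n T \<theta> = L2_inner (T (coherent n \<theta>)) (coherent n \<theta>) / of_nat n"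

abbreviation fejer :: "nat \<Rightarrow> circle_fun \<Rightarrow> circle_fun" where
  "fejer n f \<equiv> lower_symbol n (toep n f)"

abbreviation index_square :: "nat \<Rightarrow> (int \<times> int) set" where
  "index_square n \<equiv> {1..int n} \<times> {1..int n}"

lemma coherent_H: "coherent n \<theta> \<in> H_trunc n"
  unfolding coherent_def by (rule H_truncI)

lemma coherent_L2: "coherent n \<theta> \<in> L2_circle"
  by (rule H_trunc_L2[OF coherent_H])

lemma L2_norm_coherent: "(L2_norm (coherent n \<theta>))\<^sup>2 = n"
  unfolding coherent_def L2_norm_trunc by simp

lemma lower_symbol_le:
  assumes n: "n \<ge> 1" and T: "bounded_op (H_trunc n) T" "T (coherent n \<theta>) \<in> L2_circle"
  shows "cmod (lower_symbol n T \<theta>) \<le> op_norm (H_trunc n) T"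
proof -
  let ?v = "coherent n \<theta>"
  have "cmod (L2_inner (T ?v) ?v) \<le> L2_norm (T ?v) * L2_norm ?v"
    by (rule L2_Cauchy_Schwarz[OF T(2) coherent_L2])
  also have "\<dots> \<le> (op_norm (H_trunc n) T * L2_norm ?v) * L2_norm ?v"
    by (intro mult_right_mono op_norm_bound T coherent_H) simp
  also have "\<dots> = op_norm (H_trunc n) T * n"
    using L2_norm_coherent[of n \<theta>] by (simp add: power2_eq_square mult.assoc)
  finally show ?thesis using n by (simp add: lower_symbol_def norm_divide divide_le_eq)
qed

lemma sum_int_nat: "(\<Sum>j=1..n. F (int j)) = (\<Sum>j\<in>{1..int n}. F j)"
proof -
  have "(\<Sum>j\<in>{1..int n}. F j) = sum F (int ` {1..n})" by (simp add: image_int_atLeastAtMost)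
  then show ?thesis by (simp add: sum.reindex)
qed

lemma sum_index_square: "(\<Sum>a=1..n. \<Sum>b=1..n. F (int a) (int b)) = (\<Sum>p\<in>index_square n. F (fst p) (snd p))"
proof -
  have "(\<Sum>b=1..n. F a (int b)) = (\<Sum>b\<in>{1..int n}. F a b)" for a by (rule sum_int_nat)
  then have "(\<Sum>a=1..n. \<Sum>b=1..n. F (int a) (int b)) = (\<Sum>a=1..n. \<Sum>b\<in>{1..int n}. F (int a) b)" by simp
  also have "\<dots> = (\<Sum>a\<in>{1..int n}. \<Sum>b\<in>{1..int n}. F a b)" by (rule sum_int_nat)
  finally show ?thesis by (simp add: sum.cartesian_product case_prod_unfold)
qed

text \<open>Here \<open>fejer n f\<close> is recognized as the mean of the Fourier series of \<open>f\<close> with weights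
  \<open>1 - \<bar>m\<bar> / n\<close>: the index \<open>m\<close> occurs once for each entry on the \<open>m\<close>-th diagonal.\<close>

lemma fejer_eq:
  assumes f: "f \<in> C_circle"
  shows "fejer n f = (\<lambda>\<theta>. \<Sum>p\<in>index_square n. (fhat f (fst p - snd p) / of_nat n) * trig (fst p - snd p) \<theta>)"
proof
  fix \<theta>
  let ?d = "\<lambda>a. \<Sum>b=1..n. fhat f (a - int b) * trig (- int b) \<theta>"
  have "L2_inner (toep n f (coherent n \<theta>)) (coherent n \<theta>) = (\<Sum>a=1..n. ?d (int a) * cnj (trig (- int a) \<theta>))"
    unfolding coherent_def toep_coords[OF f] L2_inner_trunc[OF H_trunc_L2[OF H_truncI]]
    by (intro sum.cong refl arg_cong2[of _ _ _ _ "(*)"] fhat_trunc) auto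
  also have "\<dots> = (\<Sum>a=1..n. \<Sum>b=1..n. fhat f (int a - int b) * trig (int a - int b) \<theta>)"
    unfolding sum_distrib_right
  proof (intro sum.cong refl)
    show "fhat f (int a - int b) * trig (- int b) \<theta> * cnj (trig (- int a) \<theta>)
      = fhat f (int a - int b) * trig (int a - int b) \<theta>" for a b
      using trig_add[of "int a" "- int b" \<theta>] by (simp add: cnj_trig)
  qed
  also have "\<dots> = (\<Sum>p\<in>index_square n. fhat f (fst p - snd p) * trig (fst p - snd p) \<theta>)"
    by (rule sum_index_square)
  finally show "fejer n f \<theta> = (\<Sum>p\<in>index_square n. (fhat f (fst p - snd p) / of_nat n) * trig (fst p - snd p) \<theta>)"
    by (simp add: lower_symbol_def sum_divide_distrib)
qed

lemma fejer_Cinf: "f \<in> C_circle \<Longrightarrow> fejer n f \<in> Cinf_circle"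
  unfolding fejer_eq by (intro Cinf_sum Cinf_scale Cinf_trig)

lemma dsymbol_fejer:
  assumes f: "f \<in> Cinf_circle"
  shows "dsymbol (fejer n f) = fejer n (dsymbol f)"
proof
  fix \<theta>
  let ?c = "\<lambda>p. fhat f (fst p - snd p) / of_nat n"
  have "(fejer n f has_vector_derivative (\<Sum>p\<in>index_square n. ?c p * (\<i> * of_int (fst p - snd p) * trig (fst p - snd p) \<theta>))) (at \<theta>)"
    unfolding fejer_eq[OF Cinf_subset_C[OF f]]
    by (intro has_vector_derivative_sum has_vector_derivative_mult_right trig_has_deriv)
  note deriv = vector_derivative_at[OF this]
  show "dsymbol (fejer n f) \<theta> = fejer n (dsymbol f) \<theta>"
    unfolding dsymbol_def[of "fejer n f"] deriv fejer_eq[OF dsymbol_C[OF f]] sum_distrib_left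
    by (intro sum.cong refl) (simp add: fhat_dsymbol[OF f] divide_inverse mult_ac)
qed

lemma card_diagonal:
  assumes "\<bar>m\<bar> \<le> int n"
  shows "card {p \<in> index_square n. fst p - snd p = m} = nat (int n - \<bar>m\<bar>)"
proof -
  have "{p \<in> index_square n. fst p - snd p = m} = (\<lambda>b. (b + m, b)) ` {max 1 (1 - m)..min (int n) (int n - m)}"
    by (auto simp: image_iff)
  then have "card {p \<in> index_square n. fst p - snd p = m} = card {max 1 (1 - m)..min (int n) (int n - m)}"
    by (simp add: card_image inj_on_def)
  also have "\<dots> = nat (int n - \<bar>m\<bar>)" using assms by simp
  finally show ?thesis .
qed

lemma fhat_fejer:
  assumes f: "f \<in> C_circle" and m: "\<bar>m\<bar> < int n"
  shows "fhat (fejer n f) m = (of_int (int n - \<bar>m\<bar>) / of_nat n) * fhat f m"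
proof -
  have "fhat (fejer n f) m = (\<Sum>p\<in>index_square n. if fst p - snd p = m then fhat f (fst p - snd p) / of_nat n else 0)"
    unfolding fejer_eq[OF f] by (rule fhat_sum_trig)
  also have "\<dots> = (\<Sum>p\<in>{p \<in> index_square n. fst p - snd p = m}. fhat f m / of_nat n)"
    by (simp add: sum.inter_filter[symmetric] cong: if_cong sum.cong)
  also have "\<dots> = of_nat (nat (int n - \<bar>m\<bar>)) * (fhat f m / of_nat n)"
    using m by (simp add: card_diagonal del: of_nat_nat)
  finally show ?thesis using m by simp
qed

text \<open>The difference of a Toeplitz operator and the one with the Fejer mean as symbol has entries
  \<open>\<bar>a - b\<bar> / n\<close> times those of the original, while the commutator with the Dirac operator has
  entries \<open>a - b\<close> times these. The two thus agree in modulus up to the factor \<open>n\<close>,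
  and comparing operator norms with Hilbert-Schmidt norms costs at most \<open>sqrt n\<close>.\<close>

lemma toep_fejer_approx:
  assumes f: "f \<in> Cinf_circle" and n: "n \<ge> 1" and d: "op_norm (H_trunc n) (toep n (dsymbol f)) \<le> 1"
  shows "op_norm (H_trunc n) (\<lambda>g \<theta>. toep n f g \<theta> - toep n (fejer n f) g \<theta>) \<le> 1 / sqrt n"
proof -
  note fC = Cinf_subset_C[OF f]
  note FC = Cinf_subset_C[OF fejer_Cinf[OF fC]]
  define h where "h = (\<lambda>\<theta>. f \<theta> - fejer n f \<theta>)"
  have h: "h \<in> C_circle" unfolding h_def by (rule C_circle_diff[OF fC FC])
  have hm: "cmod (fhat h m) = cmod (fhat (dsymbol f) m) / n" if "\<bar>m\<bar> < int n" for m
  proof -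
    have "fhat h m = fhat f m - (of_int (int n - \<bar>m\<bar>) / of_nat n) * fhat f m"
      unfolding h_def using that
      by (simp add: fhat_diff[OF C_circle_subset_L2[OF fC] C_circle_subset_L2[OF FC]] fhat_fejer[OF fC])
    also have "\<dots> = of_int \<bar>m\<bar> * fhat f m / of_nat n" using n by (simp add: field_simps)
    finally show ?thesis by (simp add: fhat_dsymbol[OF f] norm_mult norm_divide)
  qed
  have col: "(\<Sum>a=1..n. (cmod (fhat (dsymbol f) (int a - int b)))\<^sup>2) \<le> 1" if b: "b \<in> {1..n}" for b
  proof -
    \<comment> \<open>the \<open>b\<close>-th basis vector, whose image is the \<open>b\<close>-th column\<close>
    let ?e = "\<lambda>\<theta>. \<Sum>k=1..n. (if k = b then 1 else 0) * trig (int k) \<theta>"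
    have e: "L2_norm ?e = 1"
    proof -
      have "(L2_norm ?e)\<^sup>2 = (\<Sum>k=1..n. if k = b then 1 else 0)"
        unfolding L2_norm_trunc by (intro sum.cong) auto
      then have "(L2_norm ?e)\<^sup>2 = 1" using b by simp
      then show ?thesis using power2_eq_imp_eq[of "L2_norm ?e" 1] by simp
    qed
    have "L2_norm (toep n (dsymbol f) ?e) \<le> op_norm (H_trunc n) (toep n (dsymbol f)) * L2_norm ?e"
      by (intro op_norm_bound bounded_op_toep dsymbol_C f H_truncI)
    then have "L2_norm (toep n (dsymbol f) ?e) \<le> 1" using d e by simp
    then have "(L2_norm (toep n (dsymbol f) ?e))\<^sup>2 \<le> 1" by (simp add: power_le_one)
    then show ?thesis
      unfolding toep_coords[OF dsymbol_C[OF f]] L2_norm_trunc using b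
      by (simp add: if_distrib[of "\<lambda>x. _ * x"] cong: if_cong)
  qed
  have HS: "(\<Sum>a=1..n. \<Sum>b=1..n. (cmod (fhat h (int a - int b)))\<^sup>2) \<le> 1 / n"
  proof -
    have "(\<Sum>a=1..n. \<Sum>b=1..n. (cmod (fhat h (int a - int b)))\<^sup>2)
      = (\<Sum>a=1..n. \<Sum>b=1..n. (cmod (fhat (dsymbol f) (int a - int b)))\<^sup>2 / (real n)\<^sup>2)"
      by (intro sum.cong refl) (auto simp: hm power_divide)
    also have "\<dots> = (\<Sum>b=1..n. \<Sum>a=1..n. (cmod (fhat (dsymbol f) (int a - int b)))\<^sup>2) / (real n)\<^sup>2"
      by (subst sum.swap) (simp add: sum_divide_distrib)
    also have "\<dots> \<le> (\<Sum>b=1..n. 1) / (real n)\<^sup>2"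
      by (intro divide_right_mono sum_mono col) auto
    also have "\<dots> = 1 / n" using n by (simp add: power2_eq_square)
    finally show ?thesis .
  qed
  have "op_norm (H_trunc n) (toep n h) \<le> 1 / sqrt n"
  proof (rule op_norm_le[OF H_trunc_nonempty bounded_op_toep[OF h]])
    fix g assume "g \<in> H_trunc n"
    then obtain c where g: "g = (\<lambda>\<theta>. \<Sum>b=1..n. c b * trig (int b) \<theta>)" by (rule H_truncE)
    have "(L2_norm (toep n h g))\<^sup>2 = (\<Sum>a=1..n. (cmod (\<Sum>b=1..n. fhat h (int a - int b) * c b))\<^sup>2)"
      unfolding g toep_coords[OF h] L2_norm_trunc ..
    also have "\<dots> \<le> (\<Sum>a=1..n. (\<Sum>b=1..n. (cmod (fhat h (int a - int b)))\<^sup>2) * (\<Sum>b=1..n. (cmod (c b))\<^sup>2))"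
    proof (rule sum_mono)
      fix a
      have "cmod (\<Sum>b=1..n. fhat h (int a - int b) * c b) \<le> (\<Sum>b=1..n. cmod (fhat h (int a - int b)) * cmod (c b))"
        using norm_sum[of "\<lambda>b. fhat h (int a - int b) * c b" "{1..n}"] by (simp add: norm_mult)
      then have "(cmod (\<Sum>b=1..n. fhat h (int a - int b) * c b))\<^sup>2
          \<le> (\<Sum>b=1..n. cmod (fhat h (int a - int b)) * cmod (c b))\<^sup>2" by (intro power_mono) auto
      also have "\<dots> \<le> (\<Sum>b=1..n. (cmod (fhat h (int a - int b)))\<^sup>2) * (\<Sum>b=1..n. (cmod (c b))\<^sup>2)"
        by (rule Cauchy_Schwarz_ineq_sum)
      finally show "(cmod (\<Sum>b=1..n. fhat h (int a - int b) * c b))\<^sup>2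
        \<le> (\<Sum>b=1..n. (cmod (fhat h (int a - int b)))\<^sup>2) * (\<Sum>b=1..n. (cmod (c b))\<^sup>2)" .
    qed
    also have "\<dots> \<le> (1 / n) * (L2_norm g)\<^sup>2"
      unfolding sum_distrib_right[symmetric] g L2_norm_trunc using HS
      by (intro mult_right_mono) (auto intro: sum_nonneg)
    also have "\<dots> = (1 / sqrt n * L2_norm g)\<^sup>2" by (simp add: power_mult_distrib power_divide)
    finally show "L2_norm (toep n h g) \<le> 1 / sqrt n * L2_norm g"
      by (rule power2_le_imp_le) simp
  qed simp
  then show ?thesis unfolding h_def toep_diff[OF fC FC] .
qed

section \<open>Approximation by Fejer means\<close>

text \<open>Multiplying the Fejer kernel by \<open>\<bar>1 - e\<^sup>i\<^sup>t\<bar>\<^sup>2\<close> telescopes the geometric sum that defines it and leaves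
  a function of size \<open>1 / n\<close>. So it suffices to control the oscillation of \<open>f\<close> by this factor.\<close>

lemma coherent_telescope: "cmod ((1 - cis (s - \<theta>)) * coherent n \<theta> s) \<le> 2"
proof (cases "n \<ge> 1")
  case True
  let ?z = "cis (s - \<theta>)"
  have "coherent n \<theta> s = (\<Sum>j=1..n. ?z ^ j)"
    unfolding coherent_def Complex.DeMoivre
    by (intro sum.cong refl) (simp add: trig_def cis_mult right_diff_distrib)
  then have "(1 - ?z) * coherent n \<theta> s = ?z ^ 1 - ?z ^ Suc n"
    using sum_gp_multiplied[OF True, of ?z] by simp
  also have "cmod \<dots> \<le> 1 + 1"
    using norm_triangle_ineq4[of "?z ^ 1" "?z ^ Suc n"] by (simp only: norm_power norm_cis power_one)
  finally show ?thesis by simp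
qed (simp add: coherent_def)

lemma fejer_approx:
  assumes f: "f \<in> C_circle" and n: "n \<ge> 1" and b: "0 \<le> \<beta>"
    and osc: "\<And>s. cmod (f s - f \<theta>) \<le> \<alpha> + \<beta> * (cmod (1 - cis (s - \<theta>)))\<^sup>2"
  shows "cmod (fejer n f \<theta> - f \<theta>) \<le> \<alpha> + 4 * \<beta> / n"
proof -
  define v where "v = coherent n \<theta>"
  define w where "w = (\<lambda>s. (1 - cis (s - \<theta>)) * v s)"
  have v: "v \<in> L2_circle" "v \<in> C_circle"
    unfolding v_def by (rule coherent_L2, rule Cinf_subset_C[OF H_trunc_Cinf[OF coherent_H]])
  have "(\<lambda>s. 1 - trig (-1) \<theta> * trig 1 s) \<in> C_circle"
    by (intro C_circle_diff C_circle_mult C_circle_const trig_C)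
  then have "(\<lambda>s. 1 - cis (s - \<theta>)) \<in> C_circle" by (simp add: trig_def cis_mult)
  then have wC: "w \<in> C_circle" unfolding w_def by (rule C_circle_mult[OF _ v(2)])
  then have w: "w \<in> L2_circle" by (rule C_circle_subset_L2)
  have "L2_norm w \<le> 2"
    using L2_norm_mult_le[OF wC C_circle_subset_L2[OF C_circle_const[of 1]], of 2] coherent_telescope
    by (simp add: w_def v_def L2_norm_one)
  then have w4: "(L2_norm w)\<^sup>2 \<le> 4" using power_mono[of "L2_norm w" 2 2] by simp
  let ?G = "\<lambda>s. f s - f \<theta>"
  have G: "?G \<in> C_circle" by (intro C_circle_diff f C_circle_const)
  have Gv: "(\<lambda>s. ?G s * v s) \<in> L2_circle" by (rule L2_mult[OF G v(1)])
  have "L2_inner (\<lambda>s. f s * v s - f \<theta> * v s) v = L2_inner (\<lambda>s. f s * v s) v - f \<theta> * L2_inner v v"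
    by (simp add: L2_inner_diff_left[OF L2_mult[OF f v(1)] L2_scale[OF v(1)] v(1)] L2_inner_scale_left)
  then have eq: "fejer n f \<theta> - f \<theta> = L2_inner (\<lambda>s. ?G s * v s) v / of_nat n"
    using n L2_norm_coherent[of n \<theta>] unfolding lower_symbol_def L2_inner_toep[OF f coherent_H coherent_H]
    by (simp add: left_diff_distrib v_def L2_inner_self field_simps flip: of_real_power)
  have "cmod (LINT s:{0..2*pi}|lborel. ?G s * v s * cnj (v s))
    \<le> (LINT s:{0..2*pi}|lborel. cmod (?G s * v s * cnj (v s)))"
    by (rule set_integral_norm_bound[OF L2_prod_integrable[OF Gv v(1)]])
  also have "\<dots> \<le> (LINT s:{0..2*pi}|lborel. \<alpha> * (cmod (v s))\<^sup>2 + \<beta> * (cmod (w s))\<^sup>2)"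
  proof (rule set_integral_mono)
    show "set_integrable lborel {0..2*pi} (\<lambda>s. cmod (?G s * v s * cnj (v s)))"
      by (intro set_integrable_norm L2_prod_integrable[OF Gv v(1)])
    show "set_integrable lborel {0..2*pi} (\<lambda>s. \<alpha> * (cmod (v s))\<^sup>2 + \<beta> * (cmod (w s))\<^sup>2)"
      by (intro set_integral_add set_integrable_mult_right impI L2_sq_integrable v w)
    show "cmod (?G s * v s * cnj (v s)) \<le> \<alpha> * (cmod (v s))\<^sup>2 + \<beta> * (cmod (w s))\<^sup>2" for s
    proof -
      have "cmod (?G s * v s * cnj (v s)) = cmod (?G s) * (cmod (v s))\<^sup>2"
        by (simp add: norm_mult power2_eq_square)
      also have "\<dots> \<le> (\<alpha> + \<beta> * (cmod (1 - cis (s - \<theta>)))\<^sup>2) * (cmod (v s))\<^sup>2"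
        by (intro mult_right_mono osc) simp
      also have "\<dots> = \<alpha> * (cmod (v s))\<^sup>2 + \<beta> * (cmod (w s))\<^sup>2"
        by (simp add: w_def norm_mult power_mult_distrib distrib_right mult.assoc)
      finally show ?thesis .
    qed
  qed
  also have "\<dots> = 2 * pi * (\<alpha> * (L2_norm v)\<^sup>2 + \<beta> * (L2_norm w)\<^sup>2)"
  proof -
    have "set_integrable lborel {0..2*pi} (\<lambda>s. \<alpha> * (cmod (v s))\<^sup>2)"
      "set_integrable lborel {0..2*pi} (\<lambda>s. \<beta> * (cmod (w s))\<^sup>2)"
      by (intro set_integrable_mult_right impI L2_sq_integrable v w)+
    then show ?thesis unfolding L2_norm_square by (simp add: set_integral_add distrib_left)
  qed
  also have "\<dots> \<le> 2 * pi * (\<alpha> * n + \<beta> * 4)"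
    unfolding v_def L2_norm_coherent using w4 b by (intro mult_left_mono add_left_mono) auto
  finally have "cmod (L2_inner (\<lambda>s. ?G s * v s) v) \<le> \<alpha> * n + \<beta> * 4"
    by (simp add: L2_inner_def norm_divide norm_mult divide_le_eq mult.commute)
  then show ?thesis unfolding eq using n by (simp add: norm_divide field_simps)
qed

text \<open>A modulus of continuity at scale \<open>\<delta>\<close> and a bound on the total oscillation give the hypothesis of
  the previous lemma.\<close>

lemma oscillation_bound:
  assumes per: "periodic f" and \<delta>: "0 < \<delta>" "\<delta> \<le> pi"
    and small: "\<And>s t. \<bar>s - t\<bar> < \<delta> \<Longrightarrow> cmod (f s - f t) \<le> \<alpha>"
    and total: "\<And>s t. \<bar>s - t\<bar> \<le> pi \<Longrightarrow> cmod (f s - f t) \<le> M"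
  shows "cmod (f s - f \<theta>) \<le> \<alpha> + M / (2 - 2 * cos \<delta>) * (cmod (1 - cis (s - \<theta>)))\<^sup>2"
proof -
  obtain m where m: "s + 2 * pi * of_int m \<in> {\<theta> - pi..<\<theta> - pi + 2 * pi}"
    using angle_in_period[of s "\<theta> - pi"] by blast
  define t where "t = s + 2 * pi * of_int m - \<theta>"
  have t: "\<bar>t\<bar> \<le> pi" using m by (auto simp: t_def)
  have fs: "f s = f (\<theta> + t)" using periodic_int[OF per, of s m] by (simp add: t_def)
  have "cis (s - \<theta>) = cis t"
  proof -
    have "cis t = cis (s - \<theta>) * cis (2 * pi * of_int m)" by (simp add: t_def cis_mult algebra_simps)
    then show ?thesis using cis_multiple_2pi[of "of_int m"] by simp
  qed
  moreover have "(1 - cos t)\<^sup>2 + (sin t)\<^sup>2 = 2 - 2 * cos t"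
    using sin_cos_squared_add[of t] by (simp add: power2_diff)
  ultimately have z: "(cmod (1 - cis (s - \<theta>)))\<^sup>2 = 2 - 2 * cos t" by (simp add: cmod_power2)
  have M: "0 \<le> M" using total[of 0 0] by simp
  have \<alpha>: "0 \<le> \<alpha>" using small[of 0 0] \<delta> by simp
  have c: "cos \<delta> < 1" using cos_monotone_0_pi[of 0 \<delta>] \<delta> by simp
  show ?thesis
  proof (cases "\<bar>t\<bar> < \<delta>")
    case True
    then have "cmod (f s - f \<theta>) \<le> \<alpha>" unfolding fs by (intro small) simp
    moreover have "0 \<le> M / (2 - 2 * cos \<delta>) * (cmod (1 - cis (s - \<theta>)))\<^sup>2" using M c by simp
    ultimately show ?thesis by simp
  next
    case False
    then have "cos \<bar>t\<bar> \<le> cos \<delta>" using t \<delta> by (intro cos_monotone_0_pi_le) auto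
    then have le: "1 \<le> (2 - 2 * cos t) / (2 - 2 * cos \<delta>)" using c by simp
    have "cmod (f s - f \<theta>) \<le> M" unfolding fs using t by (intro total) simp
    also have "\<dots> \<le> M * ((2 - 2 * cos t) / (2 - 2 * cos \<delta>))" using mult_left_mono[OF le M] by simp
    finally show ?thesis unfolding z using \<alpha> by simp
  qed
qed

lemma fejer_uniform:
  assumes e: "0 < \<epsilon>" and \<delta>: "0 < \<delta>" "\<delta> \<le> pi"
  obtains N where "N \<ge> 1" "\<And>n f \<theta>. \<lbrakk>n \<ge> N; f \<in> C_circle; \<And>s t. \<bar>s - t\<bar> < \<delta> \<Longrightarrow> cmod (f s - f t) \<le> \<epsilon> / 2;
     \<And>s t. \<bar>s - t\<bar> \<le> pi \<Longrightarrow> cmod (f s - f t) \<le> M\<rbrakk> \<Longrightarrow> cmod (fejer n f \<theta> - f \<theta>) \<le> \<epsilon>"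
proof -
  define \<beta> where "\<beta> = M / (2 - 2 * cos \<delta>)"
  obtain N0 :: nat where N0: "8 * \<beta> / \<epsilon> < real N0" using reals_Archimedean2 by blast
  have c: "cos \<delta> < 1" using cos_monotone_0_pi[of 0 \<delta>] \<delta> by simp
  have "cmod (fejer n f \<theta> - f \<theta>) \<le> \<epsilon>"
    if n: "n \<ge> max N0 1" and f: "f \<in> C_circle" and small: "\<And>s t. \<bar>s - t\<bar> < \<delta> \<Longrightarrow> cmod (f s - f t) \<le> \<epsilon> / 2"
    and total: "\<And>s t. \<bar>s - t\<bar> \<le> pi \<Longrightarrow> cmod (f s - f t) \<le> M" for n f \<theta>
  proof -
    have "0 \<le> M" using total[of 0 0] by simp
    then have "0 \<le> \<beta>" using c by (simp add: \<beta>_def)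
    have "cmod (fejer n f \<theta> - f \<theta>) \<le> \<epsilon> / 2 + 4 * \<beta> / n"
    proof (rule fejer_approx[OF f _ \<open>0 \<le> \<beta>\<close>])
      show "cmod (f s - f \<theta>) \<le> \<epsilon> / 2 + \<beta> * (cmod (1 - cis (s - \<theta>)))\<^sup>2" for s
        unfolding \<beta>_def using f by (intro oscillation_bound[OF _ \<delta> small total]) (auto simp: C_circle_def)
    qed (use n in simp)
    moreover have "4 * \<beta> / n \<le> \<epsilon> / 2"
    proof -
      have "8 * \<beta> / \<epsilon> \<le> real n" using N0 n by simp
      then show ?thesis using e n by (simp add: field_simps)
    qed
    ultimately show ?thesis by simp
  qed
  then show ?thesis using that[of "max N0 1"] by simp
qed

lemma fejer_converges:
  assumes f: "f \<in> C_circle" and e: "0 < \<epsilon>"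
  obtains N where "N \<ge> 1" "\<And>n \<theta>. n \<ge> N \<Longrightarrow> cmod (fejer n f \<theta> - f \<theta>) \<le> \<epsilon>"
proof -
  have per: "periodic f" and "continuous_on {-pi..3*pi} f"
    using f by (auto simp: C_circle_def intro: continuous_on_subset)
  then have "uniformly_continuous_on {-pi..3*pi} f" by (intro compact_uniformly_continuous) auto
  then obtain \<delta>0 where \<delta>0: "\<delta>0 > 0" "\<And>s t. s \<in> {-pi..3*pi} \<Longrightarrow> t \<in> {-pi..3*pi} \<Longrightarrow> \<bar>s - t\<bar> < \<delta>0 \<Longrightarrow> cmod (f s - f t) < \<epsilon> / 2"
    unfolding uniformly_continuous_on_def dist_norm real_norm_def using e by (metis half_gt_zero)
  define \<delta> where "\<delta> = min \<delta>0 pi"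
  have \<delta>: "0 < \<delta>" "\<delta> \<le> pi" using \<delta>0 by (auto simp: \<delta>_def)
  have small: "cmod (f s - f t) \<le> \<epsilon> / 2" if st: "\<bar>s - t\<bar> < \<delta>" for s t
  proof -
    obtain m where m: "t + 2 * pi * of_int m \<in> {0..<0 + 2 * pi}" using angle_in_period[of t 0] by blast
    have "cmod (f (s + 2 * pi * of_int m) - f (t + 2 * pi * of_int m)) < \<epsilon> / 2"
      using m st by (intro \<delta>0) (auto simp: \<delta>_def)
    then show ?thesis by (simp add: periodic_int[OF per])
  qed
  obtain M where M: "\<And>\<theta>. cmod (f \<theta>) \<le> M" using C_circle_bounded[OF f] by blast
  have total: "cmod (f s - f t) \<le> 2 * M" for s t
    using norm_triangle_ineq4[of "f s" "f t"] M[of s] M[of t] by simp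
  show ?thesis using fejer_uniform[OF e \<delta>, of "2 * M"] that small total f by metis
qed

text \<open>By the mean value theorem all functions of the Lipschitz ball have the same modulus of continuity,
  and the same bound \<open>pi\<close> for their total oscillation. So one \<open>N\<close> serves for all of them.\<close>

lemma fejer_converges_lipschitz:
  assumes e: "0 < \<epsilon>"
  obtains N where "N \<ge> 1" "\<And>n f \<theta>. \<lbrakk>n \<ge> N; f \<in> Cinf_circle; \<And>\<theta>. cmod (dsymbol f \<theta>) \<le> 1\<rbrakk> \<Longrightarrow> cmod (fejer n f \<theta> - f \<theta>) \<le> \<epsilon>"
proof -
  have lip: "cmod (f s - f t) \<le> \<bar>s - t\<bar>" if f: "f \<in> Cinf_circle" and 1: "\<And>\<theta>. cmod (dsymbol f \<theta>) \<le> 1" for f s t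
  proof -
    have 1: "cmod (circle_deriv f \<theta>) \<le> 1" for \<theta> using 1[of \<theta>] by (simp add: dsymbol_def norm_mult)
    have less: "cmod (f b - f a) \<le> b - a" if "a < b" for a b
    proof -
      have "\<exists>x\<in>{a<..<b}. norm (f b - f a) \<le> norm ((b - a) *\<^sub>R circle_deriv f x)"
        by (rule mvt_general[OF that, where f' = "\<lambda>x h. h *\<^sub>R circle_deriv f x"])
          (use Cinf_has_deriv[OF f] Cinf_subset_C[OF f] in
            \<open>auto simp: has_vector_derivative_def C_circle_def intro: continuous_on_subset\<close>)
      then obtain x where "norm (f b - f a) \<le> norm ((b - a) *\<^sub>R circle_deriv f x)" by blast
      also have "\<dots> \<le> (b - a) * 1" unfolding norm_scaleR using that 1 by (intro mult_mono) auto
      finally show ?thesis by simp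
    qed
    show ?thesis using less[of s t] less[of t s] norm_minus_commute[of "f s" "f t"] by (cases s t rule: linorder_cases) auto
  qed
  define \<delta> where "\<delta> = min (\<epsilon> / 2) pi"
  have \<delta>: "0 < \<delta>" "\<delta> \<le> pi" using e by (auto simp: \<delta>_def)
  obtain N where N: "N \<ge> 1" "\<And>n f \<theta>. \<lbrakk>n \<ge> N; f \<in> C_circle; \<And>s t. \<bar>s - t\<bar> < \<delta> \<Longrightarrow> cmod (f s - f t) \<le> \<epsilon> / 2;
     \<And>s t. \<bar>s - t\<bar> \<le> pi \<Longrightarrow> cmod (f s - f t) \<le> pi\<rbrakk> \<Longrightarrow> cmod (fejer n f \<theta> - f \<theta>) \<le> \<epsilon>"
    using fejer_uniform[OF e \<delta>, of pi] by metis
  have "cmod (fejer n f \<theta> - f \<theta>) \<le> \<epsilon>"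
    if n: "n \<ge> N" and f: "f \<in> Cinf_circle" and 1: "\<And>\<theta>. cmod (dsymbol f \<theta>) \<le> 1" for n f \<theta>
  proof (rule N(2)[OF n Cinf_subset_C[OF f]])
    show "cmod (f s - f t) \<le> \<epsilon> / 2" if "\<bar>s - t\<bar> < \<delta>" for s t
      using lip[OF f 1, of s t] that by (simp add: \<delta>_def)
    show "cmod (f s - f t) \<le> pi" if "\<bar>s - t\<bar> \<le> pi" for s t
      using lip[OF f 1, of s t] that by simp
  qed
  then show ?thesis using that N(1) by blast
qed

text \<open>The squared norms of \<open>f * coherent n \<theta> / sqrt n\<close> are the Fejer means of \<open>\<bar>f\<bar>\<^sup>2\<close> at \<open>\<theta>\<close>, which converge to
  \<open>\<bar>f \<theta>\<bar>\<^sup>2\<close>. The test vectors are smooth, so the bound on the core is enough.\<close>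

lemma sup_le_op_norm_mult:
  assumes f: "f \<in> C_circle" and op: "op_norm Cinf_circle (mult_op f) \<le> 1"
  shows "cmod (f \<theta>) \<le> 1"
proof -
  let ?F = "\<lambda>s. cnj (f s) * f s"
  have F: "?F \<in> C_circle" by (intro C_circle_mult C_circle_cnj f)
  have fejer_le: "Re (fejer n ?F \<theta>) \<le> 1" if n: "n \<ge> 1" for n
  proof -
    let ?v = "coherent n \<theta>"
    have "L2_inner (toep n ?F ?v) ?v = L2_inner (\<lambda>s. f s * ?v s) (\<lambda>s. f s * ?v s)"
      unfolding L2_inner_toep[OF F coherent_H coherent_H] by (simp add: L2_inner_def mult_ac)
    also have "\<dots> = complex_of_real ((L2_norm (mult_op f ?v))\<^sup>2)"
      by (simp only: L2_inner_self mult_op_apply[OF coherent_L2])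
    finally have eq: "Re (fejer n ?F \<theta>) = (L2_norm (mult_op f ?v))\<^sup>2 / n"
      by (simp add: lower_symbol_def)
    have "L2_norm (mult_op f ?v) \<le> op_norm Cinf_circle (mult_op f) * L2_norm ?v"
      by (intro op_norm_bound bounded_op_mult f Cinf_scale H_trunc_Cinf[OF coherent_H] subsetI Cinf_subset_L2)
    also have "\<dots> \<le> 1 * L2_norm ?v" using op by (intro mult_right_mono) auto
    finally have "(L2_norm (mult_op f ?v))\<^sup>2 \<le> (L2_norm ?v)\<^sup>2" by (intro power_mono) auto
    then show ?thesis unfolding eq L2_norm_coherent using n by simp
  qed
  have "(cmod (f \<theta>))\<^sup>2 \<le> 1 + \<epsilon>" if e: "\<epsilon> > 0" for \<epsilon>
  proof -
    obtain N where N: "N \<ge> 1" "\<And>n \<theta>. n \<ge> N \<Longrightarrow> cmod (fejer n ?F \<theta> - ?F \<theta>) \<le> \<epsilon>"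
      using fejer_converges[OF F e] by blast
    have "?F \<theta> = complex_of_real ((cmod (f \<theta>))\<^sup>2)" by (simp only: complex_norm_square mult.commute)
    then have "(cmod (f \<theta>))\<^sup>2 = Re (fejer N ?F \<theta>) - Re (fejer N ?F \<theta> - ?F \<theta>)" by simp
    also have "\<dots> \<le> 1 + \<epsilon>"
      using fejer_le[OF N(1)] N(2)[of N \<theta>] abs_Re_le_cmod[of "fejer N ?F \<theta> - ?F \<theta>"] by linarith
    finally show ?thesis .
  qed
  then have "(cmod (f \<theta>))\<^sup>2 \<le> 1" by (rule field_le_epsilon)
  then show ?thesis by (simp add: power_le_one_iff abs_square_le_1)
qed


section \<open>The two operator systems\<close>

abbreviation Toeplitz_ball :: "nat \<Rightarrow> circle_op set" where
  "Toeplitz_ball n \<equiv> lip_ball (H_trunc n) (Toeplitz_sys n) (lip_Toeplitz n)"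

abbreviation C_ball :: "circle_op set" where
  "C_ball \<equiv> lip_ball L2_circle Cinf_sys lip_C"

lemma op_norm_zero: "(\<lambda>\<theta>. 0) \<in> H \<Longrightarrow> op_norm H (\<lambda>g \<theta>. 0) = 0"
proof -
  assume "(\<lambda>\<theta>. 0) \<in> H"
  then have "{L2_norm ((\<lambda>g \<theta>. 0) g :: circle_fun) |g. g \<in> H \<and> L2_norm g \<le> 1} = {0}"
    by (auto intro!: exI[of _ "\<lambda>\<theta>. 0"])
  then show ?thesis by (simp add: op_norm_def)
qed

lemma L2_norm_trig: "L2_norm (trig m) = 1"
  by (simp add: L2_norm_def trig_orthonormal)

lemma
  shows mult_op_add: "mult_op (\<lambda>\<theta>. f \<theta> + f' \<theta>) = (\<lambda>g \<theta>. mult_op f g \<theta> + mult_op f' g \<theta>)"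
    and mult_op_diff: "mult_op (\<lambda>\<theta>. f \<theta> - f' \<theta>) = (\<lambda>g \<theta>. mult_op f g \<theta> - mult_op f' g \<theta>)"
    and mult_op_scale: "mult_op (\<lambda>\<theta>. c * f \<theta>) = (\<lambda>g \<theta>. c * mult_op f g \<theta>)"
    and mult_op_sum: "mult_op (\<lambda>\<theta>. \<Sum>i\<in>I. F i \<theta>) = (\<lambda>g \<theta>. \<Sum>i\<in>I. mult_op (F i) g \<theta>)"
    and mult_op_one: "mult_op (\<lambda>\<theta>. 1) = op_on L2_circle id"
  by (auto simp: mult_op_def op_on_def fun_eq_iff algebra_simps sum_distrib_right sum_distrib_left)

lemma dsymbol_scale:
  assumes f: "f \<in> Cinf_circle" shows "dsymbol (\<lambda>\<theta>. c * f \<theta>) = (\<lambda>\<theta>. c * dsymbol f \<theta>)"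
  unfolding dsymbol_def vector_derivative_at[OF has_vector_derivative_mult_right[OF Cinf_has_deriv[OF f]]]
  by (simp add: mult.left_commute)

text \<open>This is what makes the Lipschitz balls absorbing in both systems.\<close>

lemma smooth_normalize:
  assumes f: "f \<in> Cinf_circle"
  obtains c where "c > 0" "\<And>\<theta>. cmod (complex_of_real c * f \<theta>) \<le> 1"
    "\<And>\<theta>. cmod (dsymbol (\<lambda>\<theta>. complex_of_real c * f \<theta>) \<theta>) \<le> 1"
proof -
  obtain M where M: "0 \<le> M" "\<And>\<theta>. cmod (f \<theta>) \<le> M" using C_circle_bounded[OF Cinf_subset_C[OF f]] by blast
  obtain M' where M': "0 \<le> M'" "\<And>\<theta>. cmod (dsymbol f \<theta>) \<le> M'" using C_circle_bounded[OF dsymbol_C[OF f]] by blast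
  define c where "c = 1 / (1 + M + M')"
  have c: "c > 0" "c * (1 + M + M') = 1" using M M' by (auto simp: c_def)
  have le: "cmod (complex_of_real c * z) \<le> 1" if "cmod z \<le> 1 + M + M'" for z
    using mult_left_mono[OF that, of c] c by (simp add: norm_mult)
  show ?thesis
  proof (rule that[OF c(1)])
    show "cmod (complex_of_real c * f \<theta>) \<le> 1" for \<theta> using M(2)[of \<theta>] M'(1) by (intro le) simp
    show "cmod (dsymbol (\<lambda>\<theta>. complex_of_real c * f \<theta>) \<theta>) \<le> 1" for \<theta>
      unfolding dsymbol_scale[OF f] using M'(2)[of \<theta>] M(1) by (intro le) simp
  qed
qed

lemma Toeplitz_ballI:
  assumes f: "f \<in> Cinf_circle" and "\<And>\<theta>. cmod (f \<theta>) \<le> 1" "\<And>\<theta>. cmod (dsymbol f \<theta>) \<le> 1"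
  shows "toep n f \<in> Toeplitz_ball n"
proof -
  have H: "H_trunc n \<subseteq> L2_circle" "(\<lambda>\<theta>. 1) \<in> L2_circle"
    using H_trunc_L2 C_circle_subset_L2[OF C_circle_const] by auto
  have le: "op_norm (H_trunc n) (toep n u) \<le> 1" if "u \<in> C_circle" "\<And>\<theta>. cmod (u \<theta>) \<le> 1" for u
  proof -
    have "op_norm (H_trunc n) (toep n u) \<le> op_norm L2_circle (mult_op u)"
      by (rule op_norm_toep_le_mult[OF that(1) subset_refl L2_scale H])
    also have "\<dots> \<le> 1" using H that by (intro op_norm_mult_le L2_scale) auto
    finally show ?thesis .
  qed
  show ?thesis
    using assms f le[OF Cinf_subset_C[OF f]] le[OF dsymbol_C[OF f]]
    by (auto simp: lip_ball_def lip_Toeplitz_toep Toeplitz_sys_eq Cinf_subset_C)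
qed

lemma C_ballI:
  assumes f: "f \<in> Cinf_circle" and "\<And>\<theta>. cmod (f \<theta>) \<le> 1" "\<And>\<theta>. cmod (dsymbol f \<theta>) \<le> 1"
  shows "mult_op f \<in> C_ball"
proof -
  have "op_norm L2_circle (mult_op f) \<le> 1"
    using assms L2_zero by (intro op_norm_mult_le L2_scale Cinf_subset_C) auto
  moreover have "op_norm Cinf_circle (mult_op (dsymbol f)) \<le> 1"
    using assms Cinf_const Cinf_subset_L2 by (intro op_norm_mult_le Cinf_scale dsymbol_C) auto
  ultimately show ?thesis using f by (simp add: lip_ball_def lip_C_mult Cinf_sys_def)
qed

lemma C_ballE:
  assumes "T \<in> C_ball"
  obtains f where "f \<in> Cinf_circle" "T = mult_op f" "op_norm L2_circle (mult_op f) \<le> 1"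
    "op_norm Cinf_circle (mult_op (dsymbol f)) \<le> 1"
  using assms by (auto simp: lip_ball_def Cinf_sys_def lip_C_mult)

lemma Toeplitz_ballE:
  assumes "T \<in> Toeplitz_ball n"
  obtains f where "f \<in> Cinf_circle" "T = toep n f" "op_norm (H_trunc n) (toep n f) \<le> 1"
    "op_norm (H_trunc n) (toep n (dsymbol f)) \<le> 1"
  using assms by (auto simp: lip_ball_def lip_Toeplitz_toep elim!: Toeplitz_sysE_smooth)

text \<open>Fourier coefficients are matrix entries, so they are bounded by the norm.\<close>

lemma fhat_le_toep:
  assumes f: "f \<in> C_circle" and m: "\<bar>m\<bar> < int n"
  shows "cmod (fhat f m) \<le> op_norm (H_trunc n) (toep n f)"
proof -
  \<comment> \<open>a position \<open>(a, b)\<close> on the \<open>m\<close>-th diagonal\<close>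
  define a b where "a = nat (max 1 (1 + m))" and "b = nat (max 1 (1 - m))"
  have ab: "1 \<le> a" "a \<le> n" "1 \<le> b" "b \<le> n" and m: "m = int a - int b" using m by (auto simp: a_def b_def)
  have H: "trig (int b) \<in> H_trunc n" using ab by (intro trig_H_trunc)
  have "cmod (fhat f m) \<le> L2_norm (toep n f (trig (int b))) * L2_norm (trig (int a))"
    unfolding m toep_entry[OF f ab, symmetric]
    by (rule L2_Cauchy_Schwarz[OF H_trunc_L2[OF toep_mem_H[OF f H]] trig_L2])
  also have "\<dots> \<le> op_norm (H_trunc n) (toep n f)"
    using op_norm_bound[OF bounded_op_toep[OF f] H] by (simp add: L2_norm_trig)
  finally show ?thesis .
qed

context ball_sequence
begin

text \<open>The Lipschitz ball lies in a finite-dimensional space, spanned by the Toeplitz operators with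
  symbols \<open>trig m\<close>, and the coefficients in this basis are Fourier coefficients.\<close>

lemma lip_system_Toeplitz:
  assumes n: "n \<ge> 1"
  shows "lip_system k (H_trunc n) (Toeplitz_sys n) (Toeplitz_sys n) (lip_Toeplitz n)"
proof unfold_locales
  show "H_trunc n \<subseteq> L2_circle" using H_trunc_L2 by blast
  show "\<exists>g\<in>H_trunc n. L2_norm g \<noteq> 0"
    using trig_H_trunc[of 1 n] n by (intro bexI[of _ "trig (int 1)"]) (auto simp: L2_norm_trig)
  have zero: "(\<lambda>\<theta>. 0) \<in> H_trunc n" using H_trunc_scale[OF H_truncI, of 0 "\<lambda>_. 0"] by simp
  show "T g \<in> L2_circle" if "T \<in> Toeplitz_sys n" "g \<in> H_trunc n" for T g
    using that H_trunc_L2[OF toep_mem_H] by (auto simp: Toeplitz_sys_eq)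
  show "bounded_op (H_trunc n) T" if "T \<in> Toeplitz_sys n" for T
    using that bounded_op_toep by (auto simp: Toeplitz_sys_eq)
  show "op_on (H_trunc n) id \<in> Toeplitz_sys n"
    unfolding Toeplitz_sys_eq using toep_one[of n, symmetric] C_circle_const by blast
  show "(\<lambda>g \<theta>. S g \<theta> + T g \<theta>) \<in> Toeplitz_sys n" if "S \<in> Toeplitz_sys n" "T \<in> Toeplitz_sys n" for S T
    using that unfolding Toeplitz_sys_eq by (auto simp: toep_add[symmetric] C_circle_add)
  show "(\<lambda>g \<theta>. c * T g \<theta>) \<in> Toeplitz_sys n" if "T \<in> Toeplitz_sys n" for c T
    using that unfolding Toeplitz_sys_eq by (auto simp: toep_scale[symmetric] C_circle_mult C_circle_const)
  show "\<exists>T'\<in>Toeplitz_sys n. \<forall>g\<in>H_trunc n. \<forall>h\<in>H_trunc n. L2_inner (T' g) h = L2_inner g (T h)"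
    if T: "T \<in> Toeplitz_sys n" for T
  proof -
    obtain f where f: "f \<in> C_circle" and T: "T = toep n f" using T by (auto simp: Toeplitz_sys_eq)
    have "L2_inner (toep n (\<lambda>\<theta>. cnj (f \<theta>)) g) h = L2_inner g (T h)" if g: "g \<in> H_trunc n" and h: "h \<in> H_trunc n" for g h
    proof -
      have "L2_inner g (T h) = cnj (L2_inner (\<lambda>\<theta>. f \<theta> * h \<theta>) g)"
        unfolding T using L2_inner_commute L2_inner_toep[OF f h g] by metis
      also have "\<dots> = L2_inner g (\<lambda>\<theta>. f \<theta> * h \<theta>)" by (rule L2_inner_commute[symmetric])
      also have "\<dots> = L2_inner (\<lambda>\<theta>. cnj (f \<theta>) * g \<theta>) h" by (simp add: L2_inner_def mult_ac)
      finally show ?thesis by (simp add: L2_inner_toep[OF C_circle_cnj[OF f] g h])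
    qed
    then show ?thesis unfolding Toeplitz_sys_eq using C_circle_cnj[OF f] by blast
  qed
  show "\<exists>c>0. (\<lambda>g \<theta>. complex_of_real c * T g \<theta>) \<in> Toeplitz_ball n"
    if "T \<in> Toeplitz_sys n" for T
  proof -
    obtain f where f: "f \<in> Cinf_circle" and T: "T = toep n f" using \<open>T \<in> Toeplitz_sys n\<close> by (rule Toeplitz_sysE_smooth)
    obtain c where c: "c > 0" "\<And>\<theta>. cmod (complex_of_real c * f \<theta>) \<le> 1"
      "\<And>\<theta>. cmod (dsymbol (\<lambda>\<theta>. complex_of_real c * f \<theta>) \<theta>) \<le> 1" using smooth_normalize[OF f] by blast
    have "toep n (\<lambda>\<theta>. complex_of_real c * f \<theta>) \<in> Toeplitz_ball n"
      by (rule Toeplitz_ballI[OF Cinf_scale[OF f] c(2,3)])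
    then show ?thesis using c(1) by (auto simp: T toep_scale[OF Cinf_subset_C[OF f]])
  qed
  show "\<exists>S\<in>Toeplitz_sys n. op_norm (H_trunc n) (\<lambda>g \<theta>. T g \<theta> - S g \<theta>) \<le> \<epsilon>" if "T \<in> Toeplitz_sys n" "0 < \<epsilon>" for T \<epsilon>
    using that zero by (intro bexI[of _ T]) (simp_all add: op_norm_zero)
  show "Toeplitz_sys n \<noteq> {}" unfolding Toeplitz_sys_eq using C_circle_const by blast
  fix \<epsilon> :: real assume e: "0 < \<epsilon>"
  show "\<exists>(I :: (int \<times> int) set) \<tau>. finite I \<and> (\<forall>i\<in>I. \<tau> i \<in> Toeplitz_sys n) \<and>
      (\<forall>T\<in>Toeplitz_ball n. \<exists>c. (\<forall>i\<in>I. cmod (c i) \<le> 1) \<and>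
         op_norm (H_trunc n) (\<lambda>g \<theta>. T g \<theta> - (\<Sum>i\<in>I. c i * \<tau> i g \<theta>)) \<le> \<epsilon>)"
  proof (intro exI conjI)
    let ?I = "{- int n<..<int n} \<times> {0 :: int}"
    \<comment> \<open>the second component is a dummy; the system of continuous functions is indexed by pairs\<close>
    show "finite (?I)" by simp
    show "\<forall>i\<in>?I. toep n (trig (fst i)) \<in> Toeplitz_sys n"
      by (simp add: Toeplitz_sys_eq trig_C)
    show "\<forall>T\<in>Toeplitz_ball n.
        \<exists>c. (\<forall>i\<in>?I. cmod (c i) \<le> 1) \<and>
         op_norm (H_trunc n) (\<lambda>g \<theta>. T g \<theta> - (\<Sum>i\<in>?I. c i * toep n (trig (fst i)) g \<theta>)) \<le> \<epsilon>"
    proof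
      fix T assume "T \<in> Toeplitz_ball n"
      then obtain f where f: "f \<in> Cinf_circle" and T: "T = toep n f" and le: "op_norm (H_trunc n) (toep n f) \<le> 1"
        by (rule Toeplitz_ballE)
      have 1: "\<forall>i\<in>?I. cmod (fhat f (fst i)) \<le> 1"
        by (intro ballI order_trans[OF fhat_le_toep[OF Cinf_subset_C[OF f]] le]) auto
      have "T g \<theta> = (\<Sum>i\<in>?I. fhat f (fst i) * toep n (trig (fst i)) g \<theta>)" for g \<theta>
        unfolding T by (subst toep_trig_poly[OF Cinf_subset_C[OF f]])
          (simp add: toep_sum_trig sum.cartesian_product')
      then have "op_norm (H_trunc n) (\<lambda>g \<theta>. T g \<theta> - (\<Sum>i\<in>?I. fhat f (fst i) * toep n (trig (fst i)) g \<theta>)) \<le> \<epsilon>"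
        using e zero by (simp add: op_norm_zero)
      with 1 show "\<exists>c. (\<forall>i\<in>?I. cmod (c i) \<le> 1) \<and>
         op_norm (H_trunc n) (\<lambda>g \<theta>. T g \<theta> - (\<Sum>i\<in>?I. c i * toep n (trig (fst i)) g \<theta>)) \<le> \<epsilon>"
        by (intro exI[of _ "\<lambda>i. fhat f (fst i)"] conjI)
    qed
  qed
qed simp

text \<open>Density of the smooth functions and total boundedness of the Lipschitz ball are both supplied by
  the approximation with Fejer means.\<close>

lemma lip_system_C: "lip_system k L2_circle C_sys Cinf_sys lip_C"
proof unfold_locales
  have one: "(\<lambda>\<theta>. 1) \<in> L2_circle" by (rule C_circle_subset_L2[OF C_circle_const])
  show "\<exists>g\<in>L2_circle. L2_norm g \<noteq> 0" using one L2_norm_one by (intro bexI[of _ "\<lambda>\<theta>. 1"]) auto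
  show "T g \<in> L2_circle" if "T \<in> C_sys" "g \<in> L2_circle" for T g
    using that by (auto simp: C_sys_def mult_op_apply L2_mult)
  show "bounded_op L2_circle T" if "T \<in> C_sys" for T
    using that by (auto simp: C_sys_def intro!: bounded_op_mult L2_scale)
  show "op_on L2_circle id \<in> C_sys"
    unfolding C_sys_def mult_op_one[symmetric] by (intro imageI C_circle_const)
  show "(\<lambda>g \<theta>. S g \<theta> + T g \<theta>) \<in> C_sys" if "S \<in> C_sys" "T \<in> C_sys" for S T
    using that by (auto simp: C_sys_def mult_op_add[symmetric] C_circle_add)
  show "(\<lambda>g \<theta>. c * T g \<theta>) \<in> C_sys" if "T \<in> C_sys" for c T
    using that by (auto simp: C_sys_def mult_op_scale[symmetric] C_circle_mult C_circle_const)
  show "\<exists>T'\<in>C_sys. \<forall>g\<in>L2_circle. \<forall>h\<in>L2_circle. L2_inner (T' g) h = L2_inner g (T h)" if T: "T \<in> C_sys" for T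
  proof -
    obtain f where f: "f \<in> C_circle" and T: "T = mult_op f" using T by (auto simp: C_sys_def)
    have "L2_inner (mult_op (\<lambda>\<theta>. cnj (f \<theta>)) g) h = L2_inner g (T h)" if "g \<in> L2_circle" "h \<in> L2_circle" for g h
      using that by (simp add: T mult_op_apply L2_inner_def mult_ac)
    then show ?thesis unfolding C_sys_def using C_circle_cnj[OF f] by blast
  qed
  show "Cinf_sys \<subseteq> C_sys" using Cinf_subset_C by (auto simp: C_sys_def Cinf_sys_def)
  show "\<exists>c>0. (\<lambda>g \<theta>. complex_of_real c * T g \<theta>) \<in> C_ball" if T: "T \<in> Cinf_sys" for T
  proof -
    obtain f where f: "f \<in> Cinf_circle" and T: "T = mult_op f" using T by (auto simp: Cinf_sys_def)
    obtain c where c: "c > 0" "\<And>\<theta>. cmod (complex_of_real c * f \<theta>) \<le> 1"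
      "\<And>\<theta>. cmod (dsymbol (\<lambda>\<theta>. complex_of_real c * f \<theta>) \<theta>) \<le> 1" using smooth_normalize[OF f] by blast
    have "mult_op (\<lambda>\<theta>. complex_of_real c * f \<theta>) \<in> C_ball"
      by (rule C_ballI[OF Cinf_scale[OF f] c(2,3)])
    then show ?thesis using c(1) by (auto simp: T mult_op_scale)
  qed
  have diff_le: "op_norm L2_circle (\<lambda>g \<theta>. mult_op f g \<theta> - mult_op (fejer n f) g \<theta>) \<le> \<epsilon>"
    if f: "f \<in> C_circle" and le: "\<And>\<theta>. cmod (fejer n f \<theta> - f \<theta>) \<le> \<epsilon>" for f n \<epsilon>
    unfolding mult_op_diff[symmetric] using le one
    by (intro op_norm_mult_le L2_scale C_circle_diff f Cinf_subset_C[OF fejer_Cinf[OF f]]) (auto simp: norm_minus_commute)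
  show "\<exists>S\<in>Cinf_sys. op_norm L2_circle (\<lambda>g \<theta>. T g \<theta> - S g \<theta>) \<le> \<epsilon>" if T: "T \<in> C_sys" and e: "0 < \<epsilon>" for T \<epsilon>
  proof -
    obtain f where f: "f \<in> C_circle" and T: "T = mult_op f" using T by (auto simp: C_sys_def)
    obtain N where "\<And>n \<theta>. n \<ge> N \<Longrightarrow> cmod (fejer n f \<theta> - f \<theta>) \<le> \<epsilon>" using fejer_converges[OF f e] by blast
    from diff_le[OF f this[OF order_refl]] show ?thesis
      unfolding T Cinf_sys_def using fejer_Cinf[OF f] by blast
  qed
  show "Cinf_sys \<noteq> {}" unfolding Cinf_sys_def using Cinf_const by blast
  fix \<epsilon> :: real assume e: "0 < \<epsilon>"
  obtain N where N: "N \<ge> 1" "\<And>n f \<theta>. \<lbrakk>n \<ge> N; f \<in> Cinf_circle; \<And>\<theta>. cmod (dsymbol f \<theta>) \<le> 1\<rbrakk> \<Longrightarrow> cmod (fejer n f \<theta> - f \<theta>) \<le> \<epsilon>"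
    using fejer_converges_lipschitz[OF e] by metis
  show "\<exists>(I :: (int \<times> int) set) \<tau>. finite I \<and> (\<forall>i\<in>I. \<tau> i \<in> C_sys) \<and>
      (\<forall>T\<in>C_ball. \<exists>c. (\<forall>i\<in>I. cmod (c i) \<le> 1) \<and>
         op_norm L2_circle (\<lambda>g \<theta>. T g \<theta> - (\<Sum>i\<in>I. c i * \<tau> i g \<theta>)) \<le> \<epsilon>)"
  proof (intro exI conjI)
    show "finite (index_square N)" by simp
    show "\<forall>i\<in>index_square N. mult_op (trig (fst i - snd i)) \<in> C_sys" by (simp add: C_sys_def trig_C)
    show "\<forall>T\<in>C_ball. \<exists>c. (\<forall>i\<in>index_square N. cmod (c i) \<le> 1) \<and>
         op_norm L2_circle (\<lambda>g \<theta>. T g \<theta> - (\<Sum>i\<in>index_square N. c i * mult_op (trig (fst i - snd i)) g \<theta>)) \<le> \<epsilon>"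
    proof
      fix T assume "T \<in> C_ball"
      then obtain f where f: "f \<in> Cinf_circle" and T: "T = mult_op f" and op: "op_norm L2_circle (mult_op f) \<le> 1"
        and lip: "op_norm Cinf_circle (mult_op (dsymbol f)) \<le> 1" by (rule C_ballE)
      note fC = Cinf_subset_C[OF f]
      have fhat_le: "cmod (fhat f m) \<le> 1" for m
      proof -
        have "cmod (fhat f m) \<le> L2_norm (mult_op f (\<lambda>\<theta>. 1)) * L2_norm (trig m)"
          unfolding fhat_def using one L2_Cauchy_Schwarz[OF C_circle_subset_L2[OF fC] trig_L2] by (simp add: mult_op_apply)
        also have "\<dots> \<le> op_norm L2_circle (mult_op f)"
          using op_norm_bound[OF bounded_op_mult[OF fC subset_refl L2_scale] one] by (simp add: L2_norm_trig L2_norm_one)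
        finally show ?thesis using op by simp
      qed
      have "cmod (fhat f m / of_nat N) \<le> 1" for m
        using fhat_le[of m] N(1) by (simp add: norm_divide divide_le_eq)
      moreover have "mult_op (fejer N f) g \<theta> = (\<Sum>i\<in>index_square N. fhat f (fst i - snd i) / of_nat N * mult_op (trig (fst i - snd i)) g \<theta>)" for g \<theta>
        unfolding fejer_eq[OF fC] mult_op_sum mult_op_scale ..
      then have "op_norm L2_circle (\<lambda>g \<theta>. T g \<theta> - (\<Sum>i\<in>index_square N. fhat f (fst i - snd i) / of_nat N * mult_op (trig (fst i - snd i)) g \<theta>)) \<le> \<epsilon>"
        using diff_le[OF fC N(2)[OF order_refl f sup_le_op_norm_mult[OF dsymbol_C[OF f] lip]]] by (simp add: T)
      ultimately show "\<exists>c. (\<forall>i\<in>index_square N. cmod (c i) \<le> 1) \<and>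
         op_norm L2_circle (\<lambda>g \<theta>. T g \<theta> - (\<Sum>i\<in>index_square N. c i * mult_op (trig (fst i - snd i)) g \<theta>)) \<le> \<epsilon>"
        by (intro exI[of _ "\<lambda>i. fhat f (fst i - snd i) / of_nat N"] conjI ballI)
    qed
  qed
qed simp

end


section \<open>Transporting unital completely positive maps\<close>

lemma UCP_pullback:
  assumes \<psi>: "\<psi> \<in> UCP H E"
    and mem: "\<And>T. T \<in> E' \<Longrightarrow> \<sigma> T \<in> E"
    and add: "\<And>S T. S \<in> E' \<Longrightarrow> T \<in> E' \<Longrightarrow> \<sigma> (\<lambda>g \<theta>. S g \<theta> + T g \<theta>) = (\<lambda>g \<theta>. \<sigma> S g \<theta> + \<sigma> T g \<theta>)"
    and scale: "\<And>c T. T \<in> E' \<Longrightarrow> \<sigma> (\<lambda>g \<theta>. c * T g \<theta>) = (\<lambda>g \<theta>. c * \<sigma> T g \<theta>)"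
    and unit: "\<sigma> (op_on H' id) = op_on H id"
    and pos: "\<And>m X. (\<And>i j. i < m \<Longrightarrow> j < m \<Longrightarrow> X i j \<in> E') \<Longrightarrow> mat_positive H' L2_inner m X \<Longrightarrow>
       mat_positive H L2_inner m (\<lambda>i j. \<sigma> (X i j))"
    and E'_add: "\<And>S T. S \<in> E' \<Longrightarrow> T \<in> E' \<Longrightarrow> (\<lambda>g \<theta>. S g \<theta> + T g \<theta>) \<in> E'"
    and E'_scale: "\<And>c T. T \<in> E' \<Longrightarrow> (\<lambda>g \<theta>. c * T g \<theta>) \<in> E'"
    and E'_unit: "op_on H' id \<in> E'"
  shows "restrict (\<lambda>T. \<psi> (\<sigma> T)) E' \<in> UCP H' E'"
  unfolding UCP_def
proof (intro CollectI conjI ballI allI impI)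
  fix m X assume X: "(\<forall>i<m. \<forall>j<m. X i j \<in> E') \<and> mat_positive H' L2_inner m X"
  have "mat_positive UNIV cinner m (\<lambda>i j. \<psi> (\<sigma> (X i j)))"
    using X by (intro UCP_positive[OF \<psi>] pos mem) auto
  then show "mat_positive UNIV cinner m (\<lambda>i j. restrict (\<lambda>T. \<psi> (\<sigma> T)) E' (X i j))"
    using X by (simp add: mat_positive_def)
qed (simp_all add: mem add scale unit E'_add E'_scale E'_unit UCP_clinear[OF \<psi>] UCP_add[OF \<psi>]
      UCP_scale[OF \<psi>] UCP_unit[OF \<psi>])

text \<open>The supremum for the pullbacks runs over a part of the set of values for \<open>\<phi>\<close> and \<open>\<psi>\<close>.\<close>

lemma UCP_dist_pullback_le:
  assumes A: "lip_system k H E E0 L" and B: "lip_system k H' E' E0' L'"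
    and \<phi>: "\<phi> \<in> UCP H E" "restrict (\<lambda>T. \<phi> (\<sigma> T)) E' \<in> UCP H' E'"
    and \<psi>: "\<psi> \<in> UCP H E" "restrict (\<lambda>T. \<psi> (\<sigma> T)) E' \<in> UCP H' E'"
    and ball: "\<And>T. T \<in> lip_ball H' E0' L' \<Longrightarrow> \<sigma> T \<in> lip_ball H E0 L"
  shows "UCP_dist k H' E' E0' L' (restrict (\<lambda>T. \<phi> (\<sigma> T)) E') (restrict (\<lambda>T. \<psi> (\<sigma> T)) E')
    \<le> UCP_dist k H E E0 L \<phi> \<psi>"
proof -
  interpret A: lip_system k H E E0 L by (rule A)
  interpret B: lip_system k H' E' E0' L' by (rule B)
  show ?thesis
  proof (rule B.UCP_dist_least[OF \<phi>(2) \<psi>(2)])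
    fix T assume T: "T \<in> lip_ball H' E0' L'"
    then have "T \<in> E'" using B.ball_subset by blast
    then show "weighted_form k (\<lambda>x. restrict (\<lambda>T. \<phi> (\<sigma> T)) E' T x - restrict (\<lambda>T. \<psi> (\<sigma> T)) E' T x)
        \<le> UCP_dist k H E E0 L \<phi> \<psi>"
      using A.UCP_dist_upper[OF \<phi>(1) \<psi>(1) ball[OF T]] by simp
  qed
qed

text \<open>If \<open>\<psi>\<close> is \<open>\<phi>\<close> composed with a map that moves the Lipschitz ball by at most \<open>\<epsilon>\<close>, contractivity of
  \<open>\<phi>\<close> gives the same bound for the metric.\<close>

lemma (in lip_system) UCP_dist_near:
  assumes \<phi>: "\<phi> \<in> UCP H E" and \<psi>: "\<psi> \<in> UCP H E"
    and near: "\<And>T. T \<in> lip_ball H E0 L \<Longrightarrow> \<exists>S\<in>E. \<psi> T = \<phi> S \<and> op_norm H (\<lambda>g \<theta>. T g \<theta> - S g \<theta>) \<le> \<epsilon>"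
  shows "udist \<phi> \<psi> \<le> \<epsilon>"
proof (rule UCP_dist_least[OF \<phi> \<psi>])
  fix T assume T: "T \<in> lip_ball H E0 L"
  then have TE: "T \<in> E" using ball_subset by blast
  obtain S where S: "S \<in> E" "\<psi> T = \<phi> S" "op_norm H (\<lambda>g \<theta>. T g \<theta> - S g \<theta>) \<le> \<epsilon>" using near[OF T] by blast
  show "weighted_form k (\<lambda>x. \<phi> T x - \<psi> T x) \<le> \<epsilon>"
    using order_trans[OF UCP_form_le[OF \<phi> E_diff[OF TE S(1)]] S(3)]
    by (intro weighted_form_le) (simp add: UCP_diff[OF \<phi> TE S(1)] S(2))
qed

text \<open>The two maps between the operator systems: compression to the truncated space, and the map
  that sends an operator to multiplication by its lower symbol.\<close>

definition compress :: "nat \<Rightarrow> circle_op \<Rightarrow> circle_op" where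
  "compress n T = op_on (H_trunc n) (\<lambda>g. P_trunc n (T g))"

definition symbol_op :: "nat \<Rightarrow> circle_op \<Rightarrow> circle_op" where
  "symbol_op n T = mult_op (lower_symbol n T)"

lemma compress_mult: "compress n (mult_op f) = toep n f"
  by (simp add: compress_def toep_def)

lemma compress_positive:
  assumes X: "\<And>i j. i < m \<Longrightarrow> j < m \<Longrightarrow> X i j \<in> C_sys" and pos: "mat_positive L2_circle L2_inner m X"
  shows "mat_positive (H_trunc n) L2_inner m (\<lambda>i j. compress n (X i j))"
  unfolding mat_positive_def
proof (intro allI impI)
  fix h assume h: "\<forall>i<m. h i \<in> H_trunc n"
  have "L2_inner (compress n (X i j) (h j)) (h i) = L2_inner (X i j (h j)) (h i)" if ij: "i < m" "j < m" for i j
  proof -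
    obtain f where f: "f \<in> C_circle" "X i j = mult_op f" using X[OF ij] by (auto simp: C_sys_def)
    then show ?thesis
      using h ij by (simp add: compress_mult L2_inner_toep mult_op_apply H_trunc_L2[of "h j" n])
  qed
  then have "(\<Sum>i<m. \<Sum>j<m. L2_inner (compress n (X i j) (h j)) (h i)) = (\<Sum>i<m. \<Sum>j<m. L2_inner (X i j (h j)) (h i))"
    by simp
  then show "(\<Sum>i<m. \<Sum>j<m. L2_inner (compress n (X i j) (h j)) (h i)) \<in> \<real>\<^sub>\<ge>\<^sub>0"
    using pos H_trunc_L2 h unfolding mat_positive_def by (metis (no_types, lifting))
qed

lemma nonneg_Reals_eq_of_real: "z \<in> \<real>\<^sub>\<ge>\<^sub>0 \<Longrightarrow> z = complex_of_real (Re z) \<and> 0 \<le> Re z"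
  by (simp add: complex_nonneg_Reals_iff complex_eq_iff)

lemma set_integral_nonneg_Reals:
  assumes "\<And>\<theta>. q \<theta> \<in> \<real>\<^sub>\<ge>\<^sub>0"
  shows "(LINT \<theta>:A|lborel. q \<theta>) \<in> (\<real>\<^sub>\<ge>\<^sub>0 :: complex set)"
proof -
  have "(LINT \<theta>:A|lborel. q \<theta>) = (LINT \<theta>:A|lborel. complex_of_real (Re (q \<theta>)))"
    using nonneg_Reals_eq_of_real[OF assms] by metis
  also have "\<dots> = complex_of_real (LINT \<theta>:A|lborel. Re (q \<theta>))" by (rule set_integral_complex_of_real)
  also have "\<dots> \<in> \<real>\<^sub>\<ge>\<^sub>0"
    using nonneg_Reals_eq_of_real[OF assms]
    by (auto simp: set_lebesgue_integral_def intro!: Bochner_Integration.integral_nonneg)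
  finally show ?thesis .
qed

lemma set_integral_sum:
  assumes "\<And>i. i \<in> I \<Longrightarrow> set_integrable M A (f i)"
  shows "(LINT x:A|M. (\<Sum>i\<in>I. f i x :: complex)) = (\<Sum>i\<in>I. LINT x:A|M. f i x)"
    and "set_integrable M A (\<lambda>x. \<Sum>i\<in>I. f i x)"
  using assms unfolding set_lebesgue_integral_def set_integrable_def
  by (simp_all add: scaleR_sum_right)

text \<open>At each point, evaluating the matrix of lower symbols on scalars amounts to evaluating the matrix
  of operators on multiples of one coherent vector. Integration preserves positivity.\<close>

lemma symbol_positive:
  assumes X: "\<And>i j. i < m \<Longrightarrow> j < m \<Longrightarrow> X i j \<in> Toeplitz_sys n" and pos: "mat_positive (H_trunc n) L2_inner m X"
  shows "mat_positive L2_circle L2_inner m (\<lambda>i j. symbol_op n (X i j))"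
  unfolding mat_positive_def
proof (intro allI impI)
  fix h assume "\<forall>i<m. h i \<in> L2_circle"
  then have h: "h i \<in> L2_circle" if "i < m" for i using that by blast
  let ?v = "coherent n"
  let ?q = "\<lambda>i j \<theta>. lower_symbol n (X i j) \<theta> * h j \<theta> * cnj (h i \<theta>)"
  have symbol_C: "lower_symbol n (X i j) \<in> C_circle" if "i < m" "j < m" for i j
    using X[OF that] Cinf_subset_C[OF fejer_Cinf] by (auto simp: Toeplitz_sys_eq)
  have int: "set_integrable lborel {0..2*pi} (?q i j)" if "i < m" "j < m" for i j
    using that by (intro L2_prod_integrable L2_mult symbol_C h)
  have pointwise: "(\<Sum>i<m. \<Sum>j<m. ?q i j \<theta>) \<in> \<real>\<^sub>\<ge>\<^sub>0" for \<theta>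
  proof -
    define w where "w i = (\<lambda>s. h i \<theta> * ?v \<theta> s)" for i
    have w: "w i \<in> H_trunc n" for i unfolding w_def by (rule H_trunc_scale[OF coherent_H])
    have "?q i j \<theta> = L2_inner (X i j (w j)) (w i) / of_nat n" if ij: "i < m" "j < m" for i j
    proof -
      obtain f where f: "f \<in> C_circle" "X i j = toep n f" using X[OF ij] by (auto simp: Toeplitz_sys_eq)
      have "X i j (w j) = (\<lambda>s. h j \<theta> * X i j (?v \<theta>) s)"
        using bounded_op_toep[OF f(1)] coherent_H unfolding bounded_op_def w_def f(2) by blast
      then show ?thesis
        unfolding w_def by (simp add: L2_inner_scale_left L2_inner_scale_right lower_symbol_def)
    qed
    then have "(\<Sum>i<m. \<Sum>j<m. ?q i j \<theta>) = (\<Sum>i<m. \<Sum>j<m. L2_inner (X i j (w j)) (w i)) / of_nat n"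
      by (simp add: sum_divide_distrib)
    also have "\<dots> \<in> \<real>\<^sub>\<ge>\<^sub>0"
      using pos w unfolding mat_positive_def by (intro nonneg_Reals_divide_I) simp_all
    finally show ?thesis .
  qed
  have "(\<Sum>i<m. \<Sum>j<m. L2_inner (symbol_op n (X i j) (h j)) (h i))
    = (\<Sum>i<m. \<Sum>j<m. LINT \<theta>:{0..2*pi}|lborel. ?q i j \<theta>) / complex_of_real (2 * pi)"
    unfolding sum_divide_distrib using h
    by (intro sum.cong refl) (simp add: symbol_op_def mult_op_apply L2_inner_def)
  also have "(\<Sum>i<m. \<Sum>j<m. LINT \<theta>:{0..2*pi}|lborel. ?q i j \<theta>) = (LINT \<theta>:{0..2*pi}|lborel. \<Sum>i<m. \<Sum>j<m. ?q i j \<theta>)"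
  proof -
    have "(LINT \<theta>:{0..2*pi}|lborel. \<Sum>i<m. \<Sum>j<m. ?q i j \<theta>) = (\<Sum>i<m. LINT \<theta>:{0..2*pi}|lborel. \<Sum>j<m. ?q i j \<theta>)"
      by (intro set_integral_sum int) auto
    also have "\<dots> = (\<Sum>i<m. \<Sum>j<m. LINT \<theta>:{0..2*pi}|lborel. ?q i j \<theta>)"
      by (intro sum.cong refl set_integral_sum int) auto
    finally show ?thesis ..
  qed
  finally show "(\<Sum>i<m. \<Sum>j<m. L2_inner (symbol_op n (X i j) (h j)) (h i)) \<in> \<real>\<^sub>\<ge>\<^sub>0"
    using set_integral_nonneg_Reals[of "\<lambda>\<theta>. \<Sum>i<m. \<Sum>j<m. ?q i j \<theta>", OF pointwise]
    by (simp only: nonneg_Reals_divide_I nonneg_Reals_of_real_iff pi_ge_zero mult_nonneg_nonneg zero_le_numeral)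
qed

lemma compress_ball:
  assumes "T \<in> C_ball"
  shows "compress n T \<in> Toeplitz_ball n"
proof -
  obtain f where f: "f \<in> Cinf_circle" and T: "T = mult_op f" and op: "op_norm L2_circle (mult_op f) \<le> 1"
    and lip: "op_norm Cinf_circle (mult_op (dsymbol f)) \<le> 1" using assms by (rule C_ballE)
  note fC = Cinf_subset_C[OF f]
  have "op_norm (H_trunc n) (toep n f) \<le> op_norm L2_circle (mult_op f)"
    by (rule op_norm_toep_le_mult[OF fC subset_refl L2_scale])
      (auto intro: H_trunc_L2 C_circle_subset_L2 C_circle_const)
  moreover have "op_norm (H_trunc n) (toep n (dsymbol f)) \<le> op_norm Cinf_circle (mult_op (dsymbol f))"
    by (rule op_norm_toep_le_mult[OF dsymbol_C[OF f] _ Cinf_scale])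
      (auto intro: H_trunc_Cinf Cinf_subset_L2 Cinf_const)
  ultimately show ?thesis
    using op lip fC by (auto simp: T compress_mult lip_ball_def Toeplitz_sys_eq lip_Toeplitz_toep[OF f])
qed

text \<open>The lower symbol is bounded by the norm, and \<open>- \<i>\<close> times its derivative is the lower symbol of
  the commutator.\<close>

lemma symbol_ball:
  assumes n: "n \<ge> 1" and "T \<in> Toeplitz_ball n"
  shows "symbol_op n T \<in> C_ball"
proof -
  obtain f where f: "f \<in> Cinf_circle" and T: "T = toep n f" and op: "op_norm (H_trunc n) (toep n f) \<le> 1"
    and lip: "op_norm (H_trunc n) (toep n (dsymbol f)) \<le> 1" using assms(2) by (rule Toeplitz_ballE)
  have le: "cmod (fejer n u \<theta>) \<le> op_norm (H_trunc n) (toep n u)" if "u \<in> C_circle" for u \<theta>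
    by (intro lower_symbol_le[OF n] bounded_op_toep that H_trunc_L2[OF toep_mem_H[OF that coherent_H]])
  have "cmod (fejer n f \<theta>) \<le> 1" "cmod (dsymbol (fejer n f) \<theta>) \<le> 1" for \<theta>
    unfolding dsymbol_fejer[OF f]
    using order_trans[OF le[OF Cinf_subset_C[OF f]] op] order_trans[OF le[OF dsymbol_C[OF f]] lip] by blast+
  then show ?thesis
    unfolding T symbol_op_def by (intro C_ballI fejer_Cinf Cinf_subset_C f)
qed

context ball_sequence
begin

text \<open>The pullbacks \<open>F\<close> along \<open>compress n\<close> and \<open>G\<close> along \<open>symbol_op n\<close> are nonexpansive because these maps
  preserve the Lipschitz balls. On the balls, the composites in the two orders differ from the
  identity by the errors estimated in \<open>toep_fejer_approx\<close> and in the hypothesis \<open>fejer\<close>.\<close>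

lemma GH_dist_UCP_le:
  assumes n: "n \<ge> 1" and e: "0 < \<epsilon>" "1 / sqrt n \<le> \<epsilon>"
    and fejer: "\<And>f \<theta>. f \<in> Cinf_circle \<Longrightarrow> (\<And>\<theta>. cmod (dsymbol f \<theta>) \<le> 1) \<Longrightarrow> cmod (fejer n f \<theta> - f \<theta>) \<le> \<epsilon>"
  shows "GH_dist (UCP (H_trunc n) (Toeplitz_sys n) :: (circle_op \<Rightarrow> 'k \<Rightarrow> 'k) set)
      (UCP_dist k (H_trunc n) (Toeplitz_sys n) (Toeplitz_sys n) (lip_Toeplitz n))
      (UCP L2_circle C_sys :: (circle_op \<Rightarrow> 'k \<Rightarrow> 'k) set) (UCP_dist k L2_circle C_sys Cinf_sys lip_C)
    \<le> ennreal (2 * \<epsilon>)"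
proof -
  note sys = lip_system_Toeplitz[OF n] lip_system_C
  interpret T: lip_system k "H_trunc n" "Toeplitz_sys n" "Toeplitz_sys n" "lip_Toeplitz n" by (rule sys(1))
  interpret C: lip_system k L2_circle C_sys Cinf_sys lip_C by (rule sys(2))
  define F where "F \<psi> = restrict (\<lambda>T. \<psi> (compress n T)) C_sys" for \<psi> :: "circle_op \<Rightarrow> 'k \<Rightarrow> 'k"
  define G where "G \<phi> = restrict (\<lambda>T. \<phi> (symbol_op n T)) (Toeplitz_sys n)" for \<phi> :: "circle_op \<Rightarrow> 'k \<Rightarrow> 'k"
  have compress_mem: "compress n T \<in> Toeplitz_sys n" if "T \<in> C_sys" for T
    using that by (auto simp: C_sys_def Toeplitz_sys_eq compress_mult)
  have symbol_mem: "symbol_op n T \<in> C_sys" if "T \<in> Toeplitz_sys n" for T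
    using that by (auto simp: C_sys_def Toeplitz_sys_eq symbol_op_def Cinf_subset_C fejer_Cinf)
  have F: "F \<psi> \<in> UCP L2_circle C_sys" if "\<psi> \<in> UCP (H_trunc n) (Toeplitz_sys n)" for \<psi>
    unfolding F_def
  proof (rule UCP_pullback[OF that compress_mem])
    show "compress n (\<lambda>g \<theta>. S g \<theta> + T g \<theta>) = (\<lambda>g \<theta>. compress n S g \<theta> + compress n T g \<theta>)"
      if "S \<in> C_sys" "T \<in> C_sys" for S T
      using that by (auto simp: C_sys_def compress_mult mult_op_add[symmetric] toep_add)
    show "compress n (\<lambda>g \<theta>. c * T g \<theta>) = (\<lambda>g \<theta>. c * compress n T g \<theta>)" if "T \<in> C_sys" for c T
      using that by (auto simp: C_sys_def compress_mult mult_op_scale[symmetric] toep_scale)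
    show "compress n (op_on L2_circle id) = op_on (H_trunc n) id"
      unfolding mult_op_one[symmetric] compress_mult by (rule toep_one)
  qed (auto intro: compress_positive C.E_add C.E_scale C.E_unit)
  have G: "G \<phi> \<in> UCP (H_trunc n) (Toeplitz_sys n)" if "\<phi> \<in> UCP L2_circle C_sys" for \<phi>
    unfolding G_def
  proof (rule UCP_pullback[OF that symbol_mem])
    have L2: "T (coherent n \<theta>) \<in> L2_circle" if "T \<in> Toeplitz_sys n" for T \<theta>
      using that coherent_H by (rule T.E_maps)
    show "symbol_op n (\<lambda>g \<theta>. S g \<theta> + T g \<theta>) = (\<lambda>g \<theta>. symbol_op n S g \<theta> + symbol_op n T g \<theta>)"
      if "S \<in> Toeplitz_sys n" "T \<in> Toeplitz_sys n" for S T
    proof -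
      have "lower_symbol n (\<lambda>g \<theta>. S g \<theta> + T g \<theta>) = (\<lambda>\<theta>. lower_symbol n S \<theta> + lower_symbol n T \<theta>)"
        by (rule ext) (simp add: lower_symbol_def L2_inner_add_left[OF L2[OF that(1)] L2[OF that(2)] coherent_L2] add_divide_distrib)
      then show ?thesis by (simp add: symbol_op_def mult_op_add)
    qed
    show "symbol_op n (\<lambda>g \<theta>. c * T g \<theta>) = (\<lambda>g \<theta>. c * symbol_op n T g \<theta>)" for c T
    proof -
      have "lower_symbol n (\<lambda>g \<theta>. c * T g \<theta>) = (\<lambda>\<theta>. c * lower_symbol n T \<theta>)"
        by (rule ext) (simp add: lower_symbol_def L2_inner_scale_left)
      then show ?thesis by (simp add: symbol_op_def mult_op_scale)
    qed
    have "lower_symbol n (op_on (H_trunc n) id) = (\<lambda>\<theta>. 1)"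
      using n coherent_H[of n]
      by (intro ext) (simp add: lower_symbol_def op_on_def L2_inner_self L2_norm_coherent del: of_real_power)
    then show "symbol_op n (op_on (H_trunc n) id) = op_on L2_circle id"
      by (simp add: symbol_op_def mult_op_one)
  qed (auto intro: symbol_positive T.E_add T.E_scale T.E_unit)
  show ?thesis
  proof (rule GH_dist_le[OF T.compact_metric_UCP C.compact_metric_UCP F G _ _ _ _ e(1)])
    fix \<psi> :: "circle_op \<Rightarrow> 'k \<Rightarrow> 'k" assume \<psi>: "\<psi> \<in> UCP (H_trunc n) (Toeplitz_sys n)"
    show "C.udist (F \<psi>) (F \<psi>') \<le> T.udist \<psi> \<psi>'" if \<psi>': "\<psi>' \<in> UCP (H_trunc n) (Toeplitz_sys n)" for \<psi>'
      using F[OF \<psi>] F[OF \<psi>'] unfolding F_def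
      by (intro UCP_dist_pullback_le[OF sys] \<psi> \<psi>' compress_ball)
    show "T.udist \<psi> (G (F \<psi>)) \<le> \<epsilon>"
    proof (rule T.UCP_dist_near[OF \<psi> G[OF F[OF \<psi>]]])
      fix T assume "T \<in> Toeplitz_ball n"
      then obtain f where f: "f \<in> Cinf_circle" and T: "T = toep n f"
        and lip: "op_norm (H_trunc n) (toep n (dsymbol f)) \<le> 1" by (rule Toeplitz_ballE)
      note FC = Cinf_subset_C[OF fejer_Cinf[OF Cinf_subset_C[OF f]], of n]
      have "T \<in> Toeplitz_sys n" "mult_op (fejer n f) \<in> C_sys"
        using Cinf_subset_C[OF f] FC by (auto simp: T Toeplitz_sys_eq C_sys_def)
      then have "G (F \<psi>) T = \<psi> (toep n (fejer n f))"
        by (simp add: F_def G_def symbol_op_def compress_mult T)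
      moreover have "op_norm (H_trunc n) (\<lambda>g \<theta>. T g \<theta> - toep n (fejer n f) g \<theta>) \<le> \<epsilon>"
        using toep_fejer_approx[OF f n lip] e(2) by (simp add: T)
      ultimately show "\<exists>S\<in>Toeplitz_sys n. G (F \<psi>) T = \<psi> S \<and> op_norm (H_trunc n) (\<lambda>g \<theta>. T g \<theta> - S g \<theta>) \<le> \<epsilon>"
        using FC by (auto simp: Toeplitz_sys_eq)
    qed
  next
    fix \<phi> :: "circle_op \<Rightarrow> 'k \<Rightarrow> 'k" assume \<phi>: "\<phi> \<in> UCP L2_circle C_sys"
    show "T.udist (G \<phi>) (G \<phi>') \<le> C.udist \<phi> \<phi>'" if \<phi>': "\<phi>' \<in> UCP L2_circle C_sys" for \<phi>'
      using G[OF \<phi>] G[OF \<phi>'] unfolding G_def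
      by (intro UCP_dist_pullback_le[OF sys(2,1)] \<phi> \<phi>' symbol_ball n)
    have "C.udist \<phi> (F (G \<phi>)) \<le> \<epsilon>"
    proof (rule C.UCP_dist_near[OF \<phi> F[OF G[OF \<phi>]]])
      fix T assume "T \<in> C_ball"
      then obtain f where f: "f \<in> Cinf_circle" and T: "T = mult_op f"
        and lip: "op_norm Cinf_circle (mult_op (dsymbol f)) \<le> 1" by (rule C_ballE)
      note fC = Cinf_subset_C[OF f]
      note FC = Cinf_subset_C[OF fejer_Cinf[OF fC], of n]
      have "T \<in> C_sys" "toep n f \<in> Toeplitz_sys n"
        using fC by (auto simp: T Toeplitz_sys_eq C_sys_def)
      then have "F (G \<phi>) T = \<phi> (mult_op (fejer n f))"
        by (simp add: F_def G_def symbol_op_def compress_mult T)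
      moreover have "op_norm L2_circle (mult_op (\<lambda>\<theta>. f \<theta> - fejer n f \<theta>)) \<le> \<epsilon>"
        using fejer[OF f sup_le_op_norm_mult[OF dsymbol_C[OF f] lip]] L2_zero
        by (intro op_norm_mult_le L2_scale C_circle_diff fC FC) (auto simp: norm_minus_commute)
      ultimately show "\<exists>S\<in>C_sys. F (G \<phi>) T = \<phi> S \<and> op_norm L2_circle (\<lambda>g \<theta>. T g \<theta> - S g \<theta>) \<le> \<epsilon>"
        using FC by (auto simp: C_sys_def T mult_op_diff)
    qed
    then show "C.udist (F (G \<phi>)) \<phi> \<le> \<epsilon>"
      using Metric_space.commute[OF C.Metric_space_UCP] by metis
  qed
qed

end

theorem corollary4p2:
  fixes k :: "nat \<Rightarrow> 'k::complex_hilbert"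
  assumes separable: "separable_space (euclidean :: 'k topology)"
    and k_ball: "\<And>p. p \<ge> 1 \<Longrightarrow> k p \<in> cball 0 1"
    and k_dense: "cball 0 1 \<subseteq> closure (k ` {1..})"
  shows "(\<lambda>n. GH_dist
            (UCP (H_trunc n) (Toeplitz_sys n) :: (circle_op \<Rightarrow> 'k \<Rightarrow> 'k) set)
            (UCP_dist k (H_trunc n) (Toeplitz_sys n) (Toeplitz_sys n) (lip_Toeplitz n))
            (UCP L2_circle C_sys :: (circle_op \<Rightarrow> 'k \<Rightarrow> 'k) set)
            (UCP_dist k L2_circle C_sys Cinf_sys lip_C))
         \<longlonglongrightarrow> 0"
proof (rule order_tendstoI)
  let ?d = "\<lambda>n. GH_dist
            (UCP (H_trunc n) (Toeplitz_sys n) :: (circle_op \<Rightarrow> 'k \<Rightarrow> 'k) set)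
            (UCP_dist k (H_trunc n) (Toeplitz_sys n) (Toeplitz_sys n) (lip_Toeplitz n))
            (UCP L2_circle C_sys :: (circle_op \<Rightarrow> 'k \<Rightarrow> 'k) set)
            (UCP_dist k L2_circle C_sys Cinf_sys lip_C)"
  interpret ball_sequence k using k_ball k_dense by unfold_locales
  fix a :: ennreal assume "0 < a"
  then obtain b where b: "0 < b" "b < a" using dense by blast
  then have "b \<noteq> top" by auto
  then obtain r where r: "b = ennreal r" "0 \<le> r" by (cases b) auto
  then have "0 < r" using b(1) by simp
  \<comment> \<open>the distance will be at most \<open>2 * \<epsilon>\<close>\<close>
  define \<epsilon> where "\<epsilon> = r / 2"
  have e: "0 < \<epsilon>" using \<open>0 < r\<close> by (simp add: \<epsilon>_def)
  obtain N where N: "N \<ge> 1" "\<And>n f \<theta>. \<lbrakk>n \<ge> N; f \<in> Cinf_circle; \<And>\<theta>. cmod (dsymbol f \<theta>) \<le> 1\<rbrakk> \<Longrightarrow> cmod (fejer n f \<theta> - f \<theta>) \<le> \<epsilon>"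
    using fejer_converges_lipschitz[OF e] by metis
  \<comment> \<open>this makes \<open>1 / sqrt n\<close> at most \<open>\<epsilon>\<close>\<close>
  obtain N' :: nat where N': "1 / \<epsilon>\<^sup>2 < real N'" using reals_Archimedean2 by blast
  show "eventually (\<lambda>n. ?d n < a) sequentially"
  proof (rule eventually_sequentiallyI[of "max N N'"])
    fix n assume n: "max N N' \<le> n"
    have "1 / sqrt n \<le> \<epsilon>"
    proof -
      have "1 / \<epsilon>\<^sup>2 \<le> real n" using N' n by simp
      then have "1 / \<epsilon> \<le> sqrt n" using e by (intro real_le_rsqrt) (simp add: power_divide)
      then show ?thesis using e n N(1) by (simp add: field_simps)
    qed
    then have "?d n \<le> ennreal (2 * \<epsilon>)"
      using n N e by (intro GH_dist_UCP_le) auto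
    also have "\<dots> < a" using b(2) by (simp add: r \<epsilon>_def)
    finally show "?d n < a" .
  qed
qed simp


end
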